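(* Let $K=[k_{ij}]$ be a real $r\times r$ matrix and $\Lambda=\mathrm{diag}(\lambda_1,\dots,\lambda_r)$ a real diagonal matrix such that: (i) $k_{ij}\ge 0$ whenever $i\ne j$; (ii) $\sum_{i=1}^r k_{ij}=0$ for every $j=1,\dots,r$; (iii) for any $i_0\ne i_1$ in $\{1,\dots,r\}$ there is a sequence of indices $j_1,j_2,\dots,j_l$ with $j_1=i_0$, $j_l=i_1$ and $k_{j_m j_{m+1}}>0$ for $1\le m\le l-1$; (iv) there exist $i,j$ with $\lambda_i\neq\lambda_j$; (v) $\lambda_i>0$ for all $i=1,\dots,r$. Let $U_0:[0,\infty)\to\mathbb{R}^r$ be given initial data and let $B(x)=\Lambda^{-1}\exp(K\Lambda^{-1}x)\Lambda U_0(0)$ for $x\ge 0$, which is the solution of $\Lambda B_x=KB$ with $B(0)=U_0(0)$. Suppose that $U_0-B\in H^2(\mathbb{R}_+;\mathbb{R}^r)$ and that $\Lambda U_{0x}(0)=KU_0(0)$. Then the initial-boundary-value problem $$U_t+\Lambda U_x=KU\quad (x,t\ge 0),\qquad U|_{t=0}=U_0(x),\qquad U|_{x=0}=U_0(0)$$ has a unique global solution $U$ with $U-B\in C([0,\infty);H^2(\mathbb{R}_+;\mathbb{R}^r))$, and this solution satisfies $$\lim_{t\to\infty}\ \sup_{x\in\mathbb{R}_+}|U(x,t)-B(x)|=0.$$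
   Context: Here $\mathbb{R}_+=(0,\infty)$ is the half-line in the space variable $x$, and $U=U(x,t)=(u_1,\dots,u_r)^T$ takes values in $\mathbb{R}^r$. Subscripts $t,x$ denote partial derivatives, and $U_{0x}$ is the derivative of $U_0$. $H^2$ is the usual $L^2$-based Sobolev space; since $U_0-B\in H^2(\mathbb{R}_+;\mathbb{R}^r)$ and $B$ is smooth, $U_0$ is identified with its $C^1$ representative on $[0,\infty)$, so that $U_0(0)$ and $U_{0x}(0)$ make sense. A steady solution is a solution $B=B(x)$ of $\Lambda B_x=KB$. *)

theory Defs
  imports "HOL-Analysis.Analysis"
begin

subsection \<open>Matrices\<close>

definition diag_matrix :: "real ^ 'n \<Rightarrow> real ^ 'n ^ 'n" where
  "diag_matrix l = (\<chi> i j. if i = j then l $ i else 0)"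

(* The class multiplication on real ^ 'n ^ 'n is the componentwise one, so neither the
   class-based power nor exp is the matrix operation. *)
primrec mat_power :: "real ^ 'n ^ 'n \<Rightarrow> nat \<Rightarrow> real ^ 'n ^ 'n" where
  "mat_power A 0 = mat 1"
| "mat_power A (Suc n) = A ** mat_power A n"

definition mat_exp :: "real ^ 'n ^ 'n \<Rightarrow> real ^ 'n ^ 'n" where
  "mat_exp A = (\<Sum>n. (1 / fact n) *\<^sub>R mat_power A n)"

definition steady_state :: "real ^ 'n ^ 'n \<Rightarrow> real ^ 'n ^ 'n \<Rightarrow> real ^ 'n \<Rightarrow> real \<Rightarrow> real ^ 'n" where
  "steady_state \<Lambda> K b x =
     (matrix_inv \<Lambda> ** mat_exp (x *\<^sub>R (K ** matrix_inv \<Lambda>)) ** \<Lambda>) *v b"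

lemma mat_power_bound:
  fixes A :: "real ^ 'n ^ 'n"
  obtains C where "\<And>n i j. \<bar>mat_power A n $ i $ j\<bar> \<le> C ^ n"
proof -
  define M where "M = (\<Sum>i\<in>UNIV. \<Sum>j\<in>UNIV. \<bar>A $ i $ j\<bar>)"
  have "\<bar>mat_power A n $ i $ j\<bar> \<le> M ^ n" for n i j
  proof (induction n arbitrary: i j)
    case 0
    show ?case by (simp add: mat_def)
  next
    case (Suc n)
    have "\<bar>mat_power A (Suc n) $ i $ j\<bar> \<le> (\<Sum>k\<in>UNIV. \<bar>A $ i $ k * mat_power A n $ k $ j\<bar>)"
      by (simp add: matrix_matrix_mult_def sum_abs)
    also have "\<dots> \<le> (\<Sum>k\<in>UNIV. \<bar>A $ i $ k\<bar> * M ^ n)"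
      by (intro sum_mono) (simp add: abs_mult mult_left_mono Suc)
    also have "\<dots> = (\<Sum>k\<in>UNIV. \<bar>A $ i $ k\<bar>) * M ^ n"
      by (simp add: sum_distrib_right)
    also have "\<dots> \<le> M * M ^ n"
    proof (rule mult_right_mono)
      show "(\<Sum>k\<in>UNIV. \<bar>A $ i $ k\<bar>) \<le> M"
        unfolding M_def
        by (rule member_le_sum[where f = "\<lambda>i. \<Sum>j\<in>UNIV. \<bar>A $ i $ j\<bar>"]) (auto intro: sum_nonneg)
      show "0 \<le> M ^ n" by (simp add: M_def sum_nonneg)
    qed
    finally show ?case by simp
  qed
  then show ?thesis using that by blast
qed

lemma mat_power_scaleR: "mat_power (x *\<^sub>R A) n = x ^ n *\<^sub>R mat_power A n"
  by (induction n)
     (simp_all add: matrix_matrix_mult_def vec_eq_iff sum_distrib_left mult_ac)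

lemma mat_exp_entry:
  fixes A :: "real ^ 'n ^ 'n"
  shows "(\<lambda>n. mat_power A n $ i $ j / fact n * x ^ n) sums (mat_exp (x *\<^sub>R A) $ i $ j)"
proof -
  obtain C where C: "\<And>n i j. \<bar>mat_power A n $ i $ j\<bar> \<le> C ^ n"
    using mat_power_bound by blast
  have summ: "summable (\<lambda>n. mat_power A n $ i $ j / fact n * x ^ n)" for i j
  proof (rule summable_comparison_test')
    show "summable (\<lambda>n. (C * \<bar>x\<bar>) ^ n /\<^sub>R fact n)"
      by (rule summable_exp_generic)
    show "norm (mat_power A n $ i $ j / fact n * x ^ n) \<le> (C * \<bar>x\<bar>) ^ n /\<^sub>R fact n" for n
      using mult_right_mono[OF C[of n i j], of "\<bar>x\<bar> ^ n / fact n"]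
      by (simp add: abs_mult power_abs power_mult_distrib field_simps)
  qed
  define S where "S = (\<chi> i j. \<Sum>n. mat_power A n $ i $ j / fact n * x ^ n)"
  have "(\<lambda>n. (1 / fact n) *\<^sub>R mat_power (x *\<^sub>R A) n) sums S"
    unfolding sums_def
  proof (intro vec_tendstoI)
    fix i j
    show "(\<lambda>N. (\<Sum>n<N. (1 / fact n) *\<^sub>R mat_power (x *\<^sub>R A) n) $ i $ j) \<longlonglongrightarrow> S $ i $ j"
      using summable_LIMSEQ[OF summ[of i j]] by (simp add: S_def mat_power_scaleR mult_ac)
  qed
  then have "mat_exp (x *\<^sub>R A) = S"
    unfolding mat_exp_def by (simp add: sums_iff)
  then show ?thesis
    using summable_sums[OF summ[of i j]] by (simp add: S_def)
qed

lemma mat_exp_entry_deriv: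
  fixes A :: "real ^ 'n ^ 'n"
  shows "((\<lambda>x. mat_exp (x *\<^sub>R A) $ i $ j) has_real_derivative
            (A ** mat_exp (x *\<^sub>R A)) $ i $ j) (at x)"
proof -
  let ?c = "\<lambda>i j n. mat_power A n $ i $ j / fact n"
  have eq: "mat_exp (x *\<^sub>R A) $ i $ j = (\<Sum>n. ?c i j n * x ^ n)" for x i j
    using mat_exp_entry by (rule sums_unique)
  have "((\<lambda>x. \<Sum>n. ?c i j n * x ^ n) has_real_derivative (\<Sum>n. diffs (?c i j) n * x ^ n)) (at x)"
    by (rule termdiffs_strong_converges_everywhere) (rule sums_summable[OF mat_exp_entry])
  moreover have "(\<lambda>n. diffs (?c i j) n * x ^ n) sums ((A ** mat_exp (x *\<^sub>R A)) $ i $ j)"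
  proof -
    have "(\<lambda>n. \<Sum>k\<in>UNIV. A $ i $ k * (?c k j n * x ^ n)) sums
            (\<Sum>k\<in>UNIV. A $ i $ k * mat_exp (x *\<^sub>R A) $ k $ j)"
      by (intro sums_sum sums_mult mat_exp_entry)
    moreover have "diffs (?c i j) n * x ^ n = (\<Sum>k\<in>UNIV. A $ i $ k * (?c k j n * x ^ n))" for n
    proof -
      have "diffs (?c i j) n = mat_power A (Suc n) $ i $ j / fact n"
        by (simp add: diffs_def del: mat_power.simps of_nat_Suc)
      then show ?thesis
        by (simp add: matrix_matrix_mult_def sum_distrib_right sum_divide_distrib mult.assoc)
    qed
    ultimately show ?thesis by (simp add: matrix_matrix_mult_def)
  qed
  ultimately show ?thesis by (simp add: eq sums_iff)
qed

lemma steady_state_solves: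
  fixes \<Lambda> K :: "real ^ 'n ^ 'n"
  assumes "invertible \<Lambda>"
  obtains D where "\<And>x. (steady_state \<Lambda> K b has_vector_derivative D x) (at x)"
    and "\<And>x. \<Lambda> *v D x = K *v steady_state \<Lambda> K b x"
    and "steady_state \<Lambda> K b 0 = b"
proof
  let ?A = "K ** matrix_inv \<Lambda>"
  let ?E = "\<lambda>x. mat_exp (x *\<^sub>R ?A)"
  let ?D = "\<lambda>x. (matrix_inv \<Lambda> ** (?A ** ?E x) ** \<Lambda>) *v b"
  have inv: "\<Lambda> ** matrix_inv \<Lambda> = mat 1" "matrix_inv \<Lambda> ** \<Lambda> = mat 1"
    using someI_ex[OF assms[unfolded invertible_def]] by (simp_all add: matrix_inv_def)
  have E: "(?E has_derivative (\<lambda>h. h *\<^sub>R (?A ** ?E x))) (at x)" for x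
  proof (subst has_derivative_componentwise_within, rule ballI)
    fix e :: "real ^ 'n ^ 'n"
    assume "e \<in> Basis"
    then obtain i j where e: "e = axis i (axis j 1)"
      by (auto simp: Basis_vec_def)
    have "((\<lambda>x. ?E x $ i $ j) has_derivative (\<lambda>h. (?A ** ?E x) $ i $ j * h)) (at x)"
      using mat_exp_entry_deriv unfolding has_field_derivative_def .
    then show "((\<lambda>x. ?E x \<bullet> e) has_derivative (\<lambda>h. h *\<^sub>R (?A ** ?E x) \<bullet> e)) (at x)"
      by (simp add: e inner_axis mult.commute)
  qed
  define f where "f M = (matrix_inv \<Lambda> ** M ** \<Lambda>) *v b" for M
  have rdistrib: "(M + N) ** L = M ** L + N ** L" for M N L :: "real ^ 'n ^ 'n"
    by (simp add: matrix_matrix_mult_def vec_eq_iff distrib_right sum.distrib)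
  have f: "linear f"
    by (rule linearI)
       (simp_all add: f_def matrix_add_ldistrib rdistrib matrix_vector_mult_add_rdistrib
          matrix_scalar_ac scalar_matrix_assoc scaleR_matrix_vector_assoc)
  have fE: "steady_state \<Lambda> K b = (\<lambda>x. f (?E x))"
    by (rule ext) (simp add: steady_state_def f_def)
  have "((\<lambda>x. f (?E x)) has_derivative (\<lambda>h. f (h *\<^sub>R (?A ** ?E x)))) (at x)" for x
    by (rule bounded_linear.has_derivative[OF linear_conv_bounded_linear[THEN iffD1, OF f] E])
  then have "(steady_state \<Lambda> K b has_vector_derivative f (?A ** ?E x)) (at x)" for x
    by (simp only: fE has_vector_derivative_def linear_cmul[OF f])
  then show "(steady_state \<Lambda> K b has_vector_derivative ?D x) (at x)" for x
    by (simp only: f_def)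
  show "\<Lambda> *v ?D x = K *v steady_state \<Lambda> K b x" for x
    using inv by (simp add: steady_state_def matrix_vector_mul_assoc matrix_mul_assoc)
  have "mat_exp (0 :: real ^ 'n ^ 'n) = mat 1"
  proof -
    have "mat_exp (0 *\<^sub>R ?A) $ i $ j = mat 1 $ i $ j" for i j
      using mat_exp_entry[of ?A i j 0] powser_sums_zero_iff[of "\<lambda>n. mat_power ?A n $ i $ j / fact n"]
      by simp
    then show ?thesis by (simp add: vec_eq_iff)
  qed
  then show "steady_state \<Lambda> K b 0 = b"
    using inv by (simp add: steady_state_def)
qed

subsection \<open>The Sobolev space of order two on an open subset of the line\<close>

definition L2_on :: "real set \<Rightarrow> (real \<Rightarrow> 'a::euclidean_space) \<Rightarrow> bool" where
  "L2_on S f \<longleftrightarrow> f \<in> borel_measurable (lebesgue_on S) \<and>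
     integrable (lebesgue_on S) (\<lambda>x. (norm (f x))\<^sup>2)"

definition test_function :: "real set \<Rightarrow> (real \<Rightarrow> real) \<Rightarrow> bool" where
  "test_function S \<phi> \<longleftrightarrow>
     (\<forall>n x. (deriv ^^ n) \<phi> field_differentiable at x) \<and>
     compact (closure {x. \<phi> x \<noteq> 0}) \<and> closure {x. \<phi> x \<noteq> 0} \<subseteq> S"

(* g is an L2 weak derivative of order k of f. It is only used for f in L2, so that both
   integrals converge. *)
definition weak_derivative_on ::
  "real set \<Rightarrow> nat \<Rightarrow> (real \<Rightarrow> 'a::euclidean_space) \<Rightarrow> (real \<Rightarrow> 'a) \<Rightarrow> bool" where
  "weak_derivative_on S k f g \<longleftrightarrow> L2_on S g \<and>
     (\<forall>\<phi>. test_function S \<phi> \<longrightarrow>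
        (\<integral>x. (deriv ^^ k) \<phi> x *\<^sub>R f x \<partial>lebesgue_on S) =
        (-1) ^ k *\<^sub>R (\<integral>x. \<phi> x *\<^sub>R g x \<partial>lebesgue_on S))"

definition H2_on :: "real set \<Rightarrow> (real \<Rightarrow> 'a::euclidean_space) \<Rightarrow> bool" where
  "H2_on S f \<longleftrightarrow> L2_on S f \<and> (\<forall>k\<in>{1,2}. \<exists>g. weak_derivative_on S k f g)"

(* Weak derivatives are unique almost everywhere, so the choice does not affect the norm. *)
definition weak_deriv :: "real set \<Rightarrow> nat \<Rightarrow> (real \<Rightarrow> 'a::euclidean_space) \<Rightarrow> real \<Rightarrow> 'a" where
  "weak_deriv S k f = (SOME g. weak_derivative_on S k f g)"

definition H2_norm :: "real set \<Rightarrow> (real \<Rightarrow> 'a::euclidean_space) \<Rightarrow> real" where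
  "H2_norm S f = sqrt (\<Sum>k\<le>2. \<integral>x. (norm (weak_deriv S k f x))\<^sup>2 \<partial>lebesgue_on S)"

(* The space C([0, \<infinity>); H2(S)), with time as the first argument. *)
definition continuous_into_H2 :: "real set \<Rightarrow> (real \<Rightarrow> real \<Rightarrow> 'a::euclidean_space) \<Rightarrow> bool" where
  "continuous_into_H2 S W \<longleftrightarrow> (\<forall>t\<ge>0. H2_on S (W t)) \<and>
     (\<forall>t\<ge>0. ((\<lambda>s. H2_norm S (\<lambda>x. W s x - W t x)) \<longlongrightarrow> 0) (at t within {0..}))"

subsection \<open>The initial-boundary-value problem\<close>

(* The equation holds pointwise on the closed quadrant, with one-sided derivatives on its
   boundary. In particular each U(-, t) is continuous, hence is the continuously
   differentiable representative of its H2 class (up to the smooth function B). *)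
definition ibvp_solution ::
  "real ^ 'n ^ 'n \<Rightarrow> real ^ 'n ^ 'n \<Rightarrow> (real \<Rightarrow> real ^ 'n) \<Rightarrow> (real \<Rightarrow> real \<Rightarrow> real ^ 'n) \<Rightarrow> bool" where
  "ibvp_solution \<Lambda> K U\<^sub>0 U \<longleftrightarrow>
     (\<forall>x\<ge>0. \<forall>t\<ge>0. \<exists>Ut Ux.
        ((\<lambda>s. U x s) has_vector_derivative Ut) (at t within {0..}) \<and>
        ((\<lambda>y. U y t) has_vector_derivative Ux) (at x within {0..}) \<and>
        Ut + \<Lambda> *v Ux = K *v U x t) \<and>
     (\<forall>x\<ge>0. U x 0 = U\<^sub>0 x) \<and>
     (\<forall>t\<ge>0. U 0 t = U\<^sub>0 0)"

end

theory Submission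
  imports Defs "HOL-Computational_Algebra.Polynomial"
begin

text \<open>
  Subtract the steady state: \<open>u = U - B\<close> solves the homogeneous system
  \<open>u\<^sub>t + \<Lambda> u\<^sub>x = K u\<close> with zero boundary values, and the compatibility condition says that both
  \<open>u\<close> and \<open>u\<^sub>x\<close> vanish at the corner.  Extended by zero to \<open>x \<le> 0\<close> the initial data therefore stay \<open>C1\<close>
  (\<open>zero_extension_has_derivative\<close>), and because all speeds are positive nothing ever enters \<open>x \<le> 0\<close>.
  The boundary disappears and a Cauchy problem on the whole line remains.

  The Perron vector \<open>w > 0\<close> with \<open>K w = 0\<close> (\<open>perron_vector\<close>) makes the system a weighted Markovian
  transport equation.  The equation is integrated along characteristics (\<open>mild\<close>).  Existence is a
  contraction argument (\<open>mild_exists\<close>), and nonnegativity of the off-diagonal entries gives a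
  maximum principle relative to \<open>w\<close> with constants that do not depend on time
  (\<open>maximum_principle\<close>).  It carries uniqueness, finite speed of propagation, differentiability in
  \<open>x\<close> and the passage to limits in the data.

  Decay comes from an energy argument in the style of Shizuta and Kawashima.  For \<open>C2\<close> compactly
  supported data the weighted energy \<open>\<Sum>\<^sub>i u\<^sub>i\<^sup>2 / w\<^sub>i\<close> dissipates the differences \<open>u\<^sub>i / w\<^sub>i - u\<^sub>j / w\<^sub>j\<close>,
  all of them by irreducibility (\<open>dissipation_coercive\<close>), but not their common value.  Two
  different speeds prevent the components from travelling together: the functional
  \<open>\<integral> (u\<^sub>a / w\<^sub>a - u\<^sub>b / w\<^sub>b) \<partial>\<^sub>x u\<^sub>a / w\<^sub>a\<close> with \<open>\<lambda>\<^sub>a > \<lambda>\<^sub>b\<close> dissipates the common part of \<open>u\<^sub>x\<close>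
  (\<open>cross_rate_bound\<close>).  Hence the energy of \<open>u\<^sub>x\<close> is \<open>O(1 / t)\<close> and, by interpolation with the bounded
  energy of \<open>u\<close>, the supremum of \<open>u\<close> tends to zero (\<open>decay_C2\<close>).  The maximum principle extends this to
  continuous square-integrable data that vanish at 0 and at infinity (\<open>decay\<close>).

  Continuity in time with values in H2 is proved for \<open>u\<close>, \<open>u\<^sub>x\<close> and \<open>u\<^sub>x\<^sub>x\<close> separately.  Each of them is
  a limit in \<open>L2\<close>, uniformly in time, of flows of \<open>C2\<close> compactly supported data, because the energy
  estimate bounds the flow on \<open>L2\<close> (\<open>L2_flow\<close>).  The second derivative of the data is only in \<open>L2\<close>;
  its flow is tied to that of the first derivative through primitives (\<open>mild_primitive\<close>).

  The weak derivatives are made concrete by the fundamental lemma of the calculus of variations: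
  an H2 function that is differentiable has a derivative that is the primitive of an \<open>L2\<close> function
  (\<open>H2_on_regular\<close>), and conversely (\<open>H2_on_primitive\<close>).  Together with the embedding of H2 into
  \<open>C1\<close> this also yields uniqueness, as every competitor is again a mild solution
  (\<open>H2_solution_is_mild\<close>).
\<close>

section \<open>Smooth test functions\<close>

text \<open>Smoothness as it occurs in \<open>test_function\<close>, by iterated \<open>deriv\<close>.\<close>

definition smooth :: "(real \<Rightarrow> real) \<Rightarrow> bool" where
  "smooth f \<longleftrightarrow> (\<forall>n x. (deriv ^^ n) f field_differentiable at x)"

text \<open>The iterated \<open>deriv\<close> is awkward to compute.  It is enough to exhibit a family of differentiable
  functions that is closed under \<open>deriv\<close>.\<close>

lemma smooth_coinduct:
  assumes "f \<in> X"
    and step: "\<And>f. f \<in> X \<Longrightarrow> (\<forall>x. f field_differentiable at x) \<and> deriv f \<in> X"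
  shows "smooth f"
proof -
  have "(deriv ^^ n) f \<in> X" for n
    by (induction n) (use assms in auto)
  then show ?thesis using step by (auto simp: smooth_def)
qed

lemma smooth_deriv: "smooth f \<Longrightarrow> smooth (deriv f)"
  unfolding smooth_def by (metis funpow_swap1 funpow.simps(2) comp_apply)

lemma smooth_if_deriv:
  assumes "\<And>x. (f has_real_derivative g x) (at x)" "smooth g"
  shows "smooth f"
proof -
  have d: "deriv f = g" using assms(1) by (auto intro: DERIV_imp_deriv)
  have "(deriv ^^ n) f field_differentiable at x" for n x
  proof (cases n)
    case 0 then show ?thesis using assms(1) field_differentiable_def by auto
  next
    case (Suc k)
    then show ?thesis using assms(2) d by (metis smooth_def comp_apply funpow_Suc_right)
  qed
  then show ?thesis by (simp add: smooth_def)
qed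

lemma smooth_has_deriv: "smooth f \<Longrightarrow> (f has_real_derivative deriv f x) (at x)"
  unfolding smooth_def by (metis DERIV_deriv_iff_field_differentiable funpow_0)

lemma smooth_continuous: "smooth f \<Longrightarrow> continuous_on S f"
  by (meson DERIV_isCont continuous_at_imp_continuous_on smooth_has_deriv)

lemma smooth_lincomb:
  assumes "smooth f" "smooth g" shows "smooth (\<lambda>x. a * f x + b * g x)"
proof (rule smooth_coinduct[where X="{\<lambda>x. a * f x + b * g x |f g. smooth f \<and> smooth g}"])
  show "(\<lambda>x. a * f x + b * g x) \<in> {\<lambda>x. a * f x + b * g x |f g. smooth f \<and> smooth g}"
    using assms by blast
next
  fix h assume "h \<in> {\<lambda>x. a * f x + b * g x |f g. smooth f \<and> smooth g}"
  then obtain f g where h: "h = (\<lambda>x. a * f x + b * g x)" and s: "smooth f" "smooth g" by blast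
  have d: "(h has_real_derivative a * deriv f x + b * deriv g x) (at x)" for x
    unfolding h by (auto intro!: derivative_eq_intros smooth_has_deriv s)
  then have "deriv h = (\<lambda>x. a * deriv f x + b * deriv g x)"
    by (auto intro: DERIV_imp_deriv)
  then show "(\<forall>x. h field_differentiable at x) \<and> deriv h \<in> {\<lambda>x. a * f x + b * g x |f g. smooth f \<and> smooth g}"
    using d s smooth_deriv by (auto simp: field_differentiable_def)
qed

text \<open>The parameter \<open>c\<close> controls the height: as \<open>c\<close> tends to zero the bumps increase to the
  indicator of the open interval, so no product or power of smooth functions is needed to
  approximate indicators.\<close>

definition bump :: "real \<Rightarrow> real \<Rightarrow> real \<Rightarrow> real \<Rightarrow> real" where
  "bump c a b x = (if a < x \<and> x < b then exp (- c / ((x - a) * (b - x))) else 0)"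

lemma power_mult_exp_neg_le:
  fixes y :: real assumes "y \<ge> 0" shows "y ^ n * exp (- y) \<le> fact n"
proof -
  have "y ^ n / fact n \<le> exp y"
  proof -
    have "(\<Sum>k\<in>{n}. y ^ k /\<^sub>R fact k) \<le> exp y"
      unfolding exp_def
      by (rule sum_le_suminf) (use assms summable_exp_generic[of y] in auto)
    then show ?thesis by (simp add: divide_inverse mult.commute)
  qed
  then show ?thesis by (simp add: exp_minus field_simps)
qed

lemma has_real_derivative_zero_if_quadratic:
  fixes f :: "real \<Rightarrow> real"
  assumes "\<And>x. \<bar>f x\<bar> \<le> C * (x - a)\<^sup>2"
  shows "(f has_real_derivative 0) (at a)"
proof -
  have fa: "f a = 0" using assms[of a] by simp
  have "((\<lambda>x. (f x - f a) / (x - a)) \<longlongrightarrow> 0) (at a)"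
  proof (rule Lim_null_comparison)
    show "((\<lambda>x. C * \<bar>x - a\<bar>) \<longlongrightarrow> 0) (at a)"
      by (auto intro!: tendsto_eq_intros)
    have "norm ((f x - f a) / (x - a)) \<le> C * \<bar>x - a\<bar>" if "x \<noteq> a" for x
      using assms[of x] that fa
      by (simp add: divide_le_eq power2_eq_square abs_mult mult.assoc)
    then show "\<forall>\<^sub>F x in at a. norm ((f x - f a) / (x - a)) \<le> C * \<bar>x - a\<bar>"
      by (auto simp: eventually_at_filter)
  qed
  then show ?thesis by (simp add: has_field_derivative_iff)
qed

text \<open>Put \<open>w x = (x - a) * (b - x)\<close>.  The functions \<open>p * (1 / w) ^ k * exp (- c / w)\<close> on the interval, with
  a polynomial \<open>p\<close>, are closed under differentiation.  At the end points the exponential beats every power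
  of \<open>1 / w\<close> and makes them \<open>O((x - a)\<^sup>2)\<close>, so the derivative there is zero.\<close>

lemma smooth_bump:
  assumes ab: "a < b" and c: "c > 0"
  shows "smooth (bump c a b)"
proof -
  define w where "w x = (x - a) * (b - x)" for x
  define wp where "wp = [:- a, 1:] * [:b, - 1:]"
  have w_poly: "w x = poly wp x" for x by (simp add: w_def wp_def algebra_simps)
  define G where "G p k x = (if a < x \<and> x < b then poly p x * (1 / w x) ^ k * exp (- c / w x) else 0)"
    for p :: "real poly" and k x
  have wpos: "w x > 0" if "a < x" "x < b" for x using that by (simp add: w_def)
  define nx where "nx p k = pderiv p * wp\<^sup>2 - of_nat k * p * wp * pderiv wp + [:c:] * p * pderiv wp"
    for p :: "real poly" and k :: nat
  have G_quad: "\<exists>C. \<forall>x. \<bar>G p k x\<bar> \<le> C * (x - a)\<^sup>2 \<and> \<bar>G p k x\<bar> \<le> C * (x - b)\<^sup>2" for p k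
  proof -
    have "compact (poly p ` {a..b})" by (intro compact_continuous_image continuous_intros compact_Icc)
    then obtain M where M: "\<And>x. x \<in> {a..b} \<Longrightarrow> \<bar>poly p x\<bar> \<le> M"
      by (metis (mono_tags, lifting) bounded_iff compact_imp_bounded imageI real_norm_def)
    then have M0: "M \<ge> 0" by (metis abs_ge_zero atLeastAtMost_iff less_eq_real_def order_trans ab)
    define C where "C = M * (fact (k + 2) / c ^ (k + 2)) * (b - a)\<^sup>2"
    have C0: "C \<ge> 0" using M0 c by (simp add: C_def)
    have "\<bar>G p k x\<bar> \<le> C * (x - a)\<^sup>2 \<and> \<bar>G p k x\<bar> \<le> C * (x - b)\<^sup>2" for x
    proof (cases "a < x \<and> x < b")
      case True
      have w: "w x > 0" using True wpos by auto
      have "(c / w x) ^ (k + 2) * exp (- (c / w x)) \<le> fact (k + 2)"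
        using c w by (intro power_mult_exp_neg_le) auto
      then have "(1 / w x) ^ k * exp (- c / w x) \<le> fact (k + 2) / c ^ (k + 2) * (w x)\<^sup>2"
        using c w by (simp add: field_simps power_add power2_eq_square)
      then have "\<bar>poly p x\<bar> * ((1 / w x) ^ k * exp (- c / w x)) \<le> M * (fact (k + 2) / c ^ (k + 2) * (w x)\<^sup>2)"
        using M0 w True by (intro mult_mono[OF M]) auto
      then have 1: "\<bar>G p k x\<bar> \<le> M * (fact (k + 2) / c ^ (k + 2)) * (w x)\<^sup>2"
        using True w by (simp add: G_def abs_mult mult.assoc)
      have 2: "(w x)\<^sup>2 \<le> (b - a)\<^sup>2 * (x - a)\<^sup>2" "(w x)\<^sup>2 \<le> (b - a)\<^sup>2 * (x - b)\<^sup>2"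
      proof -
        have "(b - x)\<^sup>2 \<le> (b - a)\<^sup>2" "(x - a)\<^sup>2 \<le> (b - a)\<^sup>2" using True by (auto intro!: power_mono)
        then show "(w x)\<^sup>2 \<le> (b - a)\<^sup>2 * (x - a)\<^sup>2" "(w x)\<^sup>2 \<le> (b - a)\<^sup>2 * (x - b)\<^sup>2"
          using mult_right_mono[of "(b - x)\<^sup>2" "(b - a)\<^sup>2" "(x - a)\<^sup>2"]
            mult_right_mono[of "(x - a)\<^sup>2" "(b - a)\<^sup>2" "(b - x)\<^sup>2"]
          by (simp_all add: w_def power_mult_distrib power2_commute[of x b] mult.commute)
      qed
      have 3: "M * (fact (k + 2) / c ^ (k + 2)) \<ge> 0" using M0 c by simp
      show ?thesis
        using order_trans[OF 1 mult_left_mono[OF 2(1) 3]] order_trans[OF 1 mult_left_mono[OF 2(2) 3]]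
        by (simp add: C_def mult.assoc)
    next
      case False then show ?thesis using C0 by (auto simp: G_def)
    qed
    then show ?thesis by blast
  qed
  have G_deriv: "(G p k has_real_derivative G (nx p k) (k + 2) x) (at x)" for p k x
  proof -
    obtain C where C: "\<And>x. \<bar>G p k x\<bar> \<le> C * (x - a)\<^sup>2" "\<And>x. \<bar>G p k x\<bar> \<le> C * (x - b)\<^sup>2"
      using G_quad by blast
    consider "a < x \<and> x < b" | "x < a \<or> x > b" | "x = a" | "x = b" by linarith
    then show ?thesis
    proof cases
      case 1
      have w: "w x \<noteq> 0" using 1 wpos[of x] by simp
      have dw: "(w has_real_derivative poly (pderiv wp) x) (at x)"
        unfolding w_poly[abs_def] by (rule poly_DERIV)
      have "((\<lambda>x. poly p x * (1 / w x) ^ k * exp (- c / w x)) has_real_derivative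
         poly (nx p k) x * (1 / w x) ^ (k + 2) * exp (- c / w x)) (at x)"
      proof (cases k)
        case 0
        show ?thesis unfolding 0
          using w by (auto intro!: derivative_eq_intros dw simp: nx_def w_poly[symmetric])
             (simp add: field_simps power2_eq_square w_poly[symmetric])
      next
        case (Suc m)
        have pw: "m = 0 \<or> w x * w x ^ (m - Suc 0) = w x ^ m"
          by (cases m) auto
        show ?thesis unfolding Suc
          using w by (auto intro!: derivative_eq_intros dw simp: nx_def w_poly[symmetric],
              simp add: field_simps power2_eq_square w_poly[symmetric], use pw in auto)
      qed
      then show ?thesis
        using 1 by (subst has_field_derivative_cong_eventually[where g="\<lambda>x. poly p x * (1 / w x) ^ k * exp (- c / w x)"])
          (auto simp: G_def eventually_at_filter intro!: eventually_nhds_in_open[of "{a<..<b}", THEN eventually_mono])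
    next
      case 2
      have "open ({..<a} \<union> {b<..})" by auto
      then have "\<forall>\<^sub>F y in nhds x. y \<in> {..<a} \<union> {b<..}" using 2 by (intro eventually_nhds_in_open) auto
      then have "\<forall>\<^sub>F y in nhds x. G p k y = 0" by eventually_elim (auto simp: G_def)
      then have "(G p k has_real_derivative 0) (at x)"
        by (subst DERIV_cong_ev[OF refl _ refl, where g="\<lambda>_. 0"]) auto
      then show ?thesis using 2 by (auto simp: G_def)
    next
      case 3
      then show ?thesis using has_real_derivative_zero_if_quadratic[OF C(1)] by (simp add: G_def[of "nx p k"])
    next
      case 4
      then show ?thesis using has_real_derivative_zero_if_quadratic[OF C(2)] by (simp add: G_def[of "nx p k"])
    qed
  qed
  have "bump c a b = G 1 0" by (auto simp: bump_def G_def w_def)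
  moreover have "smooth (G 1 0)"
    by (rule smooth_coinduct[where X="{G p k |p k. True}"])
       (use G_deriv in \<open>auto simp: field_differentiable_def intro: DERIV_imp_deriv, 
         metis (no_types, lifting) DERIV_imp_deriv ext\<close>)
  ultimately show ?thesis by simp
qed


abbreviation half_line :: "real measure" where "half_line \<equiv> lebesgue_on {0<..}"

lemma test_function_iff_smooth:
  "test_function S f \<longleftrightarrow> smooth f \<and> compact (closure {x. f x \<noteq> 0}) \<and> closure {x. f x \<noteq> 0} \<subseteq> S"
  by (auto simp: test_function_def smooth_def)

lemma test_functionI:
  assumes "smooth f" and "\<And>x. x \<notin> {a..b} \<Longrightarrow> f x = 0" and "{a..b} \<subseteq> S"
  shows "test_function S f"
proof -
  have "closure {x. f x \<noteq> 0} \<subseteq> {a..b}"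
    by (rule closure_minimal) (use assms(2) in \<open>auto, (metis atLeastAtMost_iff)+\<close>)
  then show ?thesis
    using assms compact_Int_closed[OF compact_Icc[of a b] closed_closure[of "{x. f x \<noteq> 0}"]]
    by (auto simp: test_function_iff_smooth Int_absorb1)
qed

lemma test_functionE:
  assumes "test_function {0<..} f"
  obtains a b where "0 < a" "a < b" "\<And>x. x \<notin> {a..b} \<Longrightarrow> f x = 0" "smooth f"
proof -
  let ?K = "closure {x. f x \<noteq> 0}"
  have s: "smooth f" and K: "compact ?K" "?K \<subseteq> {0<..}"
    using assms by (auto simp: test_function_iff_smooth)
  show ?thesis
  proof (cases "?K = {}")
    case True
    then show ?thesis using that[of 1 2] s by (metis (mono_tags, lifting) closure_eq_empty empty_iff mem_Collect_eq zero_less_one one_less_numeral_iff semiring_norm(76))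
  next
    case False
    then obtain p q where p: "p \<in> ?K" "\<And>x. x \<in> ?K \<Longrightarrow> p \<le> x" and q: "\<And>x. x \<in> ?K \<Longrightarrow> x \<le> q"
      using compact_attains_inf[OF K(1)] compact_attains_sup[OF K(1)] by metis
    have "f x = 0" if "x \<notin> {p..q+1}" for x
    proof (rule ccontr)
      assume "f x \<noteq> 0"
      then have "x \<in> ?K" using closure_subset[of "{x. f x \<noteq> 0}"] by auto
      then show False using p q that by fastforce
    qed
    moreover have "0 < p" "p < q + 1" using p q K(2) by (auto, fastforce)
    ultimately show ?thesis using that s by blast
  qed
qed

lemma deriv_zero_outside:
  fixes f :: "real \<Rightarrow> real"
  assumes "\<And>x. x \<notin> {a..b} \<Longrightarrow> f x = 0" "x \<notin> {a..b}"
  shows "deriv f x = 0"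
proof -
  have "\<forall>\<^sub>F y in nhds x. y \<in> - {a..b}"
    using assms(2) by (intro eventually_nhds_in_open) (auto simp: closed_atLeastAtMost open_Compl)
  then have "\<forall>\<^sub>F y in nhds x. f y = 0" by eventually_elim (use assms(1) in auto)
  then have "(f has_real_derivative 0) (at x)"
    by (subst DERIV_cong_ev[OF refl _ refl, where g="\<lambda>_. 0"]) auto
  then show ?thesis by (rule DERIV_imp_deriv)
qed

lemma test_function_deriv: "test_function {0<..} f \<Longrightarrow> test_function {0<..} (deriv f)"
proof (elim test_functionE)
  fix a b :: real assume "0 < a" "a < b" "\<And>x. x \<notin> {a..b} \<Longrightarrow> f x = 0" "smooth f"
  then show "test_function {0<..} (deriv f)"
    by (intro test_functionI[where a=a and b=b] smooth_deriv deriv_zero_outside[where a=a and b=b]) auto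
qed

lemma bump_zero_outside: "x \<notin> {a..b} \<Longrightarrow> bump c a b x = 0"
  by (auto simp: bump_def)

lemma test_function_bump:
  assumes "0 < a" "a < b" "c > 0" shows "test_function {0<..} (bump c a b)"
  using assms by (intro test_functionI[where a=a and b=b] smooth_bump) (auto simp: bump_zero_outside)

section \<open>Square-integrable functions on the half-line\<close>

definition sqnorm :: "(real \<Rightarrow> 'a::euclidean_space) \<Rightarrow> real" where
  "sqnorm f = (\<integral>x. (norm (f x))\<^sup>2 \<partial>half_line)"

lemma sqnorm_nonneg: "sqnorm f \<ge> 0"
  unfolding sqnorm_def by simp

lemma norm_add_squared_le: "(norm (x + y))\<^sup>2 \<le> 2 * (norm x)\<^sup>2 + 2 * (norm (y :: 'a :: real_normed_vector))\<^sup>2"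
proof -
  have "(norm (x + y))\<^sup>2 \<le> (norm x + norm y)\<^sup>2" by (intro power_mono norm_triangle_ineq) auto
  also have "\<dots> \<le> 2 * (norm x)\<^sup>2 + 2 * (norm y)\<^sup>2"
    using zero_le_power2[of "norm x - norm y"] by (simp add: power2_eq_square algebra_simps)
  finally show ?thesis .
qed

lemma L2_on_cmul: "L2_on S f \<Longrightarrow> L2_on S (\<lambda>x. a *\<^sub>R f x)"
  by (auto simp: L2_on_def power_mult_distrib)

lemma L2_on_add:
  assumes "L2_on S f" "L2_on S g" shows "L2_on S (\<lambda>x. f x + g x)"
proof -
  have [measurable]: "f \<in> borel_measurable (lebesgue_on S)" "g \<in> borel_measurable (lebesgue_on S)"
    using assms by (auto simp: L2_on_def)
  have "integrable (lebesgue_on S) (\<lambda>x. (norm (f x + g x))\<^sup>2)"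
  proof (rule Bochner_Integration.integrable_bound)
    show "integrable (lebesgue_on S) (\<lambda>x. 2 * (norm (f x))\<^sup>2 + 2 * (norm (g x))\<^sup>2)"
      using assms by (auto simp: L2_on_def)
  qed (auto intro!: AE_I2 order_trans[OF norm_add_squared_le])
  then show ?thesis by (auto simp: L2_on_def)
qed

lemma L2_on_diff: "L2_on S f \<Longrightarrow> L2_on S g \<Longrightarrow> L2_on S (\<lambda>x. f x - g x)"
  using L2_on_add[OF _ L2_on_cmul[of S g "-1"]] by simp

lemma sqnorm_add:
  assumes "L2_on {0<..} f" "L2_on {0<..} g"
  shows "sqnorm (\<lambda>x. f x + g x) \<le> 2 * sqnorm f + 2 * sqnorm g"
proof -
  have "sqnorm (\<lambda>x. f x + g x) \<le> (\<integral>x. 2 * (norm (f x))\<^sup>2 + 2 * (norm (g x))\<^sup>2 \<partial>half_line)"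
    unfolding sqnorm_def
    using assms L2_on_add[OF assms] by (intro integral_mono norm_add_squared_le) (auto simp: L2_on_def)
  also have "\<dots> = 2 * sqnorm f + 2 * sqnorm g"
    using assms unfolding sqnorm_def by (subst Bochner_Integration.integral_add) (auto simp: L2_on_def)
  finally show ?thesis .
qed

lemma sqnorm_minus_commute: "sqnorm (\<lambda>x. f x - g x) = sqnorm (\<lambda>x. g x - f x)"
  by (simp add: sqnorm_def norm_minus_commute)

lemma sqnorm_diff_trans:
  assumes "L2_on {0<..} f" "L2_on {0<..} g" "L2_on {0<..} h"
  shows "sqnorm (\<lambda>x. f x - h x) \<le> 2 * sqnorm (\<lambda>x. f x - g x) + 2 * sqnorm (\<lambda>x. g x - h x)"
  using sqnorm_add[OF L2_on_diff[OF assms(1,2)] L2_on_diff[OF assms(2,3)]] by simp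

lemma L2_on_cong_AE:
  assumes "L2_on S f" "AE x in lebesgue_on S. f x = g x" "S \<in> sets lebesgue"
  shows "L2_on S g"
proof -
  have g: "g \<in> borel_measurable (lebesgue_on S)"
  proof -
    have "AE x in lebesgue. x \<in> S \<longrightarrow> f x = g x"
      by (rule AE_restrict_space_iff[THEN iffD1, OF _ assms(2)]) (use assms(3) in auto)
    then have "AE x in lebesgue. (if x \<in> S then f x else 0) = (if x \<in> S then g x else 0)"
      by eventually_elim auto
    moreover have "(\<lambda>x. if x \<in> S then f x else 0) \<in> borel_measurable lebesgue"
      using assms borel_measurable_if_lebesgue_on[of S UNIV f] by (simp add: L2_on_def lebesgue_on_UNIV_eq)
    ultimately have "(\<lambda>x. if x \<in> S then g x else 0) \<in> borel_measurable lebesgue"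
      by (rule borel_measurable_AE[rotated])
    then show ?thesis
      using assms(3) borel_measurable_if_lebesgue_on[of S UNIV g] by (simp add: lebesgue_on_UNIV_eq)
  qed
  have [measurable]: "f \<in> borel_measurable (lebesgue_on S)" using assms(1) by (simp add: L2_on_def)
  have "AE x in lebesgue_on S. (norm (f x))\<^sup>2 = (norm (g x))\<^sup>2"
    using assms(2) by eventually_elim simp
  then have "integrable (lebesgue_on S) (\<lambda>x. (norm (g x))\<^sup>2)"
    using integrable_cong_AE[of "\<lambda>x. (norm (f x))\<^sup>2" "lebesgue_on S" "\<lambda>x. (norm (g x))\<^sup>2"] g assms(1)
    by (simp add: L2_on_def)
  with g show ?thesis by (simp add: L2_on_def)
qed

lemma sqnorm_cong_AE:
  assumes "f \<in> borel_measurable half_line" "g \<in> borel_measurable half_line" "AE x in half_line. f x = g x"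
  shows "sqnorm f = sqnorm g"
  unfolding sqnorm_def using assms by (intro integral_cong_AE) auto

lemma L2_half_line_extend:
  assumes "L2_on {0<..} f"
  shows "(\<lambda>x. indicator {0<..} x *\<^sub>R f x) \<in> borel_measurable lebesgue"
    "integrable lebesgue (\<lambda>x. (norm (indicator {0<..} x *\<^sub>R f x))\<^sup>2)"
    "sqnorm f = (\<integral>x. (norm (indicator {0<..} x *\<^sub>R f x))\<^sup>2 \<partial>lebesgue)"
proof -
  have eq: "(norm (indicator {0<..} x *\<^sub>R f x))\<^sup>2 = indicator {0<..} x *\<^sub>R (norm (f x))\<^sup>2" for x
    by (simp add: indicator_def)
  show "(\<lambda>x. indicator {0<..} x *\<^sub>R f x) \<in> borel_measurable lebesgue"
    using assms by (simp add: L2_on_def borel_measurable_restrict_space_iff)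
  show "integrable lebesgue (\<lambda>x. (norm (indicator {0<..} x *\<^sub>R f x))\<^sup>2)"
    unfolding eq using assms by (simp add: L2_on_def integrable_restrict_space)
  show "sqnorm f = (\<integral>x. (norm (indicator {0<..} x *\<^sub>R f x))\<^sup>2 \<partial>lebesgue)"
    unfolding eq sqnorm_def by (simp add: integral_restrict_space)
qed

text \<open>The point 0 does not belong to the open half-line, but it is negligible; allowing \<open>a = 0\<close> makes primitives
  based at the boundary available.\<close>

lemma L2_absolutely_integrable:
  assumes f: "L2_on {0<..} f" and a: "0 \<le> a"
  shows "f absolutely_integrable_on {a..b}"
    and "(\<lambda>x. (norm (f x))\<^sup>2) absolutely_integrable_on {a..b}"
    and "integral {a..b} (\<lambda>x. (norm (f x))\<^sup>2) \<le> sqnorm f"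
proof -
  let ?f = "\<lambda>x. indicator {0<..} x *\<^sub>R f x"
  note E[measurable] = L2_half_line_extend(1)[OF f]
  note E2 = L2_half_line_extend(2)[OF f]
  have neg: "negligible {0::real}" by simp
  have [measurable]: "{a..b} \<in> sets lebesgue" by simp
  have sq: "(\<lambda>x. (norm (?f x))\<^sup>2) absolutely_integrable_on {a..b}"
    using E2 unfolding set_integrable_def
    by (rule Bochner_Integration.integrable_bound) (measurable, auto simp: indicator_def)
  have "?f absolutely_integrable_on {a..b}"
    unfolding set_integrable_def
  proof (rule Bochner_Integration.integrable_bound)
    have "(\<lambda>x. 1 + (norm (?f x))\<^sup>2) absolutely_integrable_on {a..b}"
      using sq by (intro set_integral_add) (auto simp: absolutely_integrable_on_const)
    then show "integrable lebesgue (\<lambda>x. indicat_real {a..b} x *\<^sub>R (1 + (norm (?f x))\<^sup>2))"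
      by (simp add: set_integrable_def)
    have "t \<le> 1 + t\<^sup>2" for t :: real
      using zero_le_power2[of "t - 1"] zero_le_power2[of "t"] unfolding power2_diff by (simp; linarith)
    from this[of "norm (?f _)"]
    show "AE x in lebesgue. norm (indicat_real {a..b} x *\<^sub>R ?f x)
        \<le> norm (indicat_real {a..b} x *\<^sub>R (1 + (norm (?f x))\<^sup>2))"
      by (auto simp: indicator_def)
  qed measurable
  then show "f absolutely_integrable_on {a..b}"
    by (rule absolutely_integrable_spike[OF _ neg]) (use a in \<open>auto simp: indicator_def\<close>)
  show 2: "(\<lambda>x. (norm (f x))\<^sup>2) absolutely_integrable_on {a..b}"
    by (rule absolutely_integrable_spike[OF sq neg]) (use a in \<open>auto simp: indicator_def\<close>)
  have "integral {a..b} (\<lambda>x. (norm (f x))\<^sup>2) = integral {a..b} (\<lambda>x. (norm (?f x))\<^sup>2)"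
    by (rule integral_spike[OF neg]) (use a in \<open>auto simp: indicator_def\<close>)
  also have "\<dots> = (LINT x:{a..b}|lebesgue. (norm (?f x))\<^sup>2)"
    using set_lebesgue_integral_eq_integral(2)[OF sq] by simp
  also have "\<dots> \<le> sqnorm f"
    unfolding L2_half_line_extend(3)[OF f] set_lebesgue_integral_def
    by (rule integral_mono[OF _ E2]) (use sq in \<open>auto simp: set_integrable_def indicator_def\<close>)
  finally show "integral {a..b} (\<lambda>x. (norm (f x))\<^sup>2) \<le> sqnorm f" .
qed

text \<open>Cauchy--Schwarz on an interval, from the nonnegativity of the integral of \<open>(norm f - s)\<^sup>2\<close> when
  \<open>s\<close> is the mean value of \<open>norm f\<close>.\<close>

lemma integral_norm_squared_le:
  fixes f :: "real \<Rightarrow> 'a::euclidean_space"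
  assumes f: "f absolutely_integrable_on {a..b}" and f2: "(\<lambda>x. (norm (f x))\<^sup>2) integrable_on {a..b}"
    and ab: "a \<le> b"
  shows "(integral {a..b} (\<lambda>x. norm (f x)))\<^sup>2 \<le> (b - a) * integral {a..b} (\<lambda>x. (norm (f x))\<^sup>2)"
proof (cases "a = b")
  case False
  then have ab: "a < b" using ab by simp
  define J where "J = integral {a..b} (\<lambda>x. norm (f x))"
  define s where "s = J / (b - a)"
  have n: "(\<lambda>x. norm (f x)) integrable_on {a..b}" using f absolutely_integrable_on_def by blast
  have "0 \<le> integral {a..b} (\<lambda>x. (norm (f x))\<^sup>2 - (2 * s) * norm (f x) + s\<^sup>2)"
  proof (rule integral_nonneg)
    show "(\<lambda>x. (norm (f x))\<^sup>2 - (2 * s) * norm (f x) + s\<^sup>2) integrable_on {a..b}"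
      using n f2 by (intro integrable_add integrable_diff integrable_on_mult_right) auto
    show "0 \<le> (norm (f x))\<^sup>2 - 2 * s * norm (f x) + s\<^sup>2" for x
      using zero_le_power2[of "norm (f x) - s"] by (simp add: power2_diff algebra_simps)
  qed
  also have "\<dots> = integral {a..b} (\<lambda>x. (norm (f x))\<^sup>2) - 2 * s * J + s\<^sup>2 * (b - a)"
    using ab by (intro integral_unique has_integral_add has_integral_diff has_integral_mult_right
        integrable_integral n f2 has_integral_const_real[of "s\<^sup>2" a b, THEN has_integral_eq_rhs, unfolded J_def])
       (auto simp: J_def intro!: has_integral_mult_right integrable_integral n)
  also have "\<dots> = integral {a..b} (\<lambda>x. (norm (f x))\<^sup>2) - J\<^sup>2 / (b - a)"
  proof -
    have "J = s * (b - a)" using ab by (simp add: s_def)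
    moreover have "J\<^sup>2 / (b - a) = s * J" using ab by (simp add: s_def power2_eq_square)
    moreover have "s\<^sup>2 * (b - a) = s * J" using ab by (simp add: s_def power2_eq_square)
    ultimately show ?thesis by (simp add: algebra_simps)
  qed
  finally show ?thesis using ab by (simp add: J_def field_simps)
qed simp

lemma norm_integral_squared_le:
  fixes f :: "real \<Rightarrow> 'a::euclidean_space"
  assumes f: "f absolutely_integrable_on {a..b}" and f2: "(\<lambda>x. (norm (f x))\<^sup>2) integrable_on {a..b}"
    and ab: "a \<le> b"
  shows "(norm (integral {a..b} f))\<^sup>2 \<le> (b - a) * integral {a..b} (\<lambda>x. (norm (f x))\<^sup>2)"
proof -
  have "norm (integral {a..b} f) \<le> integral {a..b} (\<lambda>x. norm (f x))"
    using f by (intro integral_norm_bound_integral) (auto simp: absolutely_integrable_on_def)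
  then have "(norm (integral {a..b} f))\<^sup>2 \<le> (integral {a..b} (\<lambda>x. norm (f x)))\<^sup>2"
    by (intro power_mono) auto
  also note integral_norm_squared_le[OF assms]
  finally show ?thesis .
qed

lemma L2_norm_integral_squared_le:
  assumes f: "L2_on {0<..} f" and a: "0 \<le> a" "a \<le> b"
  shows "(norm (integral {a..b} f))\<^sup>2 \<le> (b - a) * sqnorm f"
    "(integral {a..b} (\<lambda>x. norm (f x)))\<^sup>2 \<le> (b - a) * sqnorm f"
proof -
  note L = L2_absolutely_integrable[OF f a(1), of b]
  have i: "(\<lambda>x. (norm (f x))\<^sup>2) integrable_on {a..b}" using L(2) absolutely_integrable_on_def by blast
  have "(b - a) * integral {a..b} (\<lambda>x. (norm (f x))\<^sup>2) \<le> (b - a) * sqnorm f"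
    using L(3) a by (intro mult_left_mono) auto
  then show "(norm (integral {a..b} f))\<^sup>2 \<le> (b - a) * sqnorm f"
     "(integral {a..b} (\<lambda>x. norm (f x)))\<^sup>2 \<le> (b - a) * sqnorm f"
    using norm_integral_squared_le[OF L(1) i a(2)] integral_norm_squared_le[OF L(1) i a(2)] by linarith+
qed


section \<open>The fundamental lemma of the calculus of variations\<close>

text \<open>The positive and the negative part of \<open>h\<close> define finite measures on tails, which agree there and hence
  everywhere; densities are unique.\<close>

lemma AE_zero_if_tail_integrals_zero:
  fixes h :: "real \<Rightarrow> real"
  assumes h: "integrable lborel h" and z: "\<And>x. (\<integral>y. indicator {x<..} y * h y \<partial>lborel) = 0"
  shows "AE x in lborel. h x = 0"
proof -
  have [measurable]: "h \<in> borel_measurable borel" using h by auto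
  define p where "p x = max 0 (h x)" for x
  define q where "q x = max 0 (- h x)" for x
  have [measurable]: "p \<in> borel_measurable borel" "q \<in> borel_measurable borel" unfolding p_def q_def by measurable
  have ip: "integrable lborel (\<lambda>y. indicator {x<..} y * p y)" "integrable lborel (\<lambda>y. indicator {x<..} y * q y)" for x
    by (rule Bochner_Integration.integrable_bound[OF h]; auto simp: p_def q_def indicator_def)+
  have e: "emeasure (density lborel (\<lambda>x. ennreal (f x))) {x<..} = ennreal (\<integral>y. indicator {x<..} y * f y \<partial>lborel)"
    if [measurable]: "f \<in> borel_measurable borel" and "\<And>y. f y \<ge> 0" "integrable lborel (\<lambda>y. indicator {x<..} y * f y)"
      for f :: "real \<Rightarrow> real" and x
  proof -
    have "emeasure (density lborel (\<lambda>x. ennreal (f x))) {x<..} = (\<integral>\<^sup>+ y. ennreal (f y) * indicator {x<..} y \<partial>lborel)"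
      by (subst emeasure_density) auto
    also have "\<dots> = (\<integral>\<^sup>+ y. ennreal (indicator {x<..} y * f y) \<partial>lborel)"
      by (intro nn_integral_cong) (auto simp: indicator_def)
    also have "\<dots> = ennreal (\<integral>y. indicator {x<..} y * f y \<partial>lborel)"
      using that by (intro nn_integral_eq_integral) auto
    finally show ?thesis .
  qed
  have pq: "(\<integral>y. indicator {x<..} y * p y \<partial>lborel) = (\<integral>y. indicator {x<..} y * q y \<partial>lborel)" for x
  proof -
    have "(\<integral>y. indicator {x<..} y * p y \<partial>lborel) - (\<integral>y. indicator {x<..} y * q y \<partial>lborel)
        = (\<integral>y. indicator {x<..} y * p y - indicator {x<..} y * q y \<partial>lborel)"
      by (rule Bochner_Integration.integral_diff[symmetric]) (rule ip)+
    also have "\<dots> = (\<integral>y. indicator {x<..} y * h y \<partial>lborel)"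
      by (intro Bochner_Integration.integral_cong) (auto simp: p_def q_def indicator_def)
    finally show ?thesis using z by simp
  qed
  have "density lborel (\<lambda>x. ennreal (p x)) = density lborel (\<lambda>x. ennreal (q x))"
  proof (rule measure_eqI_lessThan)
    fix x :: real
    have "p y \<ge> 0" "q y \<ge> 0" for y by (auto simp: p_def q_def)
    then show "emeasure (density lborel (\<lambda>x. ennreal (p x))) {x<..} < \<infinity>"
       "emeasure (density lborel (\<lambda>x. ennreal (p x))) {x<..} = emeasure (density lborel (\<lambda>x. ennreal (q x))) {x<..}"
      using e[of p x] e[of q x] ip pq by auto
  qed auto
  then have "AE x in lborel. ennreal (p x) = ennreal (q x)"
    by (intro sigma_finite_measure.density_unique[OF sigma_finite_lborel]) auto
  then show ?thesis
    by eventually_elim (auto simp: p_def q_def max_def split: if_splits)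
qed

lemma AE_zero_if_interval_integrals_zero:
  fixes f :: "real \<Rightarrow> real"
  assumes f: "\<And>a b. 0 < a \<Longrightarrow> a < b \<Longrightarrow> f absolutely_integrable_on {a..b}"
    and z: "\<And>a b. 0 < a \<Longrightarrow> a < b \<Longrightarrow> integral {a..b} f = 0"
  shows "AE x in half_line. f x = 0"
proof -
  have *: "AE x in lebesgue. x \<in> {a..b} \<longrightarrow> f x = 0" if ab: "0 < a" "a < b" for a b
  proof -
    define h0 where "h0 x = indicator {a..b} x *\<^sub>R f x" for x
    have i0: "integrable lebesgue h0" using f[OF ab] unfolding set_integrable_def h0_def .
    then obtain h where h[measurable]: "h \<in> borel_measurable lborel" and eq: "AE x in lborel. h0 x = h x"
      using completion_ex_borel_measurable_real[OF borel_measurable_integrable[OF i0]] by blast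
    have eq': "AE x in lebesgue. h0 x = h x" using eq by (rule AE_completion)
    have hl: "h \<in> borel_measurable lebesgue" using h by (simp add: measurable_completion)
    have "integrable lebesgue h"
      using integrable_cong_AE[OF borel_measurable_integrable[OF i0] hl eq'] i0 by simp
    then have ih: "integrable lborel h" using integrable_completion[OF h] by simp
    have "(\<integral>y. indicator {x<..} y * h y \<partial>lborel) = 0" for x
    proof -
      have [measurable]: "h0 \<in> borel_measurable lebesgue" "h \<in> borel_measurable lebesgue" "{x<..} \<in> sets lebesgue"
        using i0 hl by auto
      have "(\<integral>y. indicator {x<..} y * h y \<partial>lborel) = (\<integral>y. indicator {x<..} y * h y \<partial>lebesgue)"
        by (rule integral_completion[symmetric]) measurable
      also have "\<dots> = (\<integral>y. indicator {x<..} y * h0 y \<partial>lebesgue)"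
      proof (rule integral_cong_AE)
        show "AE y in lebesgue. indicat_real {x<..} y * h y = indicator {x<..} y * h0 y"
          using eq' by eventually_elim auto
      qed measurable
      also have "\<dots> = 0"
      proof (cases "x < b")
        case False
        then have z0: "(\<lambda>y. indicator {x<..} y * h0 y) = (\<lambda>_. 0)" by (auto simp: h0_def indicator_def)
        show ?thesis unfolding z0 by simp
      next
        case True
        define m where "m = max a x"
        have m: "0 < m" "m < b" using True ab by (auto simp: m_def)
        have fm: "set_integrable lebesgue {m..b} f" using f[OF m] .
        have "(\<integral>y. indicator {x<..} y * h0 y \<partial>lebesgue) = (LINT y:{m..b}|lebesgue. f y)"
          unfolding set_lebesgue_integral_def
        proof (rule integral_cong_AE)
          have "AE y in lebesgue. y \<noteq> x" using AE_lborel_singleton[of x] by (rule AE_completion)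
          then show "AE y in lebesgue. indicator {x<..} y * h0 y = indicat_real {m..b} y *\<^sub>R f y"
            by eventually_elim (auto simp: h0_def indicator_def m_def)
        qed (use fm in \<open>auto simp: set_integrable_def\<close>)
        also have "\<dots> = integral {m..b} f"
          using set_lebesgue_integral_eq_integral(2)[OF fm] .
        finally show ?thesis using z[OF m] by simp
      qed
      finally show ?thesis .
    qed
    from AE_zero_if_tail_integrals_zero[OF ih this] have "AE x in lebesgue. h x = 0"
      by (rule AE_completion)
    with eq' show ?thesis by eventually_elim (auto simp: h0_def indicator_def)
  qed
  have "AE x in lebesgue. \<forall>n::nat. x \<in> {1 / (real n + 1)..real n + 2} \<longrightarrow> f x = 0"
    by (subst AE_all_countable, intro allI *) (auto simp: field_simps intro: add_pos_nonneg)
  then have "AE x in lebesgue. x \<in> {0<..} \<longrightarrow> f x = 0"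
  proof eventually_elim
    case (elim x)
    show ?case
    proof
      assume x: "x \<in> {0<..}"
      obtain n :: nat where n: "1 / x \<le> real n" "x \<le> real n" by (metis real_arch_simple max.bounded_iff)
      then have "x \<in> {1 / (real n + 1)..real n + 2}"
        using x by (auto simp: field_simps)
      then show "f x = 0" using elim by blast
    qed
  qed
  then show ?thesis by (simp add: AE_restrict_space_iff)
qed

definition locally_integrable :: "(real \<Rightarrow> 'a::euclidean_space) \<Rightarrow> bool" where
  "locally_integrable f \<longleftrightarrow> (\<forall>a b. 0 < a \<longrightarrow> a < b \<longrightarrow> f absolutely_integrable_on {a..b})"

lemma smooth_mult_absolutely_integrable:
  fixes f :: "real \<Rightarrow> 'a::euclidean_space"
  assumes "smooth \<phi>" "f absolutely_integrable_on {a..b}"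
  shows "(\<lambda>x. \<phi> x *\<^sub>R f x) absolutely_integrable_on {a..b}"
proof (rule absolutely_integrable_bounded_measurable_product[OF bounded_bilinear_scaleR[THEN bilinear_conv_bounded_bilinear[THEN iffD2]]])
  show "\<phi> \<in> borel_measurable (lebesgue_on {a..b})"
    by (intro continuous_imp_measurable_on_sets_lebesgue smooth_continuous assms) auto
  show "bounded (\<phi> ` {a..b})"
    by (intro compact_imp_bounded compact_continuous_image smooth_continuous assms) auto
qed (use assms in auto)

lemma test_integral:
  fixes f :: "real \<Rightarrow> 'a::euclidean_space"
  assumes "smooth \<phi>" "\<And>x. x \<notin> {a..b} \<Longrightarrow> \<phi> x = 0" "0 < a" "f absolutely_integrable_on {a..b}"
  shows "integrable half_line (\<lambda>x. \<phi> x *\<^sub>R f x)"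
    "(\<integral>x. \<phi> x *\<^sub>R f x \<partial>half_line) = integral {a..b} (\<lambda>x. \<phi> x *\<^sub>R f x)"
proof -
  note i = smooth_mult_absolutely_integrable[OF assms(1,4)]
  have eq: "indicator {0<..} x *\<^sub>R (\<phi> x *\<^sub>R f x) = indicator {a..b} x *\<^sub>R (\<phi> x *\<^sub>R f x)" for x
    using assms(2)[of x] assms(3) by (auto simp: indicator_def)
  show "integrable half_line (\<lambda>x. \<phi> x *\<^sub>R f x)"
    using i by (simp add: integrable_restrict_space set_integrable_def eq del: scaleR_scaleR)
  show "(\<integral>x. \<phi> x *\<^sub>R f x \<partial>half_line) = integral {a..b} (\<lambda>x. \<phi> x *\<^sub>R f x)"
    using set_lebesgue_integral_eq_integral(2)[OF i]
    by (simp add: integral_restrict_space set_lebesgue_integral_def eq del: scaleR_scaleR)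
qed

text \<open>Testing with bumps of parameter \<open>1 / (n + 1)\<close> and dominated convergence give vanishing integrals over
  all intervals.\<close>

lemma fundamental_lemma_real:
  fixes f :: "real \<Rightarrow> real"
  assumes f: "locally_integrable f"
    and z: "\<And>\<phi>. test_function {0<..} \<phi> \<Longrightarrow> (\<integral>x. \<phi> x *\<^sub>R f x \<partial>half_line) = 0"
  shows "AE x in half_line. f x = 0"
proof (rule AE_zero_if_interval_integrals_zero)
  show fi: "f absolutely_integrable_on {a..b}" if "0 < a" "a < b" for a b
    using f that by (simp add: locally_integrable_def)
  show "integral {a..b} f = 0" if ab: "0 < a" "a < b" for a b
  proof -
    define \<theta> where "\<theta> n = bump (1 / (real n + 1)) a b" for n
    define g where "g x = (if x \<in> {a<..<b} then f x else 0)" for x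
    note ff = fi[OF ab]
    have \<theta>: "smooth (\<theta> n)" "test_function {0<..} (\<theta> n)" for n
      unfolding \<theta>_def using ab by (auto intro!: smooth_bump test_function_bump)
    have "integral {a..b} (\<lambda>x. \<theta> n x *\<^sub>R f x) = 0" for n
      using z[OF \<theta>(2)[of n]] test_integral(2)[OF \<theta>(1)[of n] _ ab(1) ff]
      by (simp add: \<theta>_def bump_zero_outside)
    moreover have "(\<lambda>n. integral {a..b} (\<lambda>x. \<theta> n x *\<^sub>R f x)) \<longlonglongrightarrow> integral {a..b} g"
    proof (rule dominated_convergence(2))
      show "(\<lambda>x. \<theta> n x *\<^sub>R f x) integrable_on {a..b}" for n
        using smooth_mult_absolutely_integrable[OF \<theta>(1) ff] absolutely_integrable_on_def by blast
      show "(\<lambda>x. norm (f x)) integrable_on {a..b}" using ff absolutely_integrable_on_def by blast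
      have "0 \<le> \<theta> n x" "\<theta> n x \<le> 1" for n x by (auto simp: \<theta>_def bump_def)
      then show "norm (\<theta> n x *\<^sub>R f x) \<le> norm (f x)" for n x
        using mult_right_mono[of "\<theta> n x" 1 "\<bar>f x\<bar>"] by (simp add: abs_mult)
      show "(\<lambda>n. \<theta> n x *\<^sub>R f x) \<longlonglongrightarrow> g x" for x
      proof (cases "x \<in> {a<..<b}")
        case True
        have "(\<lambda>n. exp (- (1 / (real n + 1)) / ((x - a) * (b - x))) *\<^sub>R f x) \<longlonglongrightarrow> exp (- 0 / ((x - a) * (b - x))) *\<^sub>R f x"
        proof (intro tendsto_intros)
          show "(\<lambda>n. 1 / (real n + 1)) \<longlonglongrightarrow> 0"
            using LIMSEQ_inverse_real_of_nat by (simp add: inverse_eq_divide add.commute)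
        qed (use True in auto)
        then show ?thesis using True by (simp add: \<theta>_def bump_def g_def)
      qed (auto simp: \<theta>_def bump_def g_def)
    qed
    ultimately have "integral {a..b} g = 0" by (simp add: LIMSEQ_const_iff)
    moreover have "integral {a..b} g = integral {a..b} f"
      by (rule integral_spike[where S="{a,b}"]) (auto simp: g_def)
    ultimately show ?thesis by simp
  qed
qed

lemma locally_integrable_inner: "locally_integrable f \<Longrightarrow> locally_integrable (\<lambda>x. f x \<bullet> i)"
  unfolding locally_integrable_def
  by (metis absolutely_integrable_component)

lemma integrable_test_mult:
  "test_function {0<..} \<phi> \<Longrightarrow> locally_integrable f \<Longrightarrow> integrable half_line (\<lambda>x. \<phi> x *\<^sub>R f x)"
  by (metis locally_integrable_def test_functionE test_integral(1))

lemma fundamental_lemma: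
  fixes f :: "real \<Rightarrow> 'a::euclidean_space"
  assumes f: "locally_integrable f"
    and z: "\<And>\<phi>. test_function {0<..} \<phi> \<Longrightarrow> (\<integral>x. \<phi> x *\<^sub>R f x \<partial>half_line) = 0"
  shows "AE x in half_line. f x = 0"
proof -
  have "AE x in half_line. f x \<bullet> i = 0" if "i \<in> Basis" for i
  proof (rule fundamental_lemma_real)
    show "locally_integrable (\<lambda>x. f x \<bullet> i)" by (rule locally_integrable_inner[OF f])
    fix \<phi> assume p: "test_function {0<..} \<phi>"
    have "(\<integral>x. (\<phi> x *\<^sub>R f x) \<bullet> i \<partial>half_line) = (\<integral>x. \<phi> x *\<^sub>R f x \<partial>half_line) \<bullet> i"
      by (rule integral_inner_left) (use integrable_test_mult[OF p f] in auto)
    then show "(\<integral>x. \<phi> x *\<^sub>R (f x \<bullet> i) \<partial>half_line) = 0" using z[OF p] by simp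
  qed
  then have "AE x in half_line. \<forall>i\<in>Basis. f x \<bullet> i = 0" by (intro AE_finite_allI) auto
  then show ?thesis by eventually_elim (auto intro: euclidean_eqI)
qed

lemma locally_integrable_diff:
  "locally_integrable f \<Longrightarrow> locally_integrable g \<Longrightarrow> locally_integrable (\<lambda>x. f x - g x)"
  unfolding locally_integrable_def by (auto intro!: set_integral_diff)

lemma locally_integrable_const: "locally_integrable (\<lambda>x. c)"
  unfolding locally_integrable_def by (auto intro: absolutely_integrable_on_const)

lemma integral_bump_pos:
  assumes "0 < a" "a < b" "0 < c"
  shows "(\<integral>x. bump c a b x \<partial>half_line) > 0"
proof -
  have s: "smooth (bump c a b)" using assms by (intro smooth_bump)
  have e: "(\<integral>x. bump c a b x \<partial>half_line) = integral {a..b} (bump c a b)"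
    using test_integral(2)[OF s _ assms(1), of b "\<lambda>_. 1 :: real"]
    by (simp add: bump_zero_outside absolutely_integrable_on_const)
  have "integral {a..b} (bump c a b) \<noteq> 0"
  proof
    assume "integral {a..b} (bump c a b) = 0"
    then have "(bump c a b has_integral 0) (cbox a b)"
      using integrable_integral[OF integrable_continuous_real[OF smooth_continuous[OF s]], of a b] by simp
    then have "bump c a b ((a + b) / 2) = 0"
      by (intro has_integral_0_cbox_imp_0[OF smooth_continuous[OF s]]) (use assms in \<open>auto simp: bump_def field_simps\<close>)
    moreover have "bump c a b ((a + b) / 2) > 0" using assms by (auto simp: bump_def field_simps)
    ultimately show False by simp
  qed
  moreover have "integral {a..b} (bump c a b) \<ge> 0"
    by (intro integral_nonneg integrable_continuous_real smooth_continuous s) (auto simp: bump_def)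
  ultimately show ?thesis using e by simp
qed

lemma test_function_lincomb:
  assumes "test_function {0<..} f" "test_function {0<..} g"
  shows "test_function {0<..} (\<lambda>x. a * f x + b * g x)"
proof -
  obtain p q where f: "0 < p" "p < q" "\<And>x. x \<notin> {p..q} \<Longrightarrow> f x = 0" "smooth f" using test_functionE[OF assms(1)] by blast
  obtain p' q' where g: "0 < p'" "p' < q'" "\<And>x. x \<notin> {p'..q'} \<Longrightarrow> g x = 0" "smooth g" using test_functionE[OF assms(2)] by blast
  show ?thesis
  proof (rule test_functionI[where a="min p p'" and b="max q q'"])
    show "a * f x + b * g x = 0" if "x \<notin> {min p p'..max q q'}" for x
    proof -
      have "x \<notin> {p..q}" "x \<notin> {p'..q'}" using that by auto
      then show ?thesis using f(3) g(3) by simp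
    qed
  qed (use f g in \<open>auto intro: smooth_lincomb\<close>)
qed

text \<open>The primitive of a test function is constant beyond the support, and the constant is the total integral.\<close>

lemma test_function_primitive:
  assumes "test_function {0<..} \<psi>" and z: "(\<integral>x. \<psi> x \<partial>half_line) = 0"
  obtains \<phi> where "test_function {0<..} \<phi>" "deriv \<phi> = \<psi>"
proof -
  obtain a b where ab: "0 < a" "a < b" and out: "\<And>x. x \<notin> {a..b} \<Longrightarrow> \<psi> x = 0" and s: "smooth \<psi>"
    using test_functionE[OF assms(1)] by blast
  have int: "\<psi> integrable_on {u..v}" for u v by (intro integrable_continuous_real smooth_continuous s)
  have I0: "integral {a..b} \<psi> = 0"
    using test_integral(2)[OF s out ab(1), of b "\<lambda>_. 1 :: real"] z
    by (simp add: absolutely_integrable_on_const)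
  define \<phi> where "\<phi> x = integral {a - 1..x} \<psi>" for x
  have left: "integral {u..v} \<psi> = 0" if "v \<le> a" for u v
  proof -
    have "integral {u..v} \<psi> = integral {u..v} (\<lambda>_. 0 :: real)"
      by (rule integral_spike[where S="{a}"]) (use that out in auto)
    then show ?thesis by simp
  qed
  have right: "integral {u..v} \<psi> = 0" if "b \<le> u" for u v
  proof -
    have "integral {u..v} \<psi> = integral {u..v} (\<lambda>_. 0 :: real)"
      by (rule integral_spike[where S="{b}"]) (use that out in auto)
    then show ?thesis by simp
  qed
  have d: "(\<phi> has_real_derivative \<psi> x) (at x)" for x
  proof (cases "x < a")
    case True
    have "\<forall>\<^sub>F y in nhds x. y \<in> {..<a}" using True by (intro eventually_nhds_in_open) auto
    then have "\<forall>\<^sub>F y in nhds x. \<phi> y = 0" by eventually_elim (auto simp: \<phi>_def left)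
    then have "(\<phi> has_real_derivative 0) (at x)"
      by (subst DERIV_cong_ev[OF refl _ refl, where g="\<lambda>_. 0"]) auto
    then show ?thesis using out[of x] True by simp
  next
    case False
    have "((\<lambda>u. integral {a - 1..u} \<psi>) has_real_derivative \<psi> x) (at x within {a - 1..x + 1})"
      by (rule integral_has_real_derivative[OF smooth_continuous[OF s]]) (use False in auto)
    moreover have "at x within {a - 1..x + 1} = at x"
      using False by (intro at_within_interior) (auto simp: interior_atLeastAtMost_real)
    ultimately show ?thesis by (simp add: \<phi>_def[abs_def])
  qed
  have "\<phi> x = 0" if "x \<notin> {a..b}" for x
  proof (cases "x < a")
    case True then show ?thesis by (simp add: \<phi>_def left)
  next
    case False
    then have x: "x > b" using that by auto
    have "\<phi> x = integral {a - 1..a} \<psi> + integral {a..x} \<psi>"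
      unfolding \<phi>_def using int x ab by (intro Henstock_Kurzweil_Integration.integral_combine[symmetric]) auto
    also have "integral {a..x} \<psi> = integral {a..b} \<psi> + integral {b..x} \<psi>"
      using int x ab by (intro Henstock_Kurzweil_Integration.integral_combine[symmetric]) auto
    finally show ?thesis using I0 by (simp add: left right)
  qed
  then have "test_function {0<..} \<phi>"
    by (intro test_functionI[where a=a and b=b] smooth_if_deriv[OF d s]) (use ab in auto)
  moreover have "deriv \<phi> = \<psi>" using d by (auto intro: DERIV_imp_deriv)
  ultimately show ?thesis using that by blast
qed

text \<open>An arbitrary test function differs from a multiple of a fixed bump by the derivative of a test
  function.  So testing against \<open>f\<close> agrees with testing against the bump average of \<open>f\<close>.\<close>

lemma du_Bois_Reymond:
  fixes f :: "real \<Rightarrow> 'a::euclidean_space"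
  assumes f: "locally_integrable f"
    and z: "\<And>\<phi>. test_function {0<..} \<phi> \<Longrightarrow> (\<integral>x. deriv \<phi> x *\<^sub>R f x \<partial>half_line) = 0"
  obtains c where "AE x in half_line. f x = c"
proof -
  define \<theta> where "\<theta> = bump 1 1 2"
  define I where "I = (\<integral>x. \<theta> x \<partial>half_line)"
  define c where "c = (1 / I) *\<^sub>R (\<integral>x. \<theta> x *\<^sub>R f x \<partial>half_line)"
  have I: "I > 0" unfolding I_def \<theta>_def by (rule integral_bump_pos) auto
  have \<theta>: "test_function {0<..} \<theta>" unfolding \<theta>_def by (rule test_function_bump) auto
  have int1: "integrable half_line \<psi>" if "test_function {0<..} \<psi>" for \<psi>
    using integrable_test_mult[OF that locally_integrable_const[of "1::real"]] by simp
  have "AE x in half_line. f x - c = 0"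
  proof (rule fundamental_lemma)
    show "locally_integrable (\<lambda>x. f x - c)" by (intro locally_integrable_diff f locally_integrable_const)
    fix \<psi> assume \<psi>: "test_function {0<..} \<psi>"
    define J where "J = (\<integral>x. \<psi> x \<partial>half_line)"
    define k where "k = - J / I"
    define \<eta> where "\<eta> = (\<lambda>x. 1 * \<psi> x + k * \<theta> x)"
    have \<eta>: "test_function {0<..} \<eta>" unfolding \<eta>_def by (rule test_function_lincomb[OF \<psi> \<theta>])
    have "(\<integral>x. \<eta> x \<partial>half_line) = J + k * I"
      unfolding \<eta>_def J_def I_def using int1[OF \<psi>] int1[OF \<theta>]
      by (subst Bochner_Integration.integral_add) auto
    then obtain \<phi> where "test_function {0<..} \<phi>" "deriv \<phi> = \<eta>"
      using I test_function_primitive[OF \<eta>] by (auto simp: k_def)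
    then have "0 = (\<integral>x. \<eta> x *\<^sub>R f x \<partial>half_line)" using z by metis
    also have "\<dots> = (\<integral>x. \<psi> x *\<^sub>R f x + k *\<^sub>R (\<theta> x *\<^sub>R f x) \<partial>half_line)"
      by (simp add: \<eta>_def scaleR_add_left algebra_simps)
    also have "\<dots> = (\<integral>x. \<psi> x *\<^sub>R f x \<partial>half_line) + k *\<^sub>R (\<integral>x. \<theta> x *\<^sub>R f x \<partial>half_line)"
      using integrable_test_mult[OF \<psi> f] integrable_test_mult[OF \<theta> f]
      by (subst Bochner_Integration.integral_add) (auto simp del: scaleR_scaleR)
    finally have 1: "(\<integral>x. \<psi> x *\<^sub>R f x \<partial>half_line) = J *\<^sub>R c"
      using I by (simp add: c_def k_def add_eq_0_iff)
    have "(\<integral>x. \<psi> x *\<^sub>R (f x - c) \<partial>half_line) = (\<integral>x. \<psi> x *\<^sub>R f x \<partial>half_line) - (\<integral>x. \<psi> x *\<^sub>R c \<partial>half_line)"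
      unfolding scaleR_diff_right
      by (rule Bochner_Integration.integral_diff)
        (rule integrable_test_mult[OF \<psi> f] integrable_test_mult[OF \<psi> locally_integrable_const])+
    also have "(\<integral>x. \<psi> x *\<^sub>R c \<partial>half_line) = J *\<^sub>R c"
      unfolding J_def using int1[OF \<psi>] by simp
    finally show "(\<integral>x. \<psi> x *\<^sub>R (f x - c) \<partial>half_line) = 0" using 1 by simp
  qed
  then have "AE x in half_line. f x = c" by eventually_elim simp
  then show ?thesis using that by blast
qed


section \<open>Approximation by compactly supported continuous functions\<close>

definition supported_in :: "real \<Rightarrow> (real \<Rightarrow> 'a::zero) \<Rightarrow> bool" where
  "supported_in R f \<longleftrightarrow> (\<forall>x. x \<le> 0 \<or> R \<le> x \<longrightarrow> f x = 0)"

lemma supported_inD: "supported_in R f \<Longrightarrow> x \<le> 0 \<or> R \<le> x \<Longrightarrow> f x = 0"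
  by (auto simp: supported_in_def)

lemma continuous_measurable_half_line:
  fixes f :: "real \<Rightarrow> 'a::euclidean_space"
  assumes "continuous_on {0<..} f" shows "f \<in> borel_measurable half_line"
  using assms by (intro continuous_imp_measurable_on_sets_lebesgue) auto

lemma continuous_bounded_support:
  fixes k :: "real \<Rightarrow> 'a::euclidean_space"
  assumes k: "continuous_on UNIV k" "supported_in R k" and b: "\<And>x. norm (k x) \<le> b"
  shows "L2_on {0<..} k" "sqnorm k \<le> b\<^sup>2 * max 0 R"
proof -
  have [measurable]: "k \<in> borel_measurable half_line"
    by (intro continuous_measurable_half_line continuous_on_subset[OF k(1)]) auto
  let ?d = "\<lambda>x. b\<^sup>2 * indicator {0<..max 0 R} x :: real"
  have ieq: "indicat_real {0<..} x *\<^sub>R ?d x = indicat_real {0<..max 0 R} x *\<^sub>R b\<^sup>2" for x by (simp add: indicator_def)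
  have "integrable lebesgue (\<lambda>x. indicat_real {0<..max 0 R} x *\<^sub>R b\<^sup>2)"
    by (intro integrable_scaleR_left integrable_real_indicator) auto
  then have "integrable lebesgue (\<lambda>x. indicat_real {0<..} x *\<^sub>R ?d x)" by (simp only: ieq)
  then have id: "integrable half_line ?d"
    by (rule integrable_restrict_space[THEN iffD2, rotated]) simp
  have intd: "(\<integral>x. ?d x \<partial>half_line) = b\<^sup>2 * max 0 R"
  proof -
    have "(\<integral>x. ?d x \<partial>half_line) = (\<integral>x. indicat_real {0<..} x *\<^sub>R ?d x \<partial>lebesgue)"
      by (rule integral_restrict_space) auto
    also have "\<dots> = (\<integral>x. indicat_real {0<..max 0 R} x *\<^sub>R b\<^sup>2 \<partial>lebesgue)" by (simp only: ieq)
    also have "\<dots> = b\<^sup>2 * max 0 R" by simp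
    finally show ?thesis .
  qed
  have le: "(norm (k x))\<^sup>2 \<le> ?d x" if "x > 0" for x
  proof (cases "x \<le> R")
    case True then show ?thesis using that power_mono[OF b[of x], of 2] by simp
  next
    case False then show ?thesis using supported_inD[OF k(2), of x] by simp
  qed
  show L: "L2_on {0<..} k"
    unfolding L2_on_def
  proof (intro conjI)
    show "integrable half_line (\<lambda>x. (norm (k x))\<^sup>2)"
    proof (rule Bochner_Integration.integrable_bound[OF id])
      show "AE x in half_line. norm ((norm (k x))\<^sup>2) \<le> norm (?d x)"
        by (rule AE_I2) (use le in \<open>auto simp: abs_of_nonneg\<close>)
    qed measurable
  qed measurable
  have "sqnorm k \<le> (\<integral>x. ?d x \<partial>half_line)"
    unfolding sqnorm_def
    by (rule integral_mono[OF _ id]) (use L le in \<open>auto simp: L2_on_def\<close>)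
  then show "sqnorm k \<le> b\<^sup>2 * max 0 R" unfolding intd .
qed

lemma continuous_supported_bounded:
  fixes k :: "real \<Rightarrow> 'a::euclidean_space"
  assumes k: "continuous_on UNIV k" "supported_in R k"
  obtains b where "\<And>x. norm (k x) \<le> b" "b \<ge> 0"
proof -
  have "compact (k ` {0..max 0 R})"
    by (intro compact_continuous_image continuous_on_subset[OF k(1)]) auto
  then obtain b where b: "\<And>x. x \<in> {0..max 0 R} \<Longrightarrow> norm (k x) \<le> b"
    by (metis bounded_iff compact_imp_bounded imageI)
  have "norm (k x) \<le> b" for x
  proof (cases "x \<in> {0..max 0 R}")
    case False
    then have "x \<le> 0 \<or> R \<le> x" by auto
    then have "k x = 0" by (rule supported_inD[OF k(2)])
    moreover have "0 \<le> b" using order_trans[OF norm_ge_zero b[of 0]] by simp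
    ultimately show ?thesis by simp
  qed (use b in auto)
  then show ?thesis using that norm_ge_zero order_trans by blast
qed

text \<open>Radial truncation: the point of the closed ball of radius \<open>M\<close> that is nearest to \<open>y\<close>.\<close>

definition truncate :: "real \<Rightarrow> 'a::real_normed_vector \<Rightarrow> 'a" where
  "truncate M y = (M / max M (norm y)) *\<^sub>R y"

lemma truncate_continuous: "M > 0 \<Longrightarrow> continuous_on S (truncate M)"
  unfolding truncate_def[abs_def] by (intro continuous_intros) auto

lemma norm_truncate: "M > 0 \<Longrightarrow> norm (truncate M y) \<le> M" "M > 0 \<Longrightarrow> norm (y - c *\<^sub>R truncate M y) \<le> norm y"
  if "0 \<le> c" "c \<le> 1"
proof -
  assume M: "M > 0"
  show "norm (truncate M y) \<le> M" using M by (auto simp: truncate_def max_def field_simps)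
  define d where "d = c * (M / max M (norm y))"
  have "M / max M (norm y) \<le> 1" "0 \<le> M / max M (norm y)" using M by auto
  then have "0 \<le> d" "d \<le> 1"
    unfolding d_def using that mult_nonneg_nonneg[of c "M / max M (norm y)"] mult_le_one[of c "M / max M (norm y)"]
    by simp_all
  moreover have "y - c *\<^sub>R truncate M y = (1 - d) *\<^sub>R y" by (simp add: truncate_def d_def scaleR_diff_left)
  ultimately show "norm (y - c *\<^sub>R truncate M y) \<le> norm y"
    using mult_right_mono[of "1 - d" 1 "norm y"] by simp
qed

text \<open>Cut off \<open>g\<close> near 0 and near infinity and truncate its values; this converges by dominated
  convergence.  The result is bounded with bounded support, so the almost everywhere approximation of
  measurable functions by continuous ones, truncated in the same way, converges in \<open>L2\<close> as well.\<close>

lemma L2_approx_continuous: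
  fixes g :: "real \<Rightarrow> 'a::euclidean_space"
  assumes g: "L2_on {0<..} g" and e: "e > 0"
  obtains k R where "continuous_on UNIV k" "supported_in R k" "R > 0" "sqnorm (\<lambda>x. g x - k x) < e"
proof -
  have gm[measurable]: "g \<in> borel_measurable half_line" using g by (simp add: L2_on_def)
  have "g measurable_on {0<..}" by (simp add: measurable_on_iff_borel_measurable gm)
  then obtain N and G :: "nat \<Rightarrow> real \<Rightarrow> 'a" where N: "negligible N" and G: "\<And>n. continuous_on UNIV (G n)"
     and lim: "\<And>x. x \<notin> N \<Longrightarrow> (\<lambda>n. G n x) \<longlonglongrightarrow> (if x \<in> {0<..} then g x else 0)"
    unfolding measurable_on_def by metis
  have AEN: "AE x in half_line. x \<notin> N"
    using N by (auto simp: negligible_iff_null_sets AE_restrict_space_iff intro: eventually_mono[OF AE_not_in])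
  (* The support has to be in [0, M + 1] while the cut-off tends to 1 at every positive point;
     the slope M at 0 achieves this. *)
  define cut where "cut M x = max 0 (min 1 (min (M * x) (M + 1 - x)))" for M x :: real
  have cut01: "0 \<le> cut M x" "cut M x \<le> 1" for M x by (auto simp: cut_def)
  have cutc: "continuous_on S (cut M)" for M S unfolding cut_def[abs_def] by (intro continuous_intros)
  have cuts: "cut M x = 0" if "x \<le> 0 \<or> M + 1 \<le> x" "M > 0" for M x
  proof -
    have "M * x \<le> 0 \<or> M + 1 - x \<le> 0" using that by (auto simp: mult_nonneg_nonpos)
    then show ?thesis by (auto simp: cut_def)
  qed
  define u where "u m x = cut (real m + 1) x *\<^sub>R truncate (real m + 1) (g x)" for m x
  have tm[measurable]: "truncate M \<in> borel_measurable borel" if "M > 0" for M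
    by (intro borel_measurable_continuous_onI truncate_continuous that)
  have cutm: "cut M \<in> borel_measurable half_line" for M
    by (intro continuous_measurable_half_line cutc)
  have um[measurable]: "u m \<in> borel_measurable half_line" for m
    unfolding u_def by (intro borel_measurable_scaleR cutm measurable_compose[OF gm tm]) auto
  have "(\<lambda>m. sqnorm (\<lambda>x. g x - u m x)) \<longlonglongrightarrow> (\<integral>x. 0 \<partial>half_line)"
    unfolding sqnorm_def
  proof (rule integral_dominated_convergence)
    show "integrable half_line (\<lambda>x. (norm (g x))\<^sup>2)" using g by (simp add: L2_on_def)
    show "AE x in half_line. norm ((norm (g x - u m x))\<^sup>2) \<le> (norm (g x))\<^sup>2" for m
      by (rule AE_I2) (auto simp: u_def intro!: power_mono norm_truncate cut01)
    show "AE x in half_line. (\<lambda>m. (norm (g x - u m x))\<^sup>2) \<longlonglongrightarrow> 0"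
    proof (rule AE_I2)
      fix x assume "x \<in> space half_line"
      then have x: "x > 0" by simp
      obtain n0 :: nat where n0: "real n0 \<ge> norm (g x)" "real n0 \<ge> x" "real n0 \<ge> 1 / x"
        by (metis real_arch_simple max.bounded_iff)
      have "u m x = g x" if "m \<ge> n0" for m
      proof -
        have m: "real m \<ge> norm (g x)" "real m \<ge> x" "real m \<ge> 1 / x" using n0 that by (auto intro: order_trans)
        then have "(real m + 1) * x \<ge> 1" using x by (simp add: field_simps)
        then have "cut (real m + 1) x = 1" using m by (simp add: cut_def)
        moreover have "truncate (real m + 1) (g x) = g x" using m by (simp add: truncate_def max_def)
        ultimately show ?thesis by (simp add: u_def)
      qed
      then have "\<forall>\<^sub>F m in sequentially. (norm (g x - u m x))\<^sup>2 = 0"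
        unfolding eventually_sequentially by (intro exI[of _ n0]) auto
      then show "(\<lambda>m. (norm (g x - u m x))\<^sup>2) \<longlonglongrightarrow> 0" by (rule tendsto_eventually)
    qed
  qed measurable
  then have "\<forall>\<^sub>F m in sequentially. sqnorm (\<lambda>x. g x - u m x) < e / 4"
    using e by (auto dest!: order_tendstoD(2)[where a="e/4"])
  then obtain m where m: "sqnorm (\<lambda>x. g x - u m x) < e / 4" by (auto simp: eventually_sequentially)
  define M where "M = real m + 1"
  have M: "M > 0" by (simp add: M_def)
  define k where "k n x = cut M x *\<^sub>R truncate M (G n x)" for n x
  have kc: "continuous_on UNIV (k n)" for n
    unfolding k_def by (intro continuous_intros cutc continuous_on_compose2[OF truncate_continuous[OF M, of UNIV] G]) auto
  have ks: "supported_in (M + 1) (k n)" for n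
    unfolding supported_in_def k_def using cuts M by auto
  have kb: "norm (k n x) \<le> M" for n x
    unfolding k_def using mult_mono[OF cut01(2) norm_truncate(1)[of 0 M "G n x"]] cut01[of M x] M by simp
  have ub: "norm (u m x) \<le> M" for x
    unfolding u_def M_def[symmetric] using mult_mono[OF cut01(2) norm_truncate(1)[of 0 M "g x"]] cut01[of M x] M by simp
  have us: "supported_in (M + 1) (u m)"
    unfolding supported_in_def u_def M_def[symmetric] using cuts M by auto
  have km[measurable]: "k n \<in> borel_measurable half_line" for n
    by (intro continuous_measurable_half_line continuous_on_subset[OF kc]) auto
  have "(\<lambda>n. sqnorm (\<lambda>x. u m x - k n x)) \<longlonglongrightarrow> (\<integral>x. 0 \<partial>half_line)"
    unfolding sqnorm_def
  proof (rule integral_dominated_convergence)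
    define w where "w x = (if x \<le> M + 1 then 4 * M\<^sup>2 else 0)" for x
    have "emeasure lborel {0<..M + 1} < \<infinity>"
      using emeasure_lborel_Ioc[of 0 "M + 1"] M by simp
    then have "integrable lebesgue (\<lambda>x. indicat_real {0<..M+1} x *\<^sub>R (4 * M\<^sup>2))"
      by (intro integrable_scaleR_left integrable_real_indicator) auto
    moreover have "indicat_real {0<..} x *\<^sub>R w x = indicat_real {0<..M+1} x *\<^sub>R (4 * M\<^sup>2)" for x
      by (simp add: indicator_def w_def)
    ultimately show "integrable half_line w" by (simp add: integrable_restrict_space)
    show "AE x in half_line. norm ((norm (u m x - k n x))\<^sup>2) \<le> w x" for n
    proof (rule AE_I2)
      fix x
      have "norm (u m x - k n x) \<le> 2 * M" using norm_triangle_ineq4[of "u m x" "k n x"] ub[of x] kb[of n x] by linarith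
      then have "(norm (u m x - k n x))\<^sup>2 \<le> (2 * M)\<^sup>2" by (intro power_mono) auto
      then show "norm ((norm (u m x - k n x))\<^sup>2) \<le> w x"
        using supported_inD[OF us, of x] supported_inD[OF ks, of x n] by (auto simp: w_def power_mult_distrib)
    qed
    show "AE x in half_line. (\<lambda>n. (norm (u m x - k n x))\<^sup>2) \<longlonglongrightarrow> 0"
    proof -
      have "AE x in half_line. 0 < x" by (rule AE_I2) auto
      with AEN show ?thesis
      proof eventually_elim
        case (elim x)
        have "(\<lambda>n. G n x) \<longlonglongrightarrow> g x" using lim[of x] elim by auto
        then have "(\<lambda>n. truncate M (G n x)) \<longlonglongrightarrow> truncate M (g x)"
          by (rule continuous_on_tendsto_compose[OF truncate_continuous[OF M, of UNIV]]) auto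
        then have "(\<lambda>n. (norm (u m x - k n x))\<^sup>2) \<longlonglongrightarrow> (norm (u m x - cut M x *\<^sub>R truncate M (g x)))\<^sup>2"
          unfolding k_def by (intro tendsto_intros)
        then show ?case by (simp add: u_def M_def)
      qed
    qed
  qed measurable
  then have "\<forall>\<^sub>F n in sequentially. sqnorm (\<lambda>x. u m x - k n x) < e / 4"
    using e by (auto dest!: order_tendstoD(2)[where a="e/4"])
  then obtain n where n: "sqnorm (\<lambda>x. u m x - k n x) < e / 4" by (auto simp: eventually_sequentially)
  have Lk: "L2_on {0<..} (k n)" by (rule continuous_bounded_support[OF kc ks kb])
  have Lu: "L2_on {0<..} (u m)"
    unfolding L2_on_def
  proof (intro conjI)
    show "integrable half_line (\<lambda>x. (norm (u m x))\<^sup>2)"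
    proof (rule Bochner_Integration.integrable_bound)
      show "integrable half_line (\<lambda>x. (norm (g x))\<^sup>2)" using g by (simp add: L2_on_def)
      have "norm (u m x) \<le> norm (g x)" for x
      proof -
        have "norm (u m x) \<le> 1 * norm (truncate M (g x))"
          unfolding u_def M_def[symmetric] norm_scaleR using cut01[of M x] by (intro mult_right_mono) auto
        also have "\<dots> \<le> norm (g x)"
          using M mult_right_mono[of "M / max M (norm (g x))" 1 "norm (g x)"] by (simp add: truncate_def)
        finally show ?thesis .
      qed
      then show "AE x in half_line. norm ((norm (u m x))\<^sup>2) \<le> norm ((norm (g x))\<^sup>2)"
        by (intro AE_I2) (auto intro!: power_mono)
    qed measurable
  qed measurable
  have "sqnorm (\<lambda>x. g x - k n x) < e"
    using sqnorm_diff_trans[OF g Lu Lk] m n by linarith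
  then show ?thesis using that[OF kc ks, of n] M by auto
qed


section \<open>Weak derivatives and H2 on the half-line\<close>

lemma zero_if_norm_le_sqrt:
  fixes v :: "'a::real_normed_vector"
  assumes "\<And>e. e > 0 \<Longrightarrow> norm v \<le> D * sqrt e" "D \<ge> 0"
  shows "v = 0"
proof (rule ccontr)
  assume "v \<noteq> 0"
  define e where "e = (norm v / (2 * D + 1))\<^sup>2"
  have e: "e > 0" "sqrt e = norm v / (2 * D + 1)" using \<open>v \<noteq> 0\<close> assms(2) by (auto simp: e_def)
  have "norm v * (2 * D + 1) \<le> D * norm v" using assms(1)[OF e(1)] assms(2) by (simp add: e(2) field_simps)
  then show False using \<open>v \<noteq> 0\<close> assms(2) mult_nonneg_nonneg[of D "norm v"] by (simp add: algebra_simps)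
    (smt (verit) mult_nonneg_nonneg norm_ge_zero zero_less_norm_iff)
qed

lemma at_within_Icc_Suc: "x \<ge> 0 \<Longrightarrow> at x within {0..x + 1} = at x within {0::real..}"
  by (rule at_within_nhd[where S="{x - 1<..<x + 1}"]) auto

lemma continuous_on_atLeast_0:
  fixes h :: "real \<Rightarrow> 'a::topological_space"
  assumes "\<And>b. continuous_on {0..b} h"
  shows "continuous_on {0..} h"
  unfolding continuous_on_eq_continuous_within
proof
  fix x :: real assume x: "x \<in> {0..}"
  then have "continuous (at x within {0..x + 1}) h"
    using assms[of "x + 1"] by (simp add: continuous_on_eq_continuous_within)
  then show "continuous (at x within {0..}) h" using x by (simp add: at_within_Icc_Suc)
qed

lemma L2_integrable_on: "L2_on {0<..} g \<Longrightarrow> 0 \<le> a \<Longrightarrow> g integrable_on {a..b}"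
  using L2_absolutely_integrable(1) absolutely_integrable_on_def by blast

lemma L2_primitive_continuous: "L2_on {0<..} g \<Longrightarrow> continuous_on {0..b} (\<lambda>x. integral {0..x} g)"
  by (intro indefinite_integral_continuous_1 L2_integrable_on) auto

lemma L2_locally_integrable: "L2_on {0<..} g \<Longrightarrow> locally_integrable g"
  unfolding locally_integrable_def by (auto intro!: L2_absolutely_integrable(1))

lemma continuous_locally_integrable:
  fixes f :: "real \<Rightarrow> 'a::euclidean_space"
  assumes "\<And>a b. 0 < a \<Longrightarrow> a < b \<Longrightarrow> continuous_on {a..b} f"
  shows "locally_integrable f"
  unfolding locally_integrable_def using assms by (auto intro: absolutely_integrable_continuous_real)

text \<open>For continuous \<open>g\<close> this is integration by parts.  Both sides are continuous with respect to the \<open>L2\<close>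
  seminorm of \<open>g\<close>, by Cauchy--Schwarz on the support of the test function, so density of the
  continuous functions finishes the proof.\<close>

lemma primitive_weak_derivative:
  fixes g :: "real \<Rightarrow> 'a::euclidean_space"
  assumes g: "L2_on {0<..} g" and \<phi>: "test_function {0<..} \<phi>"
  shows "(\<integral>x. deriv \<phi> x *\<^sub>R integral {0..x} g \<partial>half_line) = - (\<integral>x. \<phi> x *\<^sub>R g x \<partial>half_line)"
proof -
  obtain a0 b0 where ab0: "0 < a0" "a0 < b0" and out0: "\<And>x. x \<notin> {a0..b0} \<Longrightarrow> \<phi> x = 0" and s: "smooth \<phi>"
    using test_functionE[OF \<phi>] by blast
  (* The slightly larger interval makes the boundary terms of the integration by parts vanish. *)
  define a where "a = a0 / 2"
  define b where "b = b0 + 1"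
  have ab: "0 < a" "a < b" using ab0 by (auto simp: a_def b_def)
  have out: "\<phi> x = 0" if "x \<notin> {a..b} \<or> x = a \<or> x = b" for x
    using that ab0 by (intro out0) (auto simp: a_def b_def)
  have out': "deriv \<phi> x = 0" if "x \<notin> {a..b}" for x
    by (rule deriv_zero_outside[where a=a and b=b]) (use out that in auto)
  have s': "smooth (deriv \<phi>)" by (rule smooth_deriv[OF s])
  obtain C where C: "C \<ge> 0" "\<And>x. x \<in> {a..b} \<Longrightarrow> \<bar>\<phi> x\<bar> \<le> C" "\<And>x. x \<in> {a..b} \<Longrightarrow> \<bar>deriv \<phi> x\<bar> \<le> C"
  proof -
    have "bounded (\<phi> ` {a..b})" "bounded (deriv \<phi> ` {a..b})"
      by (intro compact_imp_bounded compact_continuous_image smooth_continuous s s' compact_Icc)+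
    then obtain C1 C2 where "\<And>x. x \<in> {a..b} \<Longrightarrow> \<bar>\<phi> x\<bar> \<le> C1" "\<And>x. x \<in> {a..b} \<Longrightarrow> \<bar>deriv \<phi> x\<bar> \<le> C2"
      by (metis bounded_iff imageI real_norm_def)
    then show ?thesis by (intro that[of "max 0 (max C1 C2)"]) (auto simp: le_max_iff_disj)
  qed
  define A where "A f = integral {a..b} (\<lambda>x. deriv \<phi> x *\<^sub>R integral {0..x} f)" for f :: "real \<Rightarrow> 'a"
  define J where "J f = integral {a..b} (\<lambda>x. \<phi> x *\<^sub>R f x)" for f :: "real \<Rightarrow> 'a"
  have prim_abs: "(\<lambda>x. integral {0..x} f) absolutely_integrable_on {a..b}" if "L2_on {0<..} f" for f :: "real \<Rightarrow> 'a"
    using ab by (intro absolutely_integrable_continuous_real continuous_on_subset[OF L2_primitive_continuous[OF that, of b]]) auto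
  have A_int: "(\<lambda>x. deriv \<phi> x *\<^sub>R integral {0..x} f) integrable_on {a..b}" if "L2_on {0<..} f" for f :: "real \<Rightarrow> 'a"
    using smooth_mult_absolutely_integrable[OF s' prim_abs[OF that]] absolutely_integrable_on_def by blast
  have J_int: "(\<lambda>x. \<phi> x *\<^sub>R f x) integrable_on {a..b}" if "L2_on {0<..} f" for f :: "real \<Rightarrow> 'a"
    using smooth_mult_absolutely_integrable[OF s L2_absolutely_integrable(1)[OF that, of a b]] ab
    by (simp add: absolutely_integrable_on_def)
  define D where "D = C * (b - a) * sqrt b + C * sqrt (b - a)"
  have "A g + J g = 0"
  proof (rule zero_if_norm_le_sqrt)
    show "D \<ge> 0" using C ab by (auto simp: D_def)
    fix e :: real assume e: "e > 0"
    obtain k R where k: "continuous_on UNIV k" "supported_in R k" and sk: "sqnorm (\<lambda>x. g x - k x) < e"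
      using L2_approx_continuous[OF g e] by metis
    obtain bd where "\<And>x. norm (k x) \<le> bd" using continuous_supported_bounded[OF k] by blast
    then have Lk: "L2_on {0<..} k" by (rule continuous_bounded_support(1)[OF k])
    let ?d = "\<lambda>x. g x - k x"
    have Ld: "L2_on {0<..} ?d" by (rule L2_on_diff[OF g Lk])
    have zero: "A k + J k = 0"
    proof -
      have "((\<lambda>x. deriv \<phi> x *\<^sub>R integral {0..x} k + \<phi> x *\<^sub>R k x) has_integral
          (\<phi> b *\<^sub>R integral {0..b} k - \<phi> a *\<^sub>R integral {0..a} k)) {a..b}"
      proof (rule fundamental_theorem_of_calculus)
        fix x assume x: "x \<in> {a..b}"
        have "((\<lambda>u. integral {0..u} k) has_vector_derivative k x) (at x within {0..b})"
          by (rule integral_has_vector_derivative) (use continuous_on_subset[OF k(1)] x ab in auto)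
        then have 1: "((\<lambda>u. integral {0..u} k) has_vector_derivative k x) (at x within {a..b})"
          by (rule has_vector_derivative_within_subset) (use ab in auto)
        have 2: "(\<phi> has_real_derivative deriv \<phi> x) (at x within {a..b})"
          using smooth_has_deriv[OF s] by (rule has_field_derivative_at_within)
        show "((\<lambda>x. \<phi> x *\<^sub>R integral {0..x} k) has_vector_derivative deriv \<phi> x *\<^sub>R integral {0..x} k + \<phi> x *\<^sub>R k x) (at x within {a..b})"
          using has_vector_derivative_scaleR[OF 2 1] by (simp add: add.commute)
      qed (use ab in auto)
      then have "integral {a..b} (\<lambda>x. deriv \<phi> x *\<^sub>R integral {0..x} k + \<phi> x *\<^sub>R k x) = 0"
        using out by (simp add: integral_unique)
      then show ?thesis unfolding A_def J_def
        using integral_add[OF A_int[OF Lk] J_int[OF Lk]] by simp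
    qed
    have prim: "integral {0..x} ?d = integral {0..x} g - integral {0..x} k" for x
      by (intro integral_diff L2_integrable_on g Lk order_refl)
    have "A ?d = A g - A k"
      unfolding A_def prim scaleR_diff_right by (intro integral_diff A_int g Lk)
    moreover have "J ?d = J g - J k"
      unfolding J_def scaleR_diff_right by (intro integral_diff J_int g Lk)
    ultimately have eq: "A g + J g = A ?d + J ?d" using zero by (metis add.right_neutral add_diff_add diff_zero)
    have "norm (A ?d) \<le> integral {a..b} (\<lambda>x. C * sqrt (b * e))"
      unfolding A_def
    proof (rule integral_norm_bound_integral)
      show "norm (deriv \<phi> x *\<^sub>R integral {0..x} ?d) \<le> C * sqrt (b * e)" if x: "x \<in> {a..b}" for x
      proof -
        have "(norm (integral {0..x} ?d))\<^sup>2 \<le> (x - 0) * sqnorm ?d"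
          using L2_norm_integral_squared_le(1)[OF Ld, of 0 x] x ab by auto
        also have "\<dots> \<le> b * e" using x ab sk sqnorm_nonneg[of ?d] by (intro mult_mono) auto
        finally have "norm (integral {0..x} ?d) \<le> sqrt (b * e)" by (rule real_le_rsqrt)
        then show ?thesis using C(3)[OF x] C(1) by (auto intro: mult_mono)
      qed
    qed (use A_int[OF Ld] in auto)
    also have "\<dots> = C * (b - a) * sqrt b * sqrt e" using ab by (simp add: real_sqrt_mult)
    finally have 1: "norm (A ?d) \<le> C * (b - a) * sqrt b * sqrt e" .
    have "norm (J ?d) \<le> integral {a..b} (\<lambda>x. C * norm (?d x))"
      unfolding J_def
    proof (rule integral_norm_bound_integral)
      show "(\<lambda>x. C * norm (?d x)) integrable_on {a..b}"
        using L2_absolutely_integrable(1)[OF Ld, of a b] ab by (intro integrable_on_mult_right) (auto simp: absolutely_integrable_on_def)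
      show "norm (\<phi> x *\<^sub>R ?d x) \<le> C * norm (?d x)" if "x \<in> {a..b}" for x
        using C(2)[OF that] by (auto intro: mult_right_mono)
    qed (use J_int[OF Ld] in auto)
    also have "\<dots> = C * integral {a..b} (\<lambda>x. norm (?d x))" by simp
    also have "\<dots> \<le> C * sqrt ((b - a) * e)"
    proof (intro mult_left_mono real_le_rsqrt C)
      have "(integral {a..b} (\<lambda>x. norm (?d x)))\<^sup>2 \<le> (b - a) * sqnorm ?d"
        using L2_norm_integral_squared_le(2)[OF Ld, of a b] ab by auto
      also have "\<dots> \<le> (b - a) * e" using ab sk by (intro mult_left_mono) auto
      finally show "(integral {a..b} (\<lambda>x. norm (?d x)))\<^sup>2 \<le> (b - a) * e" .
    qed
    finally have "norm (J ?d) \<le> C * sqrt (b - a) * sqrt e" by (simp add: real_sqrt_mult)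
    with 1 show "norm (A g + J g) \<le> D * sqrt e"
      unfolding eq D_def distrib_right using norm_triangle_ineq[of "A ?d" "J ?d"] by linarith
  qed
  moreover have "(\<integral>x. deriv \<phi> x *\<^sub>R integral {0..x} g \<partial>half_line) = A g"
    unfolding A_def by (rule test_integral(2)[OF s' out' ab(1) prim_abs[OF g]])
  moreover have "(\<integral>x. \<phi> x *\<^sub>R g x \<partial>half_line) = J g"
    unfolding J_def using ab by (intro test_integral(2)[OF s _ ab(1) L2_absolutely_integrable(1)[OF g]]) (auto simp: out)
  ultimately show ?thesis by (simp add: add_eq_0_iff)
qed

lemma half_line_AE_negligible:
  assumes "AE x in half_line. P x" shows "negligible {x. 0 < x \<and> \<not> P x}"
proof -
  have "AE x in lebesgue. 0 < x \<longrightarrow> P x"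
    using AE_restrict_space_iff[THEN iffD1, OF _ assms] by simp
  then obtain N where N: "N \<in> null_sets lebesgue" "\<And>x. x \<notin> N \<Longrightarrow> 0 < x \<longrightarrow> P x"
    unfolding completion.AE_iff_null_sets by auto
  then have "negligible N" by (simp add: negligible_iff_null_sets)
  then show ?thesis by (rule negligible_subset) (use N(2) in auto)
qed

lemma integral_cong_half_line_AE:
  assumes "AE x in half_line. f x = g x" "0 \<le> a"
  shows "integral {a..b} f = integral {a..b} g"
  by (rule integral_spike[where S="insert 0 {x. 0 < x \<and> f x \<noteq> g x}"])
    (use half_line_AE_negligible[OF assms(1)] assms(2) in auto)

text \<open>The set of positive \<open>x\<close> with \<open>h x \<noteq> 0\<close> is open and negligible, hence empty.\<close>

lemma continuous_AE_zero:
  fixes h :: "real \<Rightarrow> 'a::real_normed_vector"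
  assumes h: "continuous_on {0..} h" and z: "AE x in half_line. h x = 0" and x: "x \<ge> 0"
  shows "h x = 0"
proof -
  have "open {x \<in> {0<..}. h x \<in> - {0}}"
    by (intro continuous_open_preimage[unfolded vimage_def Int_def mem_Collect_eq] continuous_on_subset[OF h]) auto
  moreover have "negligible {x \<in> {0<..}. h x \<in> - {0}}"
    using half_line_AE_negligible[OF z] by (rule negligible_subset) auto
  ultimately have "{x \<in> {0<..}. h x \<in> - {0}} = {}" using open_not_negligible by blast
  then have pos: "h y = 0" if "y > 0" for y using that by auto
  show ?thesis
  proof (cases "x = 0")
    case True
    have "(h \<longlongrightarrow> h 0) (at 0 within {0<..})"
      using h by (auto simp: continuous_on_def intro: tendsto_within_subset)
    moreover have "(h \<longlongrightarrow> 0) (at 0 within {0<..})"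
      by (rule tendsto_eventually) (auto simp: eventually_at_filter pos)
    ultimately show ?thesis using True tendsto_unique[of "at_right (0::real)" h] by (auto simp: trivial_limit_at_right_real)
  qed (use pos x in auto)
qed

text \<open>The difference of \<open>f\<close> and the primitive of \<open>g\<close> has weak derivative zero.\<close>

lemma weak_derivative_primitive:
  fixes f g :: "real \<Rightarrow> 'a::euclidean_space"
  assumes f: "L2_on {0<..} f" and g: "L2_on {0<..} g"
    and w: "\<And>\<phi>. test_function {0<..} \<phi> \<Longrightarrow>
      (\<integral>x. deriv \<phi> x *\<^sub>R f x \<partial>half_line) = - (\<integral>x. \<phi> x *\<^sub>R g x \<partial>half_line)"
  obtains c where "AE x in half_line. f x = c + integral {0..x} g"
proof -
  have lg: "locally_integrable (\<lambda>x. integral {0..x} g)"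
    by (intro continuous_locally_integrable continuous_on_subset[OF L2_primitive_continuous[OF g]]) auto
  have "\<exists>c. AE x in half_line. f x - integral {0..x} g = c"
  proof (rule du_Bois_Reymond)
    show "locally_integrable (\<lambda>x. f x - integral {0..x} g)"
      by (intro locally_integrable_diff L2_locally_integrable f lg)
    fix \<phi> assume \<phi>: "test_function {0<..} \<phi>"
    note \<phi>' = test_function_deriv[OF \<phi>]
    have "(\<integral>x. deriv \<phi> x *\<^sub>R (f x - integral {0..x} g) \<partial>half_line) =
       (\<integral>x. deriv \<phi> x *\<^sub>R f x \<partial>half_line) - (\<integral>x. deriv \<phi> x *\<^sub>R integral {0..x} g \<partial>half_line)"
      unfolding scaleR_diff_right
      by (intro Bochner_Integration.integral_diff integrable_test_mult \<phi>' L2_locally_integrable f lg)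
    then show "(\<integral>x. deriv \<phi> x *\<^sub>R (f x - integral {0..x} g) \<partial>half_line) = 0"
      using w[OF \<phi>] primitive_weak_derivative[OF g \<phi>] by simp
  qed blast
  then obtain c where "AE x in half_line. f x - integral {0..x} g = c" by blast
  then have "AE x in half_line. f x = c + integral {0..x} g" by eventually_elim (auto simp: algebra_simps)
  then show ?thesis using that by blast
qed

lemma weak_derivative_on_1:
  "weak_derivative_on {0<..} (Suc 0) f g \<longleftrightarrow> L2_on {0<..} g \<and> (\<forall>\<phi>. test_function {0<..} \<phi> \<longrightarrow>
      (\<integral>x. deriv \<phi> x *\<^sub>R f x \<partial>half_line) = - (\<integral>x. \<phi> x *\<^sub>R g x \<partial>half_line))"
  by (simp add: weak_derivative_on_def)

lemma weak_derivative_on_2: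
  "weak_derivative_on {0<..} 2 f g \<longleftrightarrow> L2_on {0<..} g \<and> (\<forall>\<phi>. test_function {0<..} \<phi> \<longrightarrow>
      (\<integral>x. deriv (deriv \<phi>) x *\<^sub>R f x \<partial>half_line) = (\<integral>x. \<phi> x *\<^sub>R g x \<partial>half_line))"
  by (simp add: weak_derivative_on_def numeral_2_eq_2)

lemma weak_derivative_on_unique:
  assumes "weak_derivative_on {0<..} k f g" "weak_derivative_on {0<..} k f h"
  shows "AE x in half_line. g x = h x"
proof -
  have L: "L2_on {0<..} g" "L2_on {0<..} h" using assms by (auto simp: weak_derivative_on_def)
  have "AE x in half_line. g x - h x = 0"
  proof (rule fundamental_lemma)
    show "locally_integrable (\<lambda>x. g x - h x)" by (intro locally_integrable_diff L2_locally_integrable L)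
    fix \<phi> assume \<phi>: "test_function {0<..} \<phi>"
    have "(-1) ^ k *\<^sub>R (\<integral>x. \<phi> x *\<^sub>R g x \<partial>half_line) = (-1) ^ k *\<^sub>R (\<integral>x. \<phi> x *\<^sub>R h x \<partial>half_line)"
      using assms \<phi> by (auto simp: weak_derivative_on_def)
    then have "(\<integral>x. \<phi> x *\<^sub>R g x \<partial>half_line) = (\<integral>x. \<phi> x *\<^sub>R h x \<partial>half_line)" by simp
    moreover have "(\<integral>x. \<phi> x *\<^sub>R (g x - h x) \<partial>half_line) = (\<integral>x. \<phi> x *\<^sub>R g x \<partial>half_line) - (\<integral>x. \<phi> x *\<^sub>R h x \<partial>half_line)"
      unfolding scaleR_diff_right
      by (intro Bochner_Integration.integral_diff integrable_test_mult \<phi> L2_locally_integrable L)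
    ultimately show "(\<integral>x. \<phi> x *\<^sub>R (g x - h x) \<partial>half_line) = 0" by simp
  qed
  then show ?thesis by eventually_elim simp
qed

lemma H2_norm_nonneg: "H2_norm S f \<ge> 0"
  unfolding H2_norm_def by (intro real_sqrt_ge_zero sum_nonneg) auto

text \<open>Weak derivatives are unique almost everywhere, so the choice in \<open>weak_deriv\<close> can be replaced
  by any weak derivatives at hand.\<close>

lemma H2_norm_squared:
  assumes f: "L2_on {0<..} f" and w: "weak_derivative_on {0<..} (Suc 0) f p" "weak_derivative_on {0<..} 2 f g"
  shows "(H2_norm {0<..} f)\<^sup>2 = sqnorm f + sqnorm p + sqnorm g"
proof -
  have *: "(\<integral>x. (norm (weak_deriv {0<..} k f x))\<^sup>2 \<partial>half_line) = sqnorm h" if h: "weak_derivative_on {0<..} k f h" for k h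
  proof -
    have wd: "weak_derivative_on {0<..} k f (weak_deriv {0<..} k f)"
      unfolding weak_deriv_def by (rule someI[of "weak_derivative_on {0<..} k f", OF h])
    show ?thesis
      unfolding sqnorm_def[symmetric]
      by (rule sqnorm_cong_AE[OF _ _ weak_derivative_on_unique[OF wd h]])
        (use wd h in \<open>auto simp: weak_derivative_on_def L2_on_def\<close>)
  qed
  have 0: "weak_derivative_on {0<..} 0 f f" using f by (simp add: weak_derivative_on_def)
  have "(H2_norm {0<..} f)\<^sup>2 = (\<Sum>k\<le>2. \<integral>x. (norm (weak_deriv {0<..} k f x))\<^sup>2 \<partial>half_line)"
    unfolding H2_norm_def by (intro real_sqrt_pow2 sum_nonneg) auto
  also have "\<dots> = sqnorm f + sqnorm p + sqnorm g"
    using *[OF 0] *[OF w(1)] *[OF w(2)] by (simp add: numeral_2_eq_2 atMost_Suc)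
  finally show ?thesis .
qed

lemma weak_derivative_on_primitive:
  fixes f p :: "real \<Rightarrow> 'a::euclidean_space"
  assumes p: "L2_on {0<..} p" and f: "\<And>x. x > 0 \<Longrightarrow> f x = c + integral {0..x} p"
    and \<phi>: "test_function {0<..} \<phi>"
  shows "(\<integral>x. deriv \<phi> x *\<^sub>R f x \<partial>half_line) = - (\<integral>x. \<phi> x *\<^sub>R p x \<partial>half_line)"
proof -
  note \<phi>' = test_function_deriv[OF \<phi>]
  obtain a b where ab: "0 < a" "a < b" and out: "\<And>x. x \<notin> {a..b} \<Longrightarrow> \<phi> x = 0" and s: "smooth \<phi>"
    using test_functionE[OF \<phi>] by blast
  have lp: "locally_integrable (\<lambda>x. integral {0..x} p)"
    by (intro continuous_locally_integrable continuous_on_subset[OF L2_primitive_continuous[OF p]]) auto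
  have z: "(\<integral>x. deriv \<phi> x *\<^sub>R c \<partial>half_line) = 0"
  proof -
    have d: "deriv \<phi> x = 0" if "x \<notin> {a/2..b+1}" for x
      by (rule deriv_zero_outside[where a=a and b=b]) (use out that ab in auto)
    have "(\<integral>x. deriv \<phi> x *\<^sub>R c \<partial>half_line) = integral {a/2..b+1} (\<lambda>x. deriv \<phi> x *\<^sub>R c)"
      by (rule test_integral(2)[OF smooth_deriv[OF s] d]) (use ab in \<open>auto intro: absolutely_integrable_on_const\<close>)
    moreover have "((\<lambda>x. deriv \<phi> x *\<^sub>R c) has_integral (\<phi> (b + 1) *\<^sub>R c - \<phi> (a / 2) *\<^sub>R c)) {a/2..b+1}"
    proof (rule fundamental_theorem_of_calculus)
      fix x assume "x \<in> {a/2..b+1}"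
      have "(\<phi> has_real_derivative deriv \<phi> x) (at x within {a/2..b+1})"
        using smooth_has_deriv[OF s] by (rule has_field_derivative_at_within)
      then show "((\<lambda>x. \<phi> x *\<^sub>R c) has_vector_derivative deriv \<phi> x *\<^sub>R c) (at x within {a/2..b+1})"
        by (auto intro!: derivative_eq_intros)
    qed (use ab in auto)
    ultimately show ?thesis using out[of "b+1"] out[of "a/2"] ab by (simp add: integral_unique)
  qed
  have "(\<integral>x. deriv \<phi> x *\<^sub>R f x \<partial>half_line) = (\<integral>x. deriv \<phi> x *\<^sub>R c + deriv \<phi> x *\<^sub>R integral {0..x} p \<partial>half_line)"
    by (intro Bochner_Integration.integral_cong) (auto simp: f scaleR_add_right)
  also have "\<dots> = (\<integral>x. deriv \<phi> x *\<^sub>R c \<partial>half_line) + (\<integral>x. deriv \<phi> x *\<^sub>R integral {0..x} p \<partial>half_line)"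
    by (intro Bochner_Integration.integral_add integrable_test_mult \<phi>' locally_integrable_const lp)
  finally show ?thesis using z primitive_weak_derivative[OF p \<phi>] by simp
qed

lemma H2_on_primitive:
  fixes f p g :: "real \<Rightarrow> 'a::euclidean_space"
  assumes L: "L2_on {0<..} f" "L2_on {0<..} p" "L2_on {0<..} g"
    and f: "\<And>x. x > 0 \<Longrightarrow> f x = c + integral {0..x} p"
    and p: "\<And>x. x > 0 \<Longrightarrow> p x = d + integral {0..x} g"
  shows "H2_on {0<..} f" "(H2_norm {0<..} f)\<^sup>2 = sqnorm f + sqnorm p + sqnorm g"
proof -
  have w1: "weak_derivative_on {0<..} (Suc 0) f p"
    unfolding weak_derivative_on_1 using weak_derivative_on_primitive[OF L(2) f] L by auto
  have w2: "weak_derivative_on {0<..} 2 f g"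
    unfolding weak_derivative_on_2
    using weak_derivative_on_primitive[OF L(2) f test_function_deriv] weak_derivative_on_primitive[OF L(3) p] L by auto
  show "H2_on {0<..} f" using w1 w2 L by (auto simp: H2_on_def)
  show "(H2_norm {0<..} f)\<^sup>2 = sqnorm f + sqnorm p + sqnorm g" by (rule H2_norm_squared[OF L(1) w1 w2])
qed

text \<open>The second weak derivative of \<open>f\<close> is the first weak derivative of the first one, because the
  derivative of a test function is a test function.  Two applications of du Bois-Reymond represent \<open>f\<close>
  as an iterated primitive almost everywhere, and continuity removes the exceptional set.\<close>

lemma H2_on_regular:
  fixes f f' :: "real \<Rightarrow> 'a::euclidean_space"
  assumes H: "H2_on {0<..} f" and d: "\<And>x. x \<ge> 0 \<Longrightarrow> (f has_vector_derivative f' x) (at x within {0..})"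
  obtains g where "L2_on {0<..} f" "L2_on {0<..} f'" "L2_on {0<..} g"
    "\<And>x. x \<ge> 0 \<Longrightarrow> f x = f 0 + integral {0..x} f'" "\<And>x. x \<ge> 0 \<Longrightarrow> f' x = f' 0 + integral {0..x} g"
    "(H2_norm {0<..} f)\<^sup>2 = sqnorm f + sqnorm f' + sqnorm g"
proof -
  obtain g1 g2 where L: "L2_on {0<..} f" and w: "weak_derivative_on {0<..} (Suc 0) f g1" "weak_derivative_on {0<..} 2 f g2"
    using H by (auto simp: H2_on_def)
  have L1: "L2_on {0<..} g1" and L2: "L2_on {0<..} g2" using w by (auto simp: weak_derivative_on_1 weak_derivative_on_2)
  obtain c where c: "AE x in half_line. f x = c + integral {0..x} g1"
    by (rule weak_derivative_primitive[OF L L1]) (use w(1) in \<open>auto simp: weak_derivative_on_1\<close>)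
  obtain d0 where d0: "AE x in half_line. g1 x = d0 + integral {0..x} g2"
  proof (rule weak_derivative_primitive[OF L1 L2])
    fix \<phi> assume \<phi>: "test_function {0<..} \<phi>"
    show "(\<integral>x. deriv \<phi> x *\<^sub>R g1 x \<partial>half_line) = - (\<integral>x. \<phi> x *\<^sub>R g2 x \<partial>half_line)"
    proof -
      have "(\<integral>x. deriv (deriv \<phi>) x *\<^sub>R f x \<partial>half_line) = - (\<integral>x. deriv \<phi> x *\<^sub>R g1 x \<partial>half_line)"
        using w(1) test_function_deriv[OF \<phi>] by (simp add: weak_derivative_on_1)
      moreover have "(\<integral>x. deriv (deriv \<phi>) x *\<^sub>R f x \<partial>half_line) = (\<integral>x. \<phi> x *\<^sub>R g2 x \<partial>half_line)"
        using w(2) \<phi> by (simp add: weak_derivative_on_2)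
      ultimately show ?thesis by simp
    qed
  qed
  define p where "p x = d0 + integral {0..x} g2" for x
  have pc: "continuous_on {0..b} p" for b unfolding p_def by (intro continuous_intros L2_primitive_continuous L2)
  have gp: "integral {0..x} g1 = integral {0..x} p" for x
    by (rule integral_cong_half_line_AE) (use d0 in \<open>auto simp: p_def\<close>)
  have fc: "continuous_on {0..} f"
    using d by (auto simp: continuous_on_eq_continuous_within intro: has_vector_derivative_continuous)
  have f_eq: "f x = c + integral {0..x} p" if "x \<ge> 0" for x
  proof -
    have "f x - (c + integral {0..x} g1) = 0"
    proof (rule continuous_AE_zero[OF _ _ that])
      show "continuous_on {0..} (\<lambda>x. f x - (c + integral {0..x} g1))"
        by (intro continuous_intros fc continuous_on_atLeast_0 L2_primitive_continuous L1)
      show "AE x in half_line. f x - (c + integral {0..x} g1) = 0" using c by eventually_elim simp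
    qed
    then show ?thesis by (simp add: gp)
  qed
  have c0: "c = f 0" using f_eq[of 0] by simp
  have f'p: "f' x = p x" if x: "x \<ge> 0" for x
  proof -
    have "((\<lambda>u. integral {0..u} p) has_vector_derivative p x) (at x within {0..x+1})"
      by (rule integral_has_vector_derivative[OF pc]) (use x in auto)
    then have "((\<lambda>u. c + integral {0..u} p) has_vector_derivative p x) (at x within {0..x+1})"
      by (auto intro!: derivative_eq_intros)
    then have "(f has_vector_derivative p x) (at x within {0..x+1})"
      by (rule has_vector_derivative_transform[rotated 2]) (use x f_eq in auto)
    moreover have "(f has_vector_derivative f' x) (at x within {0..x+1})"
      by (rule has_vector_derivative_within_subset[OF d[OF x]]) auto
    ultimately show ?thesis
      using x by (intro vector_derivative_unique_within[of x "{0..x+1}" f]) (auto simp: trivial_limit_within islimpt_Icc)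
  qed
  have AEf': "AE x in half_line. g1 x = f' x"
  proof -
    have "AE x in half_line. 0 < x" by (rule AE_I2) auto
    with d0 show ?thesis by eventually_elim (simp add: f'p p_def)
  qed
  have Lf': "L2_on {0<..} f'" by (rule L2_on_cong_AE[OF L1 AEf']) auto
  have eq1: "f x = f 0 + integral {0..x} f'" if "x \<ge> 0" for x
  proof -
    have "integral {0..x} p = integral {0..x} f'" by (rule integral_cong) (simp add: f'p)
    then show ?thesis using f_eq[OF that] c0 by simp
  qed
  have eq2: "f' x = f' 0 + integral {0..x} g2" if "x \<ge> 0" for x
    using f'p[OF that] f'p[of 0] by (simp add: p_def)
  show ?thesis
    by (rule that[OF L Lf' L2 eq1 eq2 H2_on_primitive(2)[OF L Lf' L2 eq1 eq2]]) auto
qed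

text \<open>Compare \<open>p x\<close> with \<open>p y\<close> for \<open>y\<close> in the unit interval to the right of \<open>x\<close> and average over \<open>y\<close>.  The
  local form of the bound gives the embedding into bounded functions as well as decay at infinity.\<close>

lemma L2_primitive_pointwise:
  fixes p q :: "real \<Rightarrow> 'a::euclidean_space"
  assumes L: "L2_on {0<..} p" "L2_on {0<..} q"
    and p: "\<And>x. x \<ge> 0 \<Longrightarrow> p x = c + integral {0..x} q" and x: "x \<ge> 0"
  shows "(norm (p x))\<^sup>2 \<le> 2 * integral {x..x+1} (\<lambda>y. (norm (p y))\<^sup>2) + 2 * integral {x..x+1} (\<lambda>y. (norm (q y))\<^sup>2)"
proof -
  let ?Q = "integral {x..x+1} (\<lambda>y. (norm (q y))\<^sup>2)"
  have iq: "(\<lambda>y. (norm (q y))\<^sup>2) integrable_on {x..y}" "q absolutely_integrable_on {x..y}" for y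
    using L2_absolutely_integrable[OF L(2) x, of y] by (auto simp: absolutely_integrable_on_def)
  have ip: "(\<lambda>y. (norm (p y))\<^sup>2) integrable_on {x..x+1}"
    using L2_absolutely_integrable(2)[OF L(1) x, of "x+1"] by (auto simp: absolutely_integrable_on_def)
  have le: "(norm (p x))\<^sup>2 \<le> 2 * (norm (p y))\<^sup>2 + 2 * ?Q" if y: "y \<in> {x..x+1}" for y
  proof -
    have "integral {0..y} q = integral {0..x} q + integral {x..y} q"
      using y x by (intro Henstock_Kurzweil_Integration.integral_combine[symmetric] L2_integrable_on L) auto
    then have pd: "p y - p x = integral {x..y} q" using p[of x] p[of y] x y by simp
    have "(norm (integral {x..y} q))\<^sup>2 \<le> (y - x) * integral {x..y} (\<lambda>y. (norm (q y))\<^sup>2)"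
      using y by (intro norm_integral_squared_le iq) auto
    also have "\<dots> \<le> 1 * integral {x..y} (\<lambda>y. (norm (q y))\<^sup>2)"
      using y iq by (intro mult_right_mono integral_nonneg) auto
    also have "\<dots> \<le> ?Q" unfolding mult_1 using y iq by (intro integral_subset_le) auto
    finally have "(norm (p y - p x))\<^sup>2 \<le> ?Q" using pd by simp
    then show ?thesis using norm_add_squared_le[of "p y" "p x - p y"] by (simp add: norm_minus_commute)
  qed
  have "(norm (p x))\<^sup>2 = integral {x..x+1} (\<lambda>y. (norm (p x))\<^sup>2)" by simp
  also have "\<dots> \<le> integral {x..x+1} (\<lambda>y. 2 * (norm (p y))\<^sup>2 + 2 * ?Q)"
    using ip le by (intro integral_le integrable_add integrable_on_mult_right) auto
  also have "\<dots> = 2 * integral {x..x+1} (\<lambda>y. (norm (p y))\<^sup>2) + 2 * ?Q"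
    using ip by (subst integral_add) (auto intro: integrable_on_mult_right)
  finally show ?thesis .
qed

lemma L2_primitive_bound:
  fixes p q :: "real \<Rightarrow> 'a::euclidean_space"
  assumes L: "L2_on {0<..} p" "L2_on {0<..} q"
    and p: "\<And>x. x \<ge> 0 \<Longrightarrow> p x = c + integral {0..x} q" and x: "x \<ge> 0"
  shows "(norm (p x))\<^sup>2 \<le> 2 * sqnorm p + 2 * sqnorm q"
  using L2_primitive_pointwise[OF assms] L2_absolutely_integrable(3)[OF L(1) x, of "x+1"]
    L2_absolutely_integrable(3)[OF L(2) x, of "x+1"] by linarith

text \<open>The integrals are increments of a bounded monotone primitive.\<close>

lemma L2_unit_integral_tendsto_0:
  fixes p :: "real \<Rightarrow> 'a::euclidean_space"
  assumes L: "L2_on {0<..} p"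
  shows "((\<lambda>x. integral {x..x+1} (\<lambda>y. (norm (p y))\<^sup>2)) \<longlongrightarrow> 0) at_top"
proof -
  define P where "P x = integral {0..x} (\<lambda>y. (norm (p y))\<^sup>2)" for x
  have i: "(\<lambda>y. (norm (p y))\<^sup>2) integrable_on {a..b}" if "a \<ge> 0" for a b
    using L2_absolutely_integrable(2)[OF L that, of b] by (auto simp: absolutely_integrable_on_def)
  have bdd: "bdd_above (P ` {0..})"
    using L2_absolutely_integrable(3)[OF L, of 0] by (auto simp: P_def intro!: bdd_aboveI[where M="sqnorm p"])
  have mono: "P x \<le> P y" if "0 \<le> x" "x \<le> y" for x y
    unfolding P_def using that i by (intro integral_subset_le) auto
  have diff: "integral {x..x+1} (\<lambda>y. (norm (p y))\<^sup>2) = P (x + 1) - P x" if "x \<ge> 0" for x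
    unfolding P_def using Henstock_Kurzweil_Integration.integral_combine[of 0 x "x+1", OF _ _ i] that by simp
  show ?thesis
  proof (rule tendstoI)
    fix e :: real assume e: "e > 0"
    obtain X where X: "X \<ge> 0" "P X > Sup (P ` {0..}) - e"
      using less_cSupD[of "P ` {0..}" "Sup (P ` {0..}) - e"] e by auto
    have "dist (integral {x..x+1} (\<lambda>y. (norm (p y))\<^sup>2)) 0 < e" if "x \<ge> X" for x
    proof -
      have "P (x + 1) \<le> Sup (P ` {0..})" using X that by (intro cSup_upper bdd) auto
      moreover have "P X \<le> P x" "P x \<le> P (x + 1)" using X that by (auto intro: mono)
      ultimately show ?thesis using X that diff[of x] by (simp add: dist_real_def)
    qed
    then show "\<forall>\<^sub>F x in at_top. dist (integral {x..x+1} (\<lambda>y. (norm (p y))\<^sup>2)) 0 < e"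
      unfolding eventually_at_top_linorder by blast
  qed
qed

lemma L2_primitive_tendsto_0:
  fixes p q :: "real \<Rightarrow> 'a::euclidean_space"
  assumes L: "L2_on {0<..} p" "L2_on {0<..} q"
    and p: "\<And>x. x \<ge> 0 \<Longrightarrow> p x = c + integral {0..x} q"
  shows "(p \<longlongrightarrow> 0) at_top"
proof -
  let ?b = "\<lambda>x. 2 * integral {x..x+1} (\<lambda>y. (norm (p y))\<^sup>2) + 2 * integral {x..x+1} (\<lambda>y. (norm (q y))\<^sup>2)"
  have "((\<lambda>x. sqrt (?b x)) \<longlongrightarrow> sqrt (2 * 0 + 2 * 0)) at_top"
    by (intro tendsto_intros L2_unit_integral_tendsto_0 L)
  then have "((\<lambda>x. sqrt (?b x)) \<longlongrightarrow> 0) at_top" by simp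
  moreover have "\<forall>\<^sub>F x in at_top. norm (p x) \<le> sqrt (?b x)"
    unfolding eventually_at_top_linorder using L2_primitive_pointwise[OF L p] by (intro exI[of _ 0]) (auto intro!: real_le_rsqrt)
  ultimately show ?thesis by (rule Lim_null_comparison[rotated])
qed


section \<open>Approximation by compactly supported C2 functions\<close>

lemma truncate_norm_le: "M > 0 \<Longrightarrow> norm (truncate M y) \<le> norm y"
  using mult_right_mono[of "M / max M (norm y)" 1 "norm y"] by (simp add: truncate_def)

text \<open>Subtracting the truncation to a small ball sets all small values to zero.  As \<open>f\<close> vanishes at 0 and at
  infinity, this produces compact support without a cut-off function, and the error is the truncation,
  which is small both uniformly and in \<open>L2\<close>.\<close>

lemma soft_threshold_approx:
  fixes f :: "real \<Rightarrow> 'a::euclidean_space"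
  assumes c: "continuous_on UNIV f" and z: "\<And>x. x \<le> 0 \<Longrightarrow> f x = 0" and lim: "(f \<longlongrightarrow> 0) at_top"
    and L: "L2_on {0<..} f" and e: "e > 0"
  obtains k R where "continuous_on UNIV k" "supported_in R k" "R > 0" "sqnorm (\<lambda>x. f x - k x) < e"
    "\<And>x. norm (f x - k x) \<le> e"
proof -
  define d where "d n = 1 / (real n + 1)" for n
  have d: "d n > 0" for n by (simp add: d_def)
  have d0: "d \<longlonglongrightarrow> 0" using LIMSEQ_inverse_real_of_nat by (simp add: d_def[abs_def] inverse_eq_divide add.commute)
  have fm[measurable]: "f \<in> borel_measurable half_line" using L by (simp add: L2_on_def)
  have tc: "continuous_on UNIV (\<lambda>x. truncate (d n) (f x))" for n
    by (rule continuous_on_compose2[OF truncate_continuous[OF d, of UNIV] c]) auto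
  have [measurable]: "(\<lambda>x. truncate (d n) (f x)) \<in> borel_measurable half_line" for n
    by (intro continuous_measurable_half_line continuous_on_subset[OF tc]) auto
  have "(\<lambda>n. sqnorm (\<lambda>x. truncate (d n) (f x))) \<longlonglongrightarrow> (\<integral>x. 0 \<partial>half_line)"
    unfolding sqnorm_def
  proof (rule integral_dominated_convergence)
    show "integrable half_line (\<lambda>x. (norm (f x))\<^sup>2)" using L by (simp add: L2_on_def)
    show "AE x in half_line. norm ((norm (truncate (d n) (f x)))\<^sup>2) \<le> (norm (f x))\<^sup>2" for n
      using d by (intro AE_I2) (auto intro!: power_mono truncate_norm_le)
    have "(\<lambda>n. (norm (truncate (d n) (f x)))\<^sup>2) \<longlonglongrightarrow> 0" for x
    proof (rule Lim_null_comparison)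
      show "\<forall>\<^sub>F n in sequentially. norm ((norm (truncate (d n) (f x)))\<^sup>2) \<le> (d n)\<^sup>2"
        using d by (intro always_eventually allI) (auto intro!: power_mono norm_truncate(1)[where c=0])
      show "(\<lambda>n. (d n)\<^sup>2) \<longlonglongrightarrow> 0" using tendsto_power[OF d0, of 2] by simp
    qed
    then show "AE x in half_line. (\<lambda>n. (norm (truncate (d n) (f x)))\<^sup>2) \<longlonglongrightarrow> 0" by simp
  qed measurable
  then have "\<forall>\<^sub>F n in sequentially. sqnorm (\<lambda>x. truncate (d n) (f x)) < e"
    using e by (auto dest!: order_tendstoD(2)[where a=e])
  moreover have "\<forall>\<^sub>F n in sequentially. d n < e" using order_tendstoD(2)[OF d0 e] .
  ultimately have "\<forall>\<^sub>F n in sequentially. sqnorm (\<lambda>x. truncate (d n) (f x)) < e \<and> d n < e"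
    by (rule eventually_conj)
  then obtain n where n: "sqnorm (\<lambda>x. truncate (d n) (f x)) < e" "d n < e" by (auto simp: eventually_sequentially)
  have "\<forall>\<^sub>F x in at_top. norm (f x) < d n" using lim d[of n] by (auto dest!: tendstoD simp: dist_norm)
  then obtain R0 where R0: "\<And>x. x \<ge> R0 \<Longrightarrow> norm (f x) < d n" by (auto simp: eventually_at_top_linorder)
  define k where "k x = f x - truncate (d n) (f x)" for x
  have tr: "truncate (d n) y = y" if "norm y \<le> d n" for y :: 'a using that d[of n] by (simp add: truncate_def)
  have "supported_in (max 1 R0) k"
    unfolding supported_in_def k_def using z R0 d[of n] by (auto simp: tr less_imp_le)
  moreover have "continuous_on UNIV k" unfolding k_def by (intro continuous_intros c tc)
  moreover have "norm (f x - k x) \<le> e" for x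
    using norm_truncate(1)[of 0 "d n" "f x"] d[of n] n(2) by (simp add: k_def)
  moreover have "sqnorm (\<lambda>x. f x - k x) < e" using n by (simp add: k_def)
  ultimately show ?thesis using that[of k "max 1 R0"] by auto
qed

definition box_average :: "real \<Rightarrow> (real \<Rightarrow> 'a::euclidean_space) \<Rightarrow> real \<Rightarrow> 'a" where
  "box_average h f x = (1 / h) *\<^sub>R integral {x - h..x} f"

lemma box_average_deriv:
  fixes f :: "real \<Rightarrow> 'a::euclidean_space"
  assumes f: "continuous_on UNIV f" and h: "h > 0"
  shows "(box_average h f has_vector_derivative (1 / h) *\<^sub>R (f x - f (x - h))) (at x)"
proof -
  define p where "p = x - h - 1"
  define P where "P y = integral {p..y} f" for y
  have P: "(P has_vector_derivative f y) (at y)" if "y > p" for y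
  proof -
    have "(P has_vector_derivative f y) (at y within {p..y+1})"
      unfolding P_def[abs_def] by (rule integral_has_vector_derivative[OF continuous_on_subset[OF f]]) (use that in auto)
    moreover have "at y within {p..y+1} = at y" using that by (intro at_within_interior) auto
    ultimately show ?thesis by simp
  qed
  have 1: "(P has_vector_derivative f x) (at x)" using h by (intro P) (auto simp: p_def)
  have 2: "((\<lambda>y. P (y - h)) has_vector_derivative f (x - h)) (at x)"
  proof -
    have "((P \<circ> (\<lambda>y. y - h)) has_vector_derivative 1 *\<^sub>R f (x - h)) (at x)"
    proof (rule vector_diff_chain_at)
      show "((\<lambda>y. y - h) has_vector_derivative 1) (at x)"
        by (auto intro!: derivative_eq_intros)
      show "(P has_vector_derivative f (x - h)) (at (x - h))" by (intro P) (simp add: p_def)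
    qed
    then show ?thesis by (simp add: o_def)
  qed
  have "((\<lambda>y. (1 / h) *\<^sub>R (P y - P (y - h))) has_vector_derivative (1 / h) *\<^sub>R (f x - f (x - h))) (at x)"
    by (intro bounded_linear.has_vector_derivative[OF bounded_linear_scaleR_right] has_vector_derivative_diff 1 2)
  then show ?thesis
  proof (rule has_vector_derivative_transform_within_open[where S="{x - 1<..}"])
    fix y assume "y \<in> {x - 1<..}"
    then have "P y = P (y - h) + integral {y - h..y} f"
      unfolding P_def using h
      by (intro Henstock_Kurzweil_Integration.integral_combine[symmetric] integrable_continuous_real continuous_on_subset[OF f]) (auto simp: p_def)
    then show "(1 / h) *\<^sub>R (P y - P (y - h)) = box_average h f y" by (simp add: box_average_def)
  qed auto
qed

lemma box_average_continuous:
  fixes f :: "real \<Rightarrow> 'a::euclidean_space"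
  shows "continuous_on UNIV f \<Longrightarrow> h > 0 \<Longrightarrow> continuous_on S (box_average h f)"
  by (meson box_average_deriv continuous_at_imp_continuous_on has_vector_derivative_continuous)

lemma box_average_close:
  fixes f :: "real \<Rightarrow> 'a::euclidean_space"
  assumes f: "continuous_on UNIV f" and h: "h > 0" and e: "\<And>y. y \<in> {x - h..x} \<Longrightarrow> norm (f y - v) \<le> e"
  shows "norm (box_average h f x - v) \<le> e"
proof -
  have i: "f integrable_on {x - h..x}" by (intro integrable_continuous_real continuous_on_subset[OF f]) auto
  have "integral {x - h..x} (\<lambda>y. f y - v) = integral {x - h..x} f - h *\<^sub>R v"
    using i h by (subst integral_diff) auto
  then have "box_average h f x - v = (1 / h) *\<^sub>R integral {x - h..x} (\<lambda>y. f y - v)"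
    using h by (simp add: box_average_def scaleR_diff_right)
  moreover have "norm (integral {x - h..x} (\<lambda>y. f y - v)) \<le> integral {x - h..x} (\<lambda>y. e)"
    by (rule integral_norm_bound_integral) (use i e in \<open>auto intro: integrable_diff\<close>)
  ultimately show ?thesis using h by (simp add: field_simps)
qed

lemma box_average_supported:
  fixes f :: "real \<Rightarrow> 'a::euclidean_space"
  assumes "supported_in R f" "h > 0" shows "supported_in (R + h) (box_average h f)"
  unfolding supported_in_def
proof (intro allI impI)
  fix x assume "x \<le> 0 \<or> R + h \<le> x"
  then have "f y = 0" if "y \<in> {x - h..x}" for y using supported_inD[OF assms(1), of y] that assms(2) by auto
  then have "integral {x - h..x} f = integral {x - h..x} (\<lambda>_. 0)" by (intro integral_cong) auto
  then show "box_average h f x = 0" by (simp add: box_average_def)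
qed

text \<open>The first two derivatives are carried along explicitly, since they are themselves used as
  initial data.\<close>

definition C2_supported :: "real \<Rightarrow> (real \<Rightarrow> 'a::euclidean_space) \<Rightarrow> (real \<Rightarrow> 'a) \<Rightarrow> (real \<Rightarrow> 'a) \<Rightarrow> bool" where
  "C2_supported R z z' z'' \<longleftrightarrow> (\<forall>x. (z has_vector_derivative z' x) (at x)) \<and> (\<forall>x. (z' has_vector_derivative z'' x) (at x)) \<and>
    continuous_on UNIV z'' \<and> supported_in R z \<and> supported_in R z' \<and> supported_in R z''"

lemma C2_supported_continuous:
  assumes "C2_supported R z z' z''" shows "continuous_on S z" "continuous_on S z'" "continuous_on S z''"
  using assms unfolding C2_supported_def
  by (meson continuous_at_imp_continuous_on has_vector_derivative_continuous, 
      meson continuous_at_imp_continuous_on has_vector_derivative_continuous,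
      meson continuous_on_subset subset_UNIV)

text \<open>Averaging over \<open>[x - h, x]\<close> raises the order of differentiability by one; two averages make a
  continuous function \<open>C2\<close>.  The averages look to the left so that functions that vanish
  on \<open>x \<le> 0\<close> keep this property.\<close>

lemma C2_approx_continuous:
  fixes k :: "real \<Rightarrow> 'a::euclidean_space"
  assumes k: "continuous_on UNIV k" "supported_in R k" and R: "R > 0" and e: "e > 0"
  obtains z z' z'' where "C2_supported (R + 2) z z' z''" "\<And>x. norm (k x - z x) \<le> e" "sqnorm (\<lambda>x. k x - z x) \<le> e\<^sup>2 * (R + 2)"
proof -
  have "uniformly_continuous_on {-2..R + 2} k"
    by (intro compact_uniformly_continuous continuous_on_subset[OF k(1)]) auto
  then obtain d where d: "d > 0" "\<And>x y. x \<in> {-2..R + 2} \<Longrightarrow> y \<in> {-2..R + 2} \<Longrightarrow> dist y x < d \<Longrightarrow> dist (k y) (k x) < e"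
    unfolding uniformly_continuous_on_def using e by metis
  define h where "h = min 1 (d / 3)"
  have h: "h > 0" "h \<le> 1" "2 * h < d" using d by (auto simp: h_def min_def)
  have close: "norm (k y - k x) \<le> e" if "y \<in> {x - 2 * h..x}" for x y
  proof (cases "x \<in> {-0..R + 2}")
    case True
    then have "dist (k y) (k x) < e" using that h by (intro d(2)) (auto simp: dist_real_def)
    then show ?thesis by (simp add: dist_norm)
  next
    case False
    then have "k x = 0" "k y = 0" using that h supported_inD[OF k(2)] by auto
    then show ?thesis using e by simp
  qed
  define a where "a = box_average h k"
  define z where "z = box_average h a"
  define da where "da x = (1 / h) *\<^sub>R (k x - k (x - h))" for x
  define z' where "z' x = (1 / h) *\<^sub>R (a x - a (x - h))" for x
  define z'' where "z'' x = (1 / h) *\<^sub>R (da x - da (x - h))" for x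
  have ac: "continuous_on S a" for S unfolding a_def by (rule box_average_continuous[OF k(1) h(1)])
  have kc': "continuous_on UNIV (\<lambda>x. k (x - c))" for c
    by (rule continuous_on_compose2[OF k(1)]) (auto intro!: continuous_intros)
  have da_c: "continuous_on UNIV da" unfolding da_def by (intro continuous_intros k(1) kc')
  have da_c': "continuous_on UNIV (\<lambda>x. da (x - h))"
    by (rule continuous_on_compose2[OF da_c]) (auto intro!: continuous_intros)
  have 1: "(z has_vector_derivative z' x) (at x)" for x
    unfolding z_def z'_def by (rule box_average_deriv[OF ac h(1)])
  have da: "(a has_vector_derivative da x) (at x)" for x
    unfolding a_def da_def by (rule box_average_deriv[OF k(1) h(1)])
  have da2: "((\<lambda>x. a (x - h)) has_vector_derivative da (x - h)) (at x)" for x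
  proof -
    have "((a \<circ> (\<lambda>y. y - h)) has_vector_derivative 1 *\<^sub>R da (x - h)) (at x)"
      by (rule vector_diff_chain_at) (auto intro!: derivative_eq_intros da)
    then show ?thesis by (simp add: o_def)
  qed
  have 2: "(z' has_vector_derivative z'' x) (at x)" for x
    unfolding z'_def[abs_def] z''_def
    by (intro bounded_linear.has_vector_derivative[OF bounded_linear_scaleR_right] has_vector_derivative_diff da da2)
  have 3: "continuous_on UNIV z''" unfolding z''_def[abs_def] by (intro continuous_intros da_c da_c')
  have sa: "supported_in (R + h) a" unfolding a_def by (rule box_average_supported[OF k(2) h(1)])
  have sz: "supported_in (R + h + h) z" unfolding z_def by (rule box_average_supported[OF sa h(1)])
  have S: "supported_in (R + 2) z" "supported_in (R + 2) z'" "supported_in (R + 2) z''"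
    using sz sa k(2) h unfolding supported_in_def z'_def z''_def da_def by auto
  have C2: "C2_supported (R + 2) z z' z''" unfolding C2_supported_def using 1 2 3 S by auto
  have cl: "norm (k x - z x) \<le> e" for x
  proof -
    have "norm (z x - k x) \<le> e"
      unfolding z_def
    proof (rule box_average_close[OF ac h(1)])
      fix y assume y: "y \<in> {x - h..x}"
      show "norm (a y - k x) \<le> e"
        unfolding a_def by (rule box_average_close[OF k(1) h(1)]) (use y close h in auto)
    qed
    then show ?thesis by (simp add: norm_minus_commute)
  qed
  have "sqnorm (\<lambda>x. k x - z x) \<le> e\<^sup>2 * max 0 (R + 2)"
  proof (rule continuous_bounded_support(2)[OF _ _ cl])
    show "continuous_on UNIV (\<lambda>x. k x - z x)" by (intro continuous_intros k(1) C2_supported_continuous[OF C2])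
    show "supported_in (R + 2) (\<lambda>x. k x - z x)" using S(1) k(2) by (auto simp: supported_in_def)
  qed
  then show ?thesis using that[OF C2 cl] R by simp
qed

lemma C2_supported_L2: "C2_supported R z z' z'' \<Longrightarrow> L2_on {0<..} z"
  by (metis C2_supported_continuous(1) C2_supported_def continuous_bounded_support(1) continuous_supported_bounded)

lemma continuous_supported_L2:
  fixes k :: "real \<Rightarrow> 'a::euclidean_space"
  shows "continuous_on UNIV k \<Longrightarrow> supported_in R k \<Longrightarrow> L2_on {0<..} k"
  by (metis continuous_bounded_support(1) continuous_supported_bounded)

lemma C2_approx_step:
  fixes k :: "real \<Rightarrow> 'a::euclidean_space"
  assumes k: "continuous_on UNIV k" "supported_in R k" and R: "R > 0" and e: "e > 0"
  obtains z z' z'' where "C2_supported (R + 2) z z' z''" "\<And>x. norm (k x - z x) \<le> e" "sqnorm (\<lambda>x. k x - z x) < e"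
proof -
  define d where "d = min e (min 1 (e / (2 * (R + 2))))"
  have d: "d > 0" "d \<le> e" "d \<le> 1" "d * (R + 2) \<le> e / 2"
  proof -
    have "d \<le> e / (2 * (R + 2))" by (simp add: d_def)
    then show "d * (R + 2) \<le> e / 2" using R by (simp add: field_simps)
  qed (use e R in \<open>auto simp: d_def\<close>)
  obtain z z' z'' where z: "C2_supported (R + 2) z z' z''" "\<And>x. norm (k x - z x) \<le> d" "sqnorm (\<lambda>x. k x - z x) \<le> d\<^sup>2 * (R + 2)"
    using C2_approx_continuous[OF k R d(1)] by metis
  have "d\<^sup>2 * (R + 2) \<le> d * (R + 2)" using d R by (intro mult_right_mono) (auto simp: power2_eq_square mult_le_one intro: mult_left_le)
  then have "sqnorm (\<lambda>x. k x - z x) < e" using z(3) d(4) e by linarith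
  then show ?thesis using that[OF z(1)] z(2) d(2) by (meson order_trans)
qed

lemma L2_approx_C2:
  fixes g :: "real \<Rightarrow> 'a::euclidean_space"
  assumes g: "L2_on {0<..} g" and e: "e > 0"
  obtains z z' z'' R where "C2_supported R z z' z''" "sqnorm (\<lambda>x. g x - z x) < e"
proof -
  obtain k R where k: "continuous_on UNIV k" "supported_in R k" "R > 0" and gk: "sqnorm (\<lambda>x. g x - k x) < e / 4"
    using L2_approx_continuous[OF g, of "e/4"] e by auto
  obtain z z' z'' where z: "C2_supported (R + 2) z z' z''" "sqnorm (\<lambda>x. k x - z x) < e / 4"
    using C2_approx_step[OF k, of "e / 4"] e by (metis divide_pos_pos zero_less_numeral)
  have "sqnorm (\<lambda>x. g x - z x) < e"
    using sqnorm_diff_trans[OF g continuous_supported_L2[OF k(1,2)] C2_supported_L2[OF z(1)]] gk z(2) by linarith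
  then show ?thesis using that z(1) by blast
qed

lemma C0_L2_approx_C2:
  fixes f :: "real \<Rightarrow> 'a::euclidean_space"
  assumes c: "continuous_on UNIV f" and z: "\<And>x. x \<le> 0 \<Longrightarrow> f x = 0" and lim: "(f \<longlongrightarrow> 0) at_top"
    and L: "L2_on {0<..} f" and e: "e > 0"
  obtains z z' z'' R where "C2_supported R z z' z''" "sqnorm (\<lambda>x. f x - z x) < e" "\<And>x. norm (f x - z x) \<le> e"
proof -
  have e4: "e / 4 > 0" using e by simp
  obtain k R where k: "continuous_on UNIV k" "supported_in R k" "R > 0" and gk: "sqnorm (\<lambda>x. f x - k x) < e / 4"
    and nk: "\<And>x. norm (f x - k x) \<le> e / 4"
    using soft_threshold_approx[OF c z lim L e4] by metis
  obtain z z' z'' where z: "C2_supported (R + 2) z z' z''" "sqnorm (\<lambda>x. k x - z x) < e / 4" "\<And>x. norm (k x - z x) \<le> e / 4"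
    using C2_approx_step[OF k e4] by metis
  have "sqnorm (\<lambda>x. f x - z x) < e"
    using sqnorm_diff_trans[OF L continuous_supported_L2[OF k(1,2)] C2_supported_L2[OF z(1)]] gk z(2) by linarith
  moreover have "norm (f x - z x) \<le> e" for x
    using norm_triangle_ineq[of "f x - k x" "k x - z x"] nk[of x] z(3)[of x] e by simp
  ultimately show ?thesis using that z(1) by blast
qed


section \<open>Mild solutions of a transport system\<close>

lemma has_vector_derivative_vec_componentwise:
  fixes f :: "real \<Rightarrow> real ^ 'n"
  assumes "\<And>i. ((\<lambda>x. f x $ i) has_real_derivative f' $ i) (at x within S)"
  shows "(f has_vector_derivative f') (at x within S)"
  unfolding has_vector_derivative_def
proof (subst has_derivative_componentwise_within, rule ballI)
  fix e :: "real ^ 'n" assume "e \<in> Basis"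
  then obtain i where e: "e = axis i 1" by (auto simp: Basis_vec_def)
  show "((\<lambda>x. f x \<bullet> e) has_derivative (\<lambda>h. h *\<^sub>R f' \<bullet> e)) (at x within S)"
    using assms[of i] by (simp add: e inner_axis has_field_derivative_def mult_commute_abs)
qed

lemma has_vector_derivative_component:
  fixes f :: "real \<Rightarrow> real ^ 'n"
  assumes "(f has_vector_derivative f') F"
  shows "((\<lambda>x. f x $ i) has_real_derivative f' $ i) F"
  using bounded_linear.has_vector_derivative[OF bounded_linear_vec_nth assms]
  by (simp add: has_real_derivative_iff_has_vector_derivative)

text \<open>Rescaling to the unit interval turns the variable limit into a parameter of the integrand.\<close>

lemma continuous_on_variable_integral:
  fixes k :: "'a::topological_space \<Rightarrow> real \<Rightarrow> real"
  assumes k: "continuous_on (S \<times> UNIV) (\<lambda>(z, s). k z s)" and \<tau>: "continuous_on S \<tau>" and pos: "\<And>z. z \<in> S \<Longrightarrow> \<tau> z \<ge> 0"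
  shows "continuous_on S (\<lambda>z. integral {0..\<tau> z} (k z))"
proof -
  have eq: "integral {0..\<tau> z} (k z) = integral {0..1} (\<lambda>\<sigma>. \<tau> z * k z (\<tau> z * \<sigma>))" if z: "z \<in> S" for z
  proof -
    have "((\<lambda>\<sigma>. \<tau> z *\<^sub>R k z (\<tau> z * \<sigma>)) has_integral (integral {\<tau> z * 0..\<tau> z * 1} (k z))) {0..1}"
    proof (rule has_integral_substitution)
      show "(*) (\<tau> z) ` {0..1} \<subseteq> {0..\<tau> z}"
        using pos[OF z] by (auto simp: mult_left_le)
      show "continuous_on {0..\<tau> z} (k z)"
        by (rule continuous_on_compose2[OF k, of _ "\<lambda>s. (z, s)", simplified]) (use z in \<open>auto intro!: continuous_intros\<close>)
      show "((*) (\<tau> z) has_real_derivative \<tau> z) (at \<sigma> within {0..1})" for \<sigma>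
        by (auto intro!: derivative_eq_intros)
    qed (use pos[OF z] in auto)
    from integral_unique[OF this] show ?thesis by (simp only: real_scaleR_def mult_zero_right mult_1_right)
  qed
  have "continuous_on S (\<lambda>z. integral (cbox 0 1) (\<lambda>\<sigma>. \<tau> z * k z (\<tau> z * \<sigma>)))"
  proof (rule integral_continuous_on_param)
    have c: "continuous_on (S \<times> cbox 0 1) (\<lambda>x. k (fst x) (\<tau> (fst x) * snd x))"
      by (rule continuous_on_compose2[OF k, of _ "\<lambda>x. (fst x, \<tau> (fst x) * snd x)", simplified])
         (auto intro!: continuous_intros continuous_on_compose2[OF \<tau>])
    show "continuous_on (S \<times> cbox 0 1) (\<lambda>(z, \<sigma>). \<tau> z * k z (\<tau> z * \<sigma>))"
      unfolding split_beta by (intro continuous_intros c continuous_on_compose2[OF \<tau>]) auto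
  qed
  then show ?thesis using eq by (simp cong: continuous_on_cong)
qed

text \<open>The vector \<open>w\<close> is the equilibrium distribution of the exchange described by \<open>K\<close>; its entries serve as weights in
  the maximum principle and in the energy.\<close>

locale transport =
  fixes K :: "real ^ 'n ^ 'n" and lam w :: "real ^ 'n"
  assumes offdiag: "\<And>i j. i \<noteq> j \<Longrightarrow> K $ i $ j \<ge> 0"
    and colsum: "\<And>j. (\<Sum>i\<in>UNIV. K $ i $ j) = 0"
    and irred: "\<And>i\<^sub>0 i\<^sub>1. i\<^sub>0 \<noteq> i\<^sub>1 \<Longrightarrow>
      \<exists>js. js \<noteq> [] \<and> hd js = i\<^sub>0 \<and> last js = i\<^sub>1 \<and>
           (\<forall>m. Suc m < length js \<longrightarrow> K $ (js ! m) $ (js ! Suc m) > 0)"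
    and w_pos: "\<And>i. w $ i > 0"
    and K_w: "K *v w = 0"
    and lam_pos: "\<And>i. lam $ i > 0"
begin

text \<open>Any positive bound of the diagonal of \<open>K\<close> would do: adding \<open>c\<close> to the diagonal makes all entries nonnegative,
  at the price of the factor \<open>exp (c * t)\<close> along the characteristics.\<close>

definition c :: real where "c = 1 + (\<Sum>i\<in>UNIV. \<bar>K $ i $ i\<bar>)"

definition P :: "real ^ 'n \<Rightarrow> real ^ 'n" where "P v = K *v v + c *\<^sub>R v"

lemma c_pos: "c > 0"
  unfolding c_def by (intro add_pos_nonneg sum_nonneg) auto

lemma P_component: "P v $ i = (\<Sum>j\<in>UNIV. (K $ i $ j + (if i = j then c else 0)) * v $ j)"
  by (simp add: P_def matrix_vector_mult_def distrib_right sum.distrib if_distrib[of "\<lambda>x. x * _"] cong: if_cong)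

lemma P_coeff_nonneg: "K $ i $ j + (if i = j then c else 0) \<ge> 0"
proof (cases "i = j")
  case True
  have "\<bar>K $ i $ i\<bar> \<le> (\<Sum>i\<in>UNIV. \<bar>K $ i $ i\<bar>)" by (rule member_le_sum) auto
  then show ?thesis using True by (auto simp: c_def)
qed (use offdiag in auto)

lemma P_linear: "P (a *\<^sub>R u + b *\<^sub>R v) = a *\<^sub>R P u + b *\<^sub>R P v"
  by (simp add: P_def matrix_vector_right_distrib matrix_vector_mult_scaleR algebra_simps)

lemma P_bounded_linear: "bounded_linear P"
  using P_linear[of _ _ 1] P_linear[of 1 _ 1]
  by (intro linear_conv_bounded_linear[THEN iffD1] linearI) (auto simp: P_linear[of 1 _ 1, simplified] P_linear[of _ _ 0, simplified])

lemma P_continuous [continuous_intros]: "continuous_on S f \<Longrightarrow> continuous_on S (\<lambda>x. P (f x))"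
  by (rule bounded_linear.continuous_on[OF P_bounded_linear])

text \<open>\<open>P\<close> is entrywise nonnegative and \<open>P w = c *\<^sub>R w\<close>.\<close>

lemma P_bound:
  assumes "\<And>j. \<bar>v $ j\<bar> \<le> m * w $ j"
  shows "\<bar>P v $ i\<bar> \<le> c * m * w $ i"
proof -
  have "\<bar>P v $ i\<bar> \<le> (\<Sum>j\<in>UNIV. \<bar>(K $ i $ j + (if i = j then c else 0)) * v $ j\<bar>)"
    unfolding P_component by (rule sum_abs)
  also have "\<dots> \<le> (\<Sum>j\<in>UNIV. (K $ i $ j + (if i = j then c else 0)) * (m * w $ j))"
    unfolding abs_mult abs_of_nonneg[OF P_coeff_nonneg]
    by (intro sum_mono mult_left_mono assms P_coeff_nonneg)
  also have "\<dots> = m * P w $ i"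
    unfolding P_component by (simp add: sum_distrib_left algebra_simps)
  also have "\<dots> = c * m * w $ i" using K_w by (simp add: P_def)
  finally show ?thesis .
qed

text \<open>The system integrated along characteristics.  The bound on
  \<open>{..L} \<times> {0..T}\<close> provides the starting point of the iteration in the maximum principle.\<close>

definition mild :: "(real \<Rightarrow> real ^ 'n) \<Rightarrow> (real \<Rightarrow> real \<Rightarrow> real ^ 'n) \<Rightarrow> bool" where
  "mild f u \<longleftrightarrow> continuous_on (UNIV \<times> {0..}) (\<lambda>(x, t). u x t) \<and>
     (\<forall>L T. \<exists>M. \<forall>x\<le>L. \<forall>t\<in>{0..T}. norm (u x t) \<le> M) \<and>
     (\<forall>x t i. t \<ge> 0 \<longrightarrow> exp (c * t) * u x t $ i = f (x - lam $ i * t) $ i +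
        integral {0..t} (\<lambda>s. exp (c * s) * P (u (x - lam $ i * (t - s)) s) $ i))"

lemma mild_continuous: "mild f u \<Longrightarrow> continuous_on (UNIV \<times> {0..}) (\<lambda>(x, t). u x t)"
  by (simp add: mild_def)

lemma mild_continuous_comp:
  assumes "mild f u" "continuous_on S g" "continuous_on S h" "\<And>x. x \<in> S \<Longrightarrow> h x \<ge> 0"
  shows "continuous_on S (\<lambda>x. u (g x) (h x))"
  using continuous_on_compose2[OF mild_continuous[OF assms(1)], of S "\<lambda>x. (g x, h x)"] assms(2-4)
  by (auto intro!: continuous_intros)

lemma mild_integrand_continuous:
  assumes "mild f u"
  shows "continuous_on {0..t} (\<lambda>s. exp (c * s) * P (u (x - l * (t - s)) s) $ i)"
  by (intro continuous_intros mild_continuous_comp[OF assms]) auto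

lemma mild_eq: "mild f u \<Longrightarrow> t \<ge> 0 \<Longrightarrow> exp (c * t) * u x t $ i = f (x - lam $ i * t) $ i +
        integral {0..t} (\<lambda>s. exp (c * s) * P (u (x - lam $ i * (t - s)) s) $ i)"
  by (simp add: mild_def)

lemma mild_initial: "mild f u \<Longrightarrow> u x 0 = f x"
  using mild_eq[of f u 0 x] by (simp add: vec_eq_iff)

lemma mild_lincomb:
  assumes u: "mild f u" and v: "mild g v"
  shows "mild (\<lambda>x. a *\<^sub>R f x + b *\<^sub>R g x) (\<lambda>x t. a *\<^sub>R u x t + b *\<^sub>R v x t)"
  unfolding mild_def
proof (intro conjI allI impI)
  show "continuous_on (UNIV \<times> {0..}) (\<lambda>(x, t). a *\<^sub>R u x t + b *\<^sub>R v x t)"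
    using mild_continuous[OF u] mild_continuous[OF v] unfolding split_beta by (intro continuous_intros)
  fix L T :: real
  obtain M N where M: "\<And>x t. x \<le> L \<Longrightarrow> t \<in> {0..T} \<Longrightarrow> norm (u x t) \<le> M" "\<And>x t. x \<le> L \<Longrightarrow> t \<in> {0..T} \<Longrightarrow> norm (v x t) \<le> N"
    using u v unfolding mild_def by metis
  have "norm (a *\<^sub>R u x t + b *\<^sub>R v x t) \<le> \<bar>a\<bar> * M + \<bar>b\<bar> * N" if "x \<le> L" "t \<in> {0..T}" for x t
    using M[OF that] by (intro norm_triangle_le add_mono) (auto intro: mult_left_mono)
  then show "\<exists>M. \<forall>x\<le>L. \<forall>t\<in>{0..T}. norm (a *\<^sub>R u x t + b *\<^sub>R v x t) \<le> M" by blast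
next
  fix x t :: real and i assume t: "0 \<le> t"
  let ?k = "\<lambda>u s. exp (c * s) * P (u (x - lam $ i * (t - s)) s) $ i"
  have iu: "?k u integrable_on {0..t}" and iv: "?k v integrable_on {0..t}"
    using mild_integrand_continuous u v by (auto intro!: integrable_continuous_real)
  have "integral {0..t} (?k (\<lambda>x t. a *\<^sub>R u x t + b *\<^sub>R v x t)) = integral {0..t} (\<lambda>s. a * ?k u s + b * ?k v s)"
    by (intro integral_cong) (simp add: P_linear algebra_simps)
  also have "\<dots> = a * integral {0..t} (?k u) + b * integral {0..t} (?k v)"
    using iu iv by (subst integral_add) (auto intro: integrable_on_mult_right)
  finally show "exp (c * t) * (a *\<^sub>R u x t + b *\<^sub>R v x t) $ i =
     (a *\<^sub>R f (x - lam $ i * t) + b *\<^sub>R g (x - lam $ i * t)) $ i +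
     integral {0..t} (?k (\<lambda>x t. a *\<^sub>R u x t + b *\<^sub>R v x t))"
    using mild_eq[OF u t, of x i] mild_eq[OF v t, of x i] by (simp add: algebra_simps)
qed

lemma mild_diff:
  assumes "mild f u" "mild g v" shows "mild (\<lambda>x. f x - g x) (\<lambda>x t. u x t - v x t)"
  using mild_lincomb[OF assms, of 1 "-1"] by simp

lemma mild_translate:
  assumes "mild f u" shows "mild (\<lambda>x. f (x + h)) (\<lambda>x t. u (x + h) t)"
  unfolding mild_def
proof (intro conjI allI impI)
  have "continuous_on (UNIV \<times> {0..}) (\<lambda>z. u (fst z + h) (snd z))"
    by (intro mild_continuous_comp[OF assms] continuous_intros) auto
  then show "continuous_on (UNIV \<times> {0..}) (\<lambda>(x, t). u (x + h) t)" by (simp add: split_beta)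
  fix L T
  obtain M where "\<And>x t. x \<le> L + h \<Longrightarrow> t \<in> {0..T} \<Longrightarrow> norm (u x t) \<le> M" using assms unfolding mild_def by metis
  then show "\<exists>M. \<forall>x\<le>L. \<forall>t\<in>{0..T}. norm (u (x + h) t) \<le> M" by (intro exI[of _ M]) auto
next
  fix x t :: real and i assume t: "0 \<le> t"
  show "exp (c * t) * u (x + h) t $ i = f (x - lam $ i * t + h) $ i +
     integral {0..t} (\<lambda>s. exp (c * s) * P (u (x - lam $ i * (t - s) + h) s) $ i)"
    using mild_eq[OF assms t, of "x + h" i] by (simp add: algebra_simps)
qed

text \<open>\<open>W\<close> and \<open>S\<close> are the constants that compare weighted with Euclidean quantities.\<close>

definition W :: real where "W = (\<Sum>i\<in>UNIV. w $ i)"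

definition S :: real where "S = (\<Sum>i\<in>UNIV. 1 / w $ i)"

lemma W_nonneg: "W \<ge> 0" and S_nonneg: "S \<ge> 0"
  unfolding W_def S_def using w_pos by (auto intro!: sum_nonneg simp: less_imp_le)

lemma w_le_W: "w $ i \<le> W" and inverse_w_le_S: "1 / w $ i \<le> S"
  unfolding W_def S_def using w_pos by (auto intro!: member_le_sum simp: less_imp_le)

lemma S_w_ge_1: "1 \<le> S * w $ i"
  using inverse_w_le_S[of i] w_pos[of i] by (simp add: field_simps)

text \<open>Let \<open>G\<close> be closed under following characteristics backwards.  A bound \<open>\<bar>u\<^sub>i\<bar> \<le> M * w\<^sub>i\<close> on \<open>G\<close> up to time \<open>T\<close>, inserted
  into the integrated equation, gives the convex combination \<open>exp (- c t) * m + (1 - exp (- c t)) * M\<close> in place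
  of \<open>M\<close>: a bound with a smaller excess over \<open>m\<close>.  Iterating removes the excess.  The freedom in \<open>G\<close>
  gives bounds to the left of a point as well as propagation of the support to the right.\<close>

lemma maximum_principle:
  assumes u: "mild f u"
    and G: "\<And>x t. (x, t) \<in> G \<Longrightarrow> x \<le> L \<and> t \<ge> 0"
    and bwd: "\<And>x t s i. (x, t) \<in> G \<Longrightarrow> 0 \<le> s \<Longrightarrow> s \<le> t \<Longrightarrow> (x - lam $ i * (t - s), s) \<in> G"
    and f: "\<And>y j. (y, 0) \<in> G \<Longrightarrow> \<bar>f y $ j\<bar> \<le> m * w $ j" and m: "m \<ge> 0"
    and xT: "(x, T) \<in> G"
  shows "\<bar>u x T $ i\<bar> \<le> m * w $ i"
proof -
  define q where "q = 1 - exp (- c * T)"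
  have T: "T \<ge> 0" using G[OF xT] by simp
  have q: "0 \<le> q" "q < 1" using c_pos T by (auto simp: q_def)
  define A where "A M \<longleftrightarrow> (\<forall>x t i. (x, t) \<in> G \<longrightarrow> t \<le> T \<longrightarrow> \<bar>u x t $ i\<bar> \<le> M * w $ i)" for M
  have step: "A (m + q * (M - m))" if M: "A M" "M \<ge> m" for M
    unfolding A_def
  proof (intro allI impI)
    fix x t i assume xt: "(x, t) \<in> G" "t \<le> T"
    have t: "t \<ge> 0" using G[OF xt(1)] by simp
    let ?k = "\<lambda>s. exp (c * s) * P (u (x - lam $ i * (t - s)) s) $ i"
    have E: "((\<lambda>s. exp (c * s) * (c * M * w $ i)) has_integral (exp (c * t) * (M * w $ i) - exp (c * 0) * (M * w $ i))) {0..t}"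
      by (rule fundamental_theorem_of_calculus[OF t])
         (auto intro!: derivative_eq_intros simp: has_real_derivative_iff_has_vector_derivative[symmetric])
    have "norm (integral {0..t} ?k) \<le> integral {0..t} (\<lambda>s. exp (c * s) * (c * M * w $ i))"
    proof (rule integral_norm_bound_integral)
      show "?k integrable_on {0..t}" by (intro integrable_continuous_real mild_integrand_continuous[OF u])
      show "norm (?k s) \<le> exp (c * s) * (c * M * w $ i)" if "s \<in> {0..t}" for s
      proof -
        have "(x - lam $ i * (t - s), s) \<in> G" using bwd[OF xt(1)] that by auto
        then have "\<bar>P (u (x - lam $ i * (t - s)) s) $ i\<bar> \<le> c * M * w $ i"
          using M(1) that xt by (intro P_bound) (auto simp: A_def)
        then show ?thesis by (simp add: abs_mult)
      qed
    qed (use E in auto)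
    then have "\<bar>integral {0..t} ?k\<bar> \<le> (exp (c * t) - 1) * (M * w $ i)"
      using integral_unique[OF E] by (simp add: algebra_simps)
    moreover have "(x - lam $ i * t, 0) \<in> G" using bwd[OF xt(1), of 0] t by auto
    then have "\<bar>f (x - lam $ i * t) $ i\<bar> \<le> m * w $ i" by (rule f)
    ultimately have "\<bar>exp (c * t) * u x t $ i\<bar> \<le> m * w $ i + (exp (c * t) - 1) * (M * w $ i)"
      unfolding mild_eq[OF u t] by linarith
    then have "\<bar>u x t $ i\<bar> \<le> exp (- (c * t)) * (m * w $ i + (exp (c * t) - 1) * (M * w $ i))"
      by (simp add: abs_mult exp_minus field_simps)
    also have "\<dots> = (m + (1 - exp (- (c * t))) * (M - m)) * w $ i"
      by (simp add: algebra_simps exp_minus)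
    also have "\<dots> \<le> (m + q * (M - m)) * w $ i"
      using M w_pos[of i] c_pos xt by (intro mult_right_mono add_left_mono) (auto simp: q_def)
    finally show "\<bar>u x t $ i\<bar> \<le> (m + q * (M - m)) * w $ i" .
  qed
  obtain M0 where M0: "\<And>x t. x \<le> L \<Longrightarrow> t \<in> {0..T} \<Longrightarrow> norm (u x t) \<le> M0" using u unfolding mild_def by metis
  define M where "M = max m (\<bar>M0\<bar> * S)"
  have "A M"
    unfolding A_def
  proof (intro allI impI)
    fix x t i assume xt: "(x, t) \<in> G" "t \<le> T"
    have "\<bar>u x t $ i\<bar> \<le> norm (u x t)" by (rule component_le_norm_cart)
    also have "\<dots> \<le> \<bar>M0\<bar> * 1" using M0[of x t] G[OF xt(1)] xt by auto
    also have "\<dots> \<le> \<bar>M0\<bar> * (S * w $ i)" by (rule mult_left_mono) (use S_w_ge_1 in auto)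
    also have "\<dots> \<le> M * w $ i" using w_pos[of i] by (simp add: M_def mult.assoc[symmetric] mult_right_mono)
    finally show "\<bar>u x t $ i\<bar> \<le> M * w $ i" .
  qed
  then have it: "A (m + q ^ n * (M - m))" for n
  proof (induction n)
    case (Suc n)
    have "m + q ^ n * (M - m) \<ge> m" using q by (simp add: M_def)
    from step[OF Suc.IH[OF Suc.prems] this] show ?case by (simp add: mult.assoc)
  qed simp
  have "(\<lambda>n. (m + q ^ n * (M - m)) * w $ i) \<longlonglongrightarrow> (m + 0 * (M - m)) * w $ i"
    using q by (intro tendsto_intros LIMSEQ_power_zero) auto
  then show ?thesis
    using it xT by (intro LIMSEQ_le_const) (auto simp: A_def)
qed

definition C\<^sub>0 :: real where "C\<^sub>0 = S * W"

lemma C\<^sub>0_nonneg: "C\<^sub>0 \<ge> 0"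
  unfolding C\<^sub>0_def by (intro mult_nonneg_nonneg S_nonneg W_nonneg)

lemma sup_bound:
  assumes u: "mild f u" and f: "\<And>y. y \<le> L \<Longrightarrow> norm (f y) \<le> e" and x: "x \<le> L" "t \<ge> 0"
  shows "norm (u x t) \<le> C\<^sub>0 * e"
proof -
  have e: "e \<ge> 0" using f[of L] norm_ge_zero order_trans by blast
  have "\<bar>u x t $ i\<bar> \<le> (e * S) * w $ i" for i
  proof (rule maximum_principle[OF u, where G="{..L} \<times> {0..}"])
    show "\<bar>f y $ j\<bar> \<le> (e * S) * w $ j" if "(y, 0) \<in> {..L} \<times> {0..}" for y j
    proof -
      have "\<bar>f y $ j\<bar> \<le> norm (f y)" by (rule component_le_norm_cart)
      also have "\<dots> \<le> e * 1" using f that by auto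
      also have "\<dots> \<le> e * (S * w $ j)" by (rule mult_left_mono[OF S_w_ge_1 e])
      finally show ?thesis by (simp add: mult.assoc)
    qed
    fix y s r :: real and i assume "(y, s) \<in> {..L} \<times> {0..}" "0 \<le> r" "r \<le> s"
    then show "(y - lam $ i * (s - r), r) \<in> {..L} \<times> {0..}"
      using mult_nonneg_nonneg[OF less_imp_le[OF lam_pos[of i]], of "s - r"] by (auto simp del: zero_le_mult_iff)
  qed (use x e S_nonneg in auto)
  then have "norm (u x t) \<le> (\<Sum>i\<in>UNIV. (e * S) * w $ i)"
    by (intro order_trans[OF norm_le_l1_cart] sum_mono)
  also have "\<dots> = C\<^sub>0 * e" by (simp add: C\<^sub>0_def W_def sum_distrib_left[symmetric])
  finally show ?thesis .
qed

lemma mild_zero_left: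
  assumes "mild f u" "\<And>y. y \<le> L \<Longrightarrow> f y = 0" "x \<le> L" "t \<ge> 0"
  shows "u x t = 0"
  using sup_bound[OF assms(1) _ assms(3,4), of 0] assms(2) by simp

lemma mild_unique:
  assumes "mild f u" "mild f v" "t \<ge> 0" shows "u x t = v x t"
  using mild_zero_left[OF mild_diff[OF assms(1,2)], of x x t] assms(3) by simp

definition speed :: real where "speed = (\<Sum>i\<in>UNIV. lam $ i)"

lemma lam_le_speed: "lam $ i \<le> speed"
  unfolding speed_def using lam_pos by (intro member_le_sum) (auto simp: less_imp_le)

lemma speed_nonneg: "speed \<ge> 0"
  unfolding speed_def using lam_pos by (intro sum_nonneg) (auto simp: less_imp_le)

lemma mild_zero_right:
  assumes u: "mild f u" and f: "\<And>y. y \<ge> R \<Longrightarrow> f y = 0" and x: "x \<ge> R + speed * t" "t \<ge> 0"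
  shows "u x t = 0"
proof -
  have "\<bar>u x t $ i\<bar> \<le> 0 * w $ i" for i
  proof (rule maximum_principle[OF u, where G="{(y, s). y \<le> x \<and> s \<ge> 0 \<and> y \<ge> R + speed * s}" and L=x])
    fix y s r :: real and i assume *: "(y, s) \<in> {(y, s). y \<le> x \<and> s \<ge> 0 \<and> y \<ge> R + speed * s}" "0 \<le> r" "r \<le> s"
    have "lam $ i * (s - r) \<le> speed * (s - r)" "0 \<le> lam $ i * (s - r)"
      using lam_le_speed[of i] lam_pos[of i] * by (auto intro!: mult_right_mono)
    then show "(y - lam $ i * (s - r), r) \<in> {(y, s). y \<le> x \<and> s \<ge> 0 \<and> y \<ge> R + speed * s}"
      using * by (auto simp: algebra_simps)
  qed (use f x in auto)
  then show ?thesis by (simp add: vec_eq_iff)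
qed

text \<open>With the weight \<open>exp (- (a - c) * t)\<close> and \<open>a\<close> large the integrated equation becomes a contraction on
  the bounded continuous functions of \<open>(x, t)\<close>.  Negative times are folded to 0 by \<open>\<tau>\<close>, so that the
  space of functions is a complete type.\<close>

lemma mild_exists:
  assumes fc: "continuous_on UNIV f" and fb: "\<And>x. norm (f x) \<le> F"
  obtains u where "mild f u"
proof -
  obtain B where B: "B \<ge> 0" "\<And>v. norm (P v) \<le> B * norm v"
    using bounded_linear.nonneg_bounded[OF P_bounded_linear] by (metis mult.commute)
  have Pi: "\<bar>P v $ i\<bar> \<le> B * norm v" for v i
    using component_le_norm_cart[of "P v" i] B(2)[of v] by linarith
  define n where "n = real CARD('n)"
  have n: "n > 0" by (simp add: n_def)
  define a where "a = 2 * n * B + c + 1"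
  have a: "a > 0" "a > 2 * n * B" "a > c" using B n c_pos by (auto simp: a_def intro!: add_nonneg_pos)
  define \<tau> where "\<tau> z = max 0 (snd z)" for z :: "real \<times> real"
  define k where "k v i z s = exp (a * s) * P (apply_bcontfun v (fst z - lam $ i * (\<tau> z - s), s)) $ i"
    for v :: "(real \<times> real) \<Rightarrow>\<^sub>C (real ^ 'n)" and i and z :: "real \<times> real" and s
  define \<Phi> where "\<Phi> v z = (\<chi> i. exp (- a * \<tau> z) * (f (fst z - lam $ i * \<tau> z) $ i + integral {0..\<tau> z} (k v i z)))" for v z
  have \<tau>0: "\<tau> z \<ge> 0" for z by (simp add: \<tau>_def)
  have \<tau>c: "continuous_on S \<tau>" for S unfolding \<tau>_def[abs_def] by (intro continuous_intros)
  have vc: "continuous_on S (\<lambda>z. apply_bcontfun v (g z))" if "continuous_on S g" for v :: "(real \<times> real) \<Rightarrow>\<^sub>C (real ^ 'n)" and g and S :: "'z::topological_space set"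
    by (rule continuous_on_compose2[OF continuous_on_apply_bcontfun[of UNIV v] that]) auto
  have kc: "continuous_on (UNIV \<times> UNIV) (\<lambda>(z, s). k v i z s)" for v i
    unfolding k_def split_beta
    by (intro continuous_intros vc continuous_on_compose2[OF \<tau>c[of UNIV]]) auto
  have kc1: "continuous_on S (k v i z)" for S v i z
    unfolding k_def by (intro continuous_intros vc)
  have \<Phi>c: "continuous_on UNIV (\<Phi> v)" for v
    unfolding \<Phi>_def
    by (intro continuous_intros \<tau>c continuous_on_variable_integral kc \<tau>0
        continuous_on_compose2[OF fc]) auto
  have expint: "((\<lambda>s. exp (a * s) * D) has_integral (exp (a * t) * (D / a) - exp (a * 0) * (D / a))) {0..t}" if "t \<ge> 0" for t D
    by (rule fundamental_theorem_of_calculus[OF that])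
       (use a in \<open>auto intro!: derivative_eq_intros simp: has_real_derivative_iff_has_vector_derivative[symmetric]\<close>)
  have kint: "exp (- a * \<tau> z) * \<bar>integral {0..\<tau> z} (\<lambda>s. k v i z s - d s)\<bar> \<le> D / a"
    if D: "\<And>s. \<bar>k v i z s - d s\<bar> \<le> exp (a * s) * D" and dc: "continuous_on {0..\<tau> z} d" and D0: "D \<ge> 0" for v i z d D
  proof -
    have "norm (integral {0..\<tau> z} (\<lambda>s. k v i z s - d s)) \<le> integral {0..\<tau> z} (\<lambda>s. exp (a * s) * D)"
      using expint[OF \<tau>0[of z], of D] D dc
      by (intro integral_norm_bound_integral) (auto intro!: integrable_continuous_real continuous_intros kc1)
    also have "\<dots> = (exp (a * \<tau> z) - 1) * (D / a)"
      using integral_unique[OF expint[OF \<tau>0[of z], of D]] by (simp add: algebra_simps)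
    also have "\<dots> \<le> exp (a * \<tau> z) * (D / a)" using D0 a by (intro mult_right_mono) auto
    finally show ?thesis by (simp add: exp_minus field_simps)
  qed
  have nb: "norm (apply_bcontfun v z) \<le> norm v" for v :: "(real \<times> real) \<Rightarrow>\<^sub>C (real ^ 'n)" and z by (rule norm_bounded)
  have \<Phi>b: "norm (\<Phi> v z) \<le> n * (F + B * norm v / a)" for v z
  proof -
    have "\<bar>\<Phi> v z $ i\<bar> \<le> F + B * norm v / a" for i
    proof -
      have "exp (- a * \<tau> z) * \<bar>f (fst z - lam $ i * \<tau> z) $ i\<bar> \<le> 1 * F"
        using a \<tau>0[of z] fb[of "fst z - lam $ i * \<tau> z"] component_le_norm_cart[of "f (fst z - lam $ i * \<tau> z)" i]
        by (intro mult_mono) auto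
      moreover have "exp (- a * \<tau> z) * \<bar>integral {0..\<tau> z} (\<lambda>s. k v i z s - 0)\<bar> \<le> B * norm v / a"
      proof (rule kint)
        show "\<bar>k v i z s - 0\<bar> \<le> exp (a * s) * (B * norm v)" for s
          using order_trans[OF Pi mult_left_mono[OF nb B(1)]] by (auto simp: k_def abs_mult)
      qed (use B in auto)
      ultimately show ?thesis
        unfolding \<Phi>_def using abs_triangle_ineq[of "exp (- a * \<tau> z) * f (fst z - lam $ i * \<tau> z) $ i" "exp (- a * \<tau> z) * integral {0..\<tau> z} (k v i z)"]
        by (simp add: distrib_left abs_mult)
    qed
    then have "norm (\<Phi> v z) \<le> (\<Sum>i\<in>(UNIV::'n set). F + B * norm v / a)"
      by (intro order_trans[OF norm_le_l1_cart] sum_mono)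
    then show ?thesis by (simp add: n_def)
  qed
  have \<Phi>in: "\<Phi> v \<in> bcontfun" for v by (rule bcontfun_normI[OF \<Phi>c \<Phi>b])
  define \<Psi> where "\<Psi> v = Bcontfun (\<Phi> v)" for v
  have \<Psi>: "apply_bcontfun (\<Psi> v) = \<Phi> v" for v unfolding \<Psi>_def by (rule Bcontfun_inverse[OF \<Phi>in])
  have "\<exists>!v. \<Psi> v = v"
  proof (rule banach_fix_type)
    show "\<forall>v v'. dist (\<Psi> v) (\<Psi> v') \<le> (1/2) * dist v v'"
    proof (intro allI dist_bound)
      fix v v' z
      have "\<bar>(\<Phi> v z - \<Phi> v' z) $ i\<bar> \<le> B * dist v v' / a" for i
      proof -
        have "exp (- a * \<tau> z) * \<bar>integral {0..\<tau> z} (\<lambda>s. k v i z s - k v' i z s)\<bar> \<le> B * dist v v' / a"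
        proof (rule kint)
          show "\<bar>k v i z s - k v' i z s\<bar> \<le> exp (a * s) * (B * dist v v')" for s
          proof -
            let ?y = "(fst z - lam $ i * (\<tau> z - s), s)"
            have "k v i z s - k v' i z s = exp (a * s) * P (apply_bcontfun v ?y - apply_bcontfun v' ?y) $ i"
              by (simp add: k_def bounded_linear.linear[OF P_bounded_linear, THEN linear_diff] algebra_simps)
            moreover have "\<bar>P (apply_bcontfun v ?y - apply_bcontfun v' ?y) $ i\<bar> \<le> B * dist v v'"
              using dist_bounded[of v ?y v'] B(1)
              by (intro order_trans[OF Pi mult_left_mono]) (auto simp: dist_norm)
            ultimately show ?thesis by (simp add: abs_mult)
          qed
        qed (use B kc1 in auto)
        moreover have "(\<Phi> v z - \<Phi> v' z) $ i = exp (- a * \<tau> z) * integral {0..\<tau> z} (\<lambda>s. k v i z s - k v' i z s)"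
          by (subst integral_diff) (auto simp: \<Phi>_def algebra_simps intro!: integrable_continuous_real kc1)
        ultimately show ?thesis by (simp add: abs_mult)
      qed
      then have "norm (\<Phi> v z - \<Phi> v' z) \<le> (\<Sum>i\<in>(UNIV::'n set). B * dist v v' / a)"
        by (intro order_trans[OF norm_le_l1_cart] sum_mono)
      also have "\<dots> = (n * B / a) * dist v v'" by (simp add: n_def)
      also have "\<dots> \<le> (1/2) * dist v v'" using a n B by (intro mult_right_mono) (auto simp: field_simps)
      finally show "dist (apply_bcontfun (\<Psi> v) z) (apply_bcontfun (\<Psi> v') z) \<le> 1/2 * dist v v'"
        unfolding \<Psi> dist_norm .
    qed
  qed auto
  then obtain v where "\<Psi> v = v" by blast
  then have v: "\<Phi> v z = apply_bcontfun v z" for z using \<Psi> by metis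
  define \<gamma> where "\<gamma> = a - c"
  define u where "u x t = exp (\<gamma> * t) *\<^sub>R apply_bcontfun v (x, t)" for x t
  have "mild f u"
    unfolding mild_def
  proof (intro conjI allI impI)
    show "continuous_on (UNIV \<times> {0..}) (\<lambda>(x, t). u x t)"
      unfolding u_def split_beta by (intro continuous_intros vc)
    fix L T :: real
    have "norm (u x t) \<le> exp (\<gamma> * \<bar>T\<bar>) * norm v" if "x \<le> L" "t \<in> {0..T}" for x t
      unfolding u_def norm_scaleR using nb[of v "(x, t)"] that a by (intro mult_mono) (auto simp: \<gamma>_def)
    then show "\<exists>M. \<forall>x\<le>L. \<forall>t\<in>{0..T}. norm (u x t) \<le> M" by blast
  next
    fix x t :: real and i assume t: "t \<ge> 0"
    have \<tau>t: "\<tau> (x, t) = t" using t by (simp add: \<tau>_def)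
    have "exp (c * t) * u x t $ i = exp (a * t) * \<Phi> v (x, t) $ i"
      unfolding v by (simp add: u_def \<gamma>_def exp_add[symmetric] mult.assoc[symmetric] algebra_simps)
    also have "\<dots> = f (x - lam $ i * t) $ i + integral {0..t} (k v i (x, t))"
      by (simp add: \<Phi>_def \<tau>t exp_minus)
    also have "integral {0..t} (k v i (x, t)) = integral {0..t} (\<lambda>s. exp (c * s) * P (u (x - lam $ i * (t - s)) s) $ i)"
    proof (rule integral_cong)
      fix s
      have "P (u (x - lam $ i * (t - s)) s) = exp (\<gamma> * s) *\<^sub>R P (apply_bcontfun v (x - lam $ i * (t - s), s))"
        unfolding u_def by (rule linear_cmul[OF bounded_linear.linear[OF P_bounded_linear]])
      then show "k v i (x, t) s = exp (c * s) * P (u (x - lam $ i * (t - s)) s) $ i"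
        by (simp add: k_def \<tau>t \<gamma>_def exp_add[symmetric] mult.assoc[symmetric] algebra_simps)
    qed
    finally show "exp (c * t) * u x t $ i = f (x - lam $ i * t) $ i + integral {0..t} (\<lambda>s. exp (c * s) * P (u (x - lam $ i * (t - s)) s) $ i)" .
  qed
  then show ?thesis using that by blast
qed


section \<open>Differentiability of mild solutions\<close>

text \<open>A difference quotient of \<open>u\<close> minus \<open>p\<close> is the mild solution for the corresponding error in the data, by
  linearity and translation invariance.  The error in the data is uniformly small to the left of any point, because
  \<open>f'\<close> vanishes for negative arguments and is uniformly continuous on compact sets.\<close>

lemma mild_space_derivative:
  assumes u: "mild f u" and p: "mild f' p"
    and d: "\<And>x. (f has_vector_derivative f' x) (at x)" and c: "continuous_on UNIV f'"
    and z: "\<And>x. x \<le> 0 \<Longrightarrow> f' x = 0" and t: "t \<ge> 0"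
  shows "((\<lambda>x. u x t) has_vector_derivative p x t) (at x)"
  unfolding has_vector_derivative_def has_derivative_at
proof (intro conjI bounded_linear_scaleR_left tendstoI)
  fix e :: real assume e: "e > 0"
  define \<eta> where "\<eta> = e / (2 * (C\<^sub>0 + 1))"
  have \<eta>: "\<eta> > 0" "C\<^sub>0 * \<eta> < e"
    using e C\<^sub>0_nonneg by (auto simp: \<eta>_def field_simps intro!: divide_pos_pos add_nonneg_pos)
  (* With increments below 1, points y < - 2 are compared only with points where f' vanishes, and all
     other pairs lie in this compact interval. *)
  have "uniformly_continuous_on {-3..\<bar>x\<bar> + 3} f'"
    by (intro compact_uniformly_continuous continuous_on_subset[OF c]) auto
  then obtain \<delta> where \<delta>: "\<delta> > 0" "\<And>y y'. y \<in> {-3..\<bar>x\<bar> + 3} \<Longrightarrow> y' \<in> {-3..\<bar>x\<bar> + 3} \<Longrightarrow> dist y' y < \<delta> \<Longrightarrow> dist (f' y') (f' y) < \<eta>"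
    unfolding uniformly_continuous_on_def using \<eta>(1) by metis
  have "dist (norm (u (x + h) t - u x t - h *\<^sub>R p x t) / norm h) 0 < e" if h: "h \<noteq> 0" "\<bar>h\<bar> < min 1 \<delta>" for h
  proof -
    define g where "g y = (1 / h) *\<^sub>R (f (y + h) - f y) - f' y" for y
    define v where "v y s = (1 / h) *\<^sub>R (u (y + h) s - u y s) - p y s" for y s
    have m: "mild g v"
      using mild_lincomb[OF mild_diff[OF mild_translate[OF u, of h] u] p, of "1 / h" "-1"]
      by (simp add: g_def[abs_def] v_def[abs_def])
    have g: "norm (g y) \<le> \<eta>" if y: "y \<le> \<bar>x\<bar> + 1" for y
    proof -
      have osc: "norm (f' y' - f' y) \<le> \<eta>" if "y' \<in> closed_segment y (y + h)" for y'
      proof -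
        have yy: "dist y' y < min 1 \<delta>" "y' \<le> \<bar>x\<bar> + 3"
          using that h y by (auto simp: closed_segment_eq_real_ivl dist_real_def split: if_splits)
        show ?thesis
        proof (cases "y \<ge> -2")
          case True
          then have "dist (f' y') (f' y) < \<eta>" using yy y by (intro \<delta>(2)) (auto simp: dist_real_def)
          then show ?thesis by (simp add: dist_norm)
        next
          case False
          then have "f' y = 0" "f' y' = 0" using yy by (auto intro!: z simp: dist_real_def)
          then show ?thesis using \<eta> by simp
        qed
      qed
      have "norm (f (y + h) - f y - (y + h - y) *\<^sub>R f' y) \<le> norm (y + h - y) * \<eta>"
        by (rule vector_differentiable_bound_linearization[where S="closed_segment y (y + h)"])
          (use d osc in \<open>auto intro: has_vector_derivative_at_within\<close>)
      then have "norm (h *\<^sub>R g y) \<le> \<bar>h\<bar> * \<eta>"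
        using h by (simp add: g_def scaleR_diff_right)
      then show ?thesis using h by simp
    qed
    have "norm (v x t) \<le> C\<^sub>0 * \<eta>" by (rule sup_bound[OF m g]) (use t in auto)
    moreover have "u (x + h) t - u x t - h *\<^sub>R p x t = h *\<^sub>R v x t"
      using h by (simp add: v_def scaleR_diff_right)
    ultimately show ?thesis using h \<eta> by simp
  qed
  then show "\<forall>\<^sub>F h in at 0. dist (norm (u (x + h) t - u x t - h *\<^sub>R p x t) / norm h) 0 < e"
    using \<delta>(1) unfolding eventually_at by (intro exI[of _ "min 1 \<delta>"]) (auto simp: dist_real_def)
qed

text \<open>The difference between moving along a slanted line and staying at \<open>x\<close>.  Adding or subtracting it converts
  derivatives along characteristics into derivatives in time, and only continuity of the derivative in \<open>x\<close> is
  needed.\<close>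

lemma shear_derivative:
  fixes u p :: "real \<Rightarrow> real \<Rightarrow> real ^ 'n"
  assumes pc: "continuous_on (UNIV \<times> {0..}) (\<lambda>(x, t). p x t)"
    and d: "\<And>x t. t \<ge> 0 \<Longrightarrow> ((\<lambda>x. u x t) has_vector_derivative p x t) (at x)" and t: "t \<ge> 0"
  shows "((\<lambda>s. u (x + l * (s - t)) s $ i - u x s $ i) has_real_derivative l * p x t $ i) (at t within {0..})"
  unfolding has_field_derivative_def has_derivative_within_alt
proof (intro conjI allI impI)
  show "bounded_linear ((*) (l * p x t $ i))" by (rule bounded_linear_mult_right)
  fix e :: real assume e: "e > 0"
  define \<eta> where "\<eta> = e / (3 * (\<bar>l\<bar> + 1))"
  have \<eta>: "\<eta> > 0" "\<bar>l\<bar> * (3 * \<eta>) \<le> e" using e by (auto simp: \<eta>_def field_simps)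
  from pc[unfolded continuous_on_iff, rule_format, of "(x, t)" \<eta>] t \<eta>(1)
  obtain \<delta> where \<delta>: "\<delta> > 0" "\<And>y s. s \<ge> 0 \<Longrightarrow> dist (y, s) (x, t) < \<delta> \<Longrightarrow> dist (p y s) (p x t) < \<eta>"
    by auto
  define \<rho> where "\<rho> = \<delta> / (\<bar>l\<bar> + 2)"
  have \<rho>: "\<rho> > 0" "(\<bar>l\<bar> + 1) * \<rho> < \<delta>" using \<delta>(1) by (auto simp: \<rho>_def field_simps)
  show "\<exists>d>0. \<forall>s\<in>{0..}. norm (s - t) < d \<longrightarrow>
      norm ((u (x + l * (s - t)) s $ i - u x s $ i) - (u (x + l * (t - t)) t $ i - u x t $ i) - l * p x t $ i * (s - t)) \<le> e * norm (s - t)"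
  proof (intro exI[of _ \<rho>] conjI ballI impI \<rho>(1))
    fix s assume s: "s \<in> {0..}" "norm (s - t) < \<rho>"
    have close: "norm (p y s - p x t) \<le> \<eta>" if y: "y \<in> closed_segment x (x + l * (s - t))" for y
    proof -
      have "dist y x \<le> \<bar>l * (s - t)\<bar>" using y by (auto simp: closed_segment_eq_real_ivl dist_real_def split: if_splits)
      also have "\<dots> \<le> \<bar>l\<bar> * \<rho>" using s(2) unfolding abs_mult by (intro mult_left_mono) auto
      finally have "dist y x + dist s t < \<delta>" using s(2) \<rho>(2) by (simp add: dist_real_def algebra_simps)
      moreover have "dist (y, s) (x, t) \<le> dist y x + dist s t"
        unfolding dist_Pair_Pair by (rule sqrt_sum_squares_le_sum) auto
      ultimately have "dist (p y s) (p x t) < \<eta>" using s by (intro \<delta>(2)) auto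
      then show ?thesis by (simp add: dist_norm)
    qed
    let ?b = "x + l * (s - t)"
    have x: "x \<in> closed_segment x ?b" by simp
    have 1: "norm (u ?b s - u x s - (?b - x) *\<^sub>R p x s) \<le> norm (?b - x) * (2 * \<eta>)"
    proof (rule vector_differentiable_bound_linearization[where S="closed_segment x ?b"
          and f="\<lambda>y. u y s" and f'="\<lambda>y. p y s"])
      show "((\<lambda>y. u y s) has_vector_derivative p y s) (at y within closed_segment x ?b)" for y
        by (rule has_vector_derivative_at_within[OF d]) (use s in simp)
      show "norm (p y s - p x s) \<le> 2 * \<eta>" if "y \<in> closed_segment x ?b" for y
        using norm_diff_triangle_le[OF close[OF that], of "p x s" \<eta>] close[OF x] by (simp add: norm_minus_commute)
    qed (use x in auto)
    have 2: "norm ((?b - x) *\<^sub>R p x s - (?b - x) *\<^sub>R p x t) \<le> norm (?b - x) * \<eta>"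
      unfolding scaleR_diff_right[symmetric] norm_scaleR real_norm_def by (intro mult_left_mono close[OF x]) auto
    have "norm (u ?b s - u x s - (?b - x) *\<^sub>R p x t) \<le> norm (?b - x) * (3 * \<eta>)"
      using norm_diff_triangle_le[OF 1 2] by (simp only: distrib_left[symmetric]) (simp add: algebra_simps)
    also have "\<dots> = (\<bar>l\<bar> * (3 * \<eta>)) * norm (s - t)" by (simp add: abs_mult)
    also have "\<dots> \<le> e * norm (s - t)" by (intro mult_right_mono \<eta>) auto
    finally have "norm (u ?b s - u x s - (?b - x) *\<^sub>R p x t) \<le> e * norm (s - t)" .
    moreover have "(u ?b s $ i - u x s $ i) - (u (x + l * (t - t)) t $ i - u x t $ i) - l * p x t $ i * (s - t)
       = (u ?b s - u x s - (?b - x) *\<^sub>R p x t) $ i" by (simp add: algebra_simps)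
    ultimately show "norm ((u ?b s $ i - u x s $ i) - (u (x + l * (t - t)) t $ i - u x t $ i) - l * p x t $ i * (s - t)) \<le> e * norm (s - t)"
      using component_le_norm_cart[of "u ?b s - u x s - (?b - x) *\<^sub>R p x t" i] by (simp only: real_norm_def)
  qed
qed

lemma along_characteristic:
  assumes u: "mild f u" and t: "t \<ge> 0"
  shows "((\<lambda>s. u (x + lam $ i * (s - t)) s $ i) has_real_derivative (K *v u x t) $ i) (at t within {0..})"
proof -
  define z where "z = x - lam $ i * t"
  define k where "k s = exp (c * s) * P (u (z + lam $ i * s) s) $ i" for s
  have kc: "continuous_on {0..t+1} k"
    unfolding k_def by (intro continuous_intros mild_continuous_comp[OF u]) auto
  have rep: "u (x + lam $ i * (s - t)) s $ i = exp (- (c * s)) * (f z $ i + integral {0..s} k)" if "s \<ge> 0" for s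
  proof -
    have "exp (c * s) * u (z + lam $ i * s) s $ i = f z $ i + integral {0..s} k"
      using mild_eq[OF u that, of "z + lam $ i * s" i] unfolding k_def by (simp add: algebra_simps)
    then have "u (z + lam $ i * s) s $ i = exp (- (c * s)) * (f z $ i + integral {0..s} k)"
      by (simp add: exp_minus field_simps)
    then show ?thesis by (simp add: z_def algebra_simps)
  qed
  have "((\<lambda>s. integral {0..s} k) has_real_derivative k t) (at t within {0..t+1})"
    by (rule integral_has_real_derivative[OF kc]) (use t in auto)
  then have I: "((\<lambda>s. integral {0..s} k) has_real_derivative k t) (at t within {0..})"
    using t by (simp add: at_within_Icc_Suc)
  have "((\<lambda>s. exp (- (c * s)) * (f z $ i + integral {0..s} k)) has_real_derivative
      exp (- (c * t)) * k t - c * (exp (- (c * t)) * (f z $ i + integral {0..t} k))) (at t within {0..})"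
    by (auto intro!: derivative_eq_intros I)
  also have "exp (- (c * t)) * k t - c * (exp (- (c * t)) * (f z $ i + integral {0..t} k)) = (K *v u x t) $ i"
  proof -
    have "exp (- (c * t)) * (f z $ i + integral {0..t} k) = u x t $ i" using rep[OF t] by simp
    moreover have "exp (- (c * t)) * exp (c * t) = 1" by (simp add: exp_minus)
    ultimately show ?thesis by (simp add: k_def P_def z_def mult.assoc[symmetric])
  qed
  finally show ?thesis
    by (rule has_field_derivative_transform_within[OF _ zero_less_one]) (use t rep in auto)
qed

lemma mild_time_derivative:
  assumes u: "mild f u" and pc: "continuous_on (UNIV \<times> {0..}) (\<lambda>(x, t). p x t)"
    and d: "\<And>x t. t \<ge> 0 \<Longrightarrow> ((\<lambda>x. u x t) has_vector_derivative p x t) (at x)" and t: "t \<ge> 0"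
  shows "((\<lambda>s. u x s) has_vector_derivative K *v u x t - (\<chi> i. lam $ i * p x t $ i)) (at t within {0..})"
proof (rule has_vector_derivative_vec_componentwise)
  fix i
  have "((\<lambda>s. u (x + lam $ i * (s - t)) s $ i - (u (x + lam $ i * (s - t)) s $ i - u x s $ i)) has_real_derivative
     (K *v u x t) $ i - lam $ i * p x t $ i) (at t within {0..})"
    by (intro DERIV_diff along_characteristic[OF u t] shear_derivative[OF pc d t])
  then show "((\<lambda>s. u x s $ i) has_real_derivative (K *v u x t - (\<chi> i. lam $ i * p x t $ i)) $ i) (at t within {0..})"
    by simp
qed

lemma classical_imp_mild:
  fixes u p :: "real \<Rightarrow> real \<Rightarrow> real ^ 'n"
  assumes uc: "continuous_on (UNIV \<times> {0..}) (\<lambda>(x, t). u x t)"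
    and pc: "continuous_on (UNIV \<times> {0..}) (\<lambda>(x, t). p x t)"
    and d: "\<And>x t. t \<ge> 0 \<Longrightarrow> ((\<lambda>x. u x t) has_vector_derivative p x t) (at x)"
    and dt: "\<And>x t. t \<ge> 0 \<Longrightarrow> ((\<lambda>s. u x s) has_vector_derivative K *v u x t - (\<chi> i. lam $ i * p x t $ i)) (at t within {0..})"
    and z: "\<And>x t. t \<ge> 0 \<Longrightarrow> x \<le> 0 \<Longrightarrow> u x t = 0"
  shows "mild (\<lambda>x. u x 0) u"
  unfolding mild_def
proof (intro conjI allI impI uc)
  fix L T :: real
  have "compact ((\<lambda>(x, t). u x t) ` ({0..L} \<times> {0..T}))"
    by (intro compact_continuous_image continuous_on_subset[OF uc] compact_Times) auto
  then obtain M where M: "\<And>x t. x \<in> {0..L} \<Longrightarrow> t \<in> {0..T} \<Longrightarrow> norm (u x t) \<le> M"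
    by (force dest!: compact_imp_bounded simp: bounded_iff)
  have "norm (u x t) \<le> max M 0" if "x \<le> L" "t \<in> {0..T}" for x t
    using M[of x t] z[of t x] that by (cases "x \<ge> 0") (auto simp: le_max_iff_disj)
  then show "\<exists>M. \<forall>x\<le>L. \<forall>t\<in>{0..T}. norm (u x t) \<le> M" by blast
next
  fix x t :: real and i assume t: "t \<ge> 0"
  define X where "X s = x - lam $ i * (t - s)" for s
  have "((\<lambda>s. u (X s) s $ i) has_real_derivative (K *v u (X r) r) $ i) (at r within {0..t})" if r: "r \<in> {0..t}" for r
  proof -
    have "((\<lambda>s. (u (X r + lam $ i * (s - r)) s $ i - u (X r) s $ i) + u (X r) s $ i) has_real_derivative
        lam $ i * p (X r) r $ i + (K *v u (X r) r - (\<chi> i. lam $ i * p (X r) r $ i)) $ i) (at r within {0..})"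
      by (intro DERIV_add shear_derivative[OF pc d] has_vector_derivative_component[OF dt]) (use r in auto)
    moreover have "X r + lam $ i * (s - r) = X s" for s by (simp add: X_def algebra_simps)
    ultimately have "((\<lambda>s. u (X s) s $ i) has_real_derivative (K *v u (X r) r) $ i) (at r within {0..})" by simp
    then show ?thesis by (rule has_field_derivative_subset) auto
  qed
  then have "((\<lambda>s. exp (c * s) * u (X s) s $ i) has_real_derivative exp (c * r) * P (u (X r) r) $ i) (at r within {0..t})" if r: "r \<in> {0..t}" for r
    using that by (auto intro!: derivative_eq_intros simp: P_def algebra_simps)
  then have "((\<lambda>s. exp (c * s) * P (u (X s) s) $ i) has_integral (exp (c * t) * u (X t) t $ i - exp (c * 0) * u (X 0) 0 $ i)) {0..t}"
    by (intro fundamental_theorem_of_calculus t) (auto simp: has_real_derivative_iff_has_vector_derivative)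
  from integral_unique[OF this]
  show "exp (c * t) * u x t $ i = u (x - lam $ i * t) 0 $ i + integral {0..t} (\<lambda>s. exp (c * s) * P (u (x - lam $ i * (t - s)) s) $ i)"
    by (simp add: X_def)
qed

end


section \<open>Dissipation by the exchange matrix\<close>

lemma real_add_squared_le: "(x + y)\<^sup>2 \<le> 2 * x\<^sup>2 + 2 * (y :: real)\<^sup>2"
  using norm_add_squared_le[of x y] by simp

context transport
begin

text \<open>The quadratic form of the exchange in the variables \<open>v\<^sub>i / w\<^sub>i\<close>.  The
  diagonal entries of \<open>K\<close> are multiplied by zero, so all terms are nonnegative.\<close>

definition dissipation :: "real ^ 'n \<Rightarrow> real" where
  "dissipation v = (\<Sum>i\<in>UNIV. \<Sum>j\<in>UNIV. K $ i $ j * w $ j * (v $ i / w $ i - v $ j / w $ j)\<^sup>2)"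

definition energy :: "real ^ 'n \<Rightarrow> real" where
  "energy v = (\<Sum>i\<in>UNIV. (v $ i)\<^sup>2 / w $ i)"

lemma energy_nonneg: "energy v \<ge> 0"
  unfolding energy_def using w_pos by (intro sum_nonneg divide_nonneg_pos) auto

lemma K_w_component: "(\<Sum>j\<in>UNIV. K $ i $ j * w $ j) = 0"
  using K_w by (simp add: vec_eq_iff matrix_vector_mult_def)

lemma dissipation_term_nonneg: "K $ i $ j * w $ j * (v $ i / w $ i - v $ j / w $ j)\<^sup>2 \<ge> 0"
  using offdiag[of i j] w_pos[of j] by (cases "i = j") (auto intro!: mult_nonneg_nonneg)

lemma dissipation_nonneg: "dissipation v \<ge> 0"
  unfolding dissipation_def by (intro sum_nonneg dissipation_term_nonneg)

text \<open>Expanding the square in \<open>dissipation\<close>, the pure squares drop out: one because the rows of \<open>K\<close> annihilate \<open>w\<close>, the other because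
  the columns of \<open>K\<close> sum to zero.\<close>

lemma dissipation_identity:
  "(\<Sum>i\<in>UNIV. 2 * v $ i * (K *v v) $ i / w $ i) = - dissipation v"
proof -
  define V where "V i = v $ i / w $ i" for i
  have v: "v $ i = w $ i * V i" for i using w_pos[of i] by (simp add: V_def)
  have 1: "(\<Sum>i\<in>UNIV. \<Sum>j\<in>UNIV. K $ i $ j * w $ j * (V i)\<^sup>2) = 0"
  proof -
    have "(\<Sum>j\<in>UNIV. K $ i $ j * w $ j * (V i)\<^sup>2) = 0" for i
      using K_w_component[of i] by (simp add: sum_distrib_right[symmetric])
    then show ?thesis by simp
  qed
  have 2: "(\<Sum>i\<in>UNIV. \<Sum>j\<in>UNIV. K $ i $ j * w $ j * (V j)\<^sup>2) = 0"
  proof -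
    have "(\<Sum>i\<in>UNIV. K $ i $ j * w $ j * (V j)\<^sup>2) = 0" for j
      using colsum[of j] by (simp add: sum_distrib_right[symmetric] mult.assoc)
    then show ?thesis by (subst sum.swap) simp
  qed
  have "dissipation v = (\<Sum>i\<in>UNIV. \<Sum>j\<in>UNIV. K $ i $ j * w $ j * (V i)\<^sup>2 + K $ i $ j * w $ j * (V j)\<^sup>2 - 2 * (V i * (K $ i $ j * v $ j)))"
    unfolding dissipation_def V_def[symmetric] by (intro sum.cong refl) (simp add: v power2_eq_square algebra_simps)
  also have "\<dots> = - (\<Sum>i\<in>UNIV. \<Sum>j\<in>UNIV. 2 * (V i * (K $ i $ j * v $ j)))"
    using 1 2 by (simp add: sum.distrib sum_subtractf)
  also have "(\<Sum>i\<in>UNIV. \<Sum>j\<in>UNIV. 2 * (V i * (K $ i $ j * v $ j))) = (\<Sum>i\<in>UNIV. 2 * v $ i * (K *v v) $ i / w $ i)"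
    by (intro sum.cong refl) (simp add: matrix_vector_mult_def V_def sum_distrib_left sum_divide_distrib mult_ac)
  finally show ?thesis by simp
qed

text \<open>Each link of the path is a term of the dissipation; the links are combined with
  \<open>(x + y)\<^sup>2 \<le> 2 * x\<^sup>2 + 2 * y\<^sup>2\<close>.\<close>

lemma path_coercive:
  assumes "js \<noteq> []" "\<forall>m. Suc m < length js \<longrightarrow> K $ (js ! m) $ (js ! Suc m) > 0"
  shows "\<exists>C\<ge>0. \<forall>v. (v $ hd js / w $ hd js - v $ last js / w $ last js)\<^sup>2 \<le> C * dissipation v"
  using assms
proof (induction js)
  case (Cons a js)
  show ?case
  proof (cases "js = []")
    case True then show ?thesis by (intro exI[of _ 0]) auto
  next
    case False
    have "\<forall>m. Suc m < length js \<longrightarrow> K $ (js ! m) $ (js ! Suc m) > 0"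
    proof (intro allI impI)
      fix m assume "Suc m < length js"
      then show "K $ (js ! m) $ (js ! Suc m) > 0" using Cons.prems(2)[rule_format, of "Suc m"] by simp
    qed
    from Cons.IH[OF False this] obtain C where C: "C \<ge> 0"
      "\<And>v. (v $ hd js / w $ hd js - v $ last js / w $ last js)\<^sup>2 \<le> C * dissipation v" by blast
    have pos: "K $ a $ hd js > 0" using Cons.prems(2)[rule_format, of 0] False by (simp add: hd_conv_nth)
    define b where "b = K $ a $ hd js * w $ hd js"
    have b: "b > 0" using pos w_pos by (simp add: b_def)
    have "(v $ a / w $ a - v $ last js / w $ last js)\<^sup>2 \<le> (2 / b + 2 * C) * dissipation v" for v
    proof -
      have "b * (v $ a / w $ a - v $ hd js / w $ hd js)\<^sup>2 \<le> (\<Sum>j\<in>UNIV. K $ a $ j * w $ j * (v $ a / w $ a - v $ j / w $ j)\<^sup>2)"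
        unfolding b_def by (rule member_le_sum[where f="\<lambda>j. K $ a $ j * w $ j * (v $ a / w $ a - v $ j / w $ j)\<^sup>2"])
          (auto simp: dissipation_term_nonneg)
      also have "\<dots> \<le> dissipation v"
        unfolding dissipation_def
        by (rule member_le_sum[where f="\<lambda>i. \<Sum>j\<in>UNIV. K $ i $ j * w $ j * (v $ i / w $ i - v $ j / w $ j)\<^sup>2"])
          (auto intro: sum_nonneg dissipation_term_nonneg)
      finally have 1: "(v $ a / w $ a - v $ hd js / w $ hd js)\<^sup>2 \<le> dissipation v / b"
        using b by (simp add: field_simps)
      show ?thesis
        using norm_add_squared_le[of "v $ a / w $ a - v $ hd js / w $ hd js" "v $ hd js / w $ hd js - v $ last js / w $ last js"]
          1 C(2)[of v] by (simp add: algebra_simps)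
    qed
    moreover have "2 / b + 2 * C \<ge> 0" using b C by simp
    ultimately show ?thesis using False by auto
  qed
qed simp

lemma dissipation_coercive:
  obtains C where "C \<ge> 0" "\<And>v i j. (v $ i / w $ i - v $ j / w $ j)\<^sup>2 \<le> C * dissipation v"
proof -
  have "\<exists>C\<ge>0. \<forall>v. (v $ i / w $ i - v $ j / w $ j)\<^sup>2 \<le> C * dissipation v" for i j
  proof (cases "i = j")
    case True then show ?thesis by (intro exI[of _ 0]) auto
  next
    case False
    then obtain js where "js \<noteq> []" "hd js = i" "last js = j"
      "\<forall>m. Suc m < length js \<longrightarrow> K $ (js ! m) $ (js ! Suc m) > 0" using irred by metis
    then show ?thesis using path_coercive[of js] by auto
  qed
  then obtain C where C: "\<And>i j. C i j \<ge> 0" "\<And>v i j. (v $ i / w $ i - v $ j / w $ j)\<^sup>2 \<le> C i j * dissipation v"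
    by metis
  define Q where "Q = (\<Sum>i\<in>UNIV. \<Sum>j\<in>UNIV. C i j)"
  have "C i j \<le> Q" for i j
  proof -
    have "C i j \<le> (\<Sum>j\<in>UNIV. C i j)" by (rule member_le_sum) (auto simp: C)
    also have "\<dots> \<le> Q" unfolding Q_def by (rule member_le_sum) (auto intro!: sum_nonneg C)
    finally show ?thesis .
  qed
  then have "(v $ i / w $ i - v $ j / w $ j)\<^sup>2 \<le> Q * dissipation v" for v i j
    using C(2)[of v i j] mult_right_mono[OF _ dissipation_nonneg[of v]] by (meson order_trans)
  moreover have "Q \<ge> 0" unfolding Q_def by (intro sum_nonneg C)
  ultimately show ?thesis using that by blast
qed

definition reaction :: "real ^ 'n \<Rightarrow> 'n \<Rightarrow> real" where "reaction v i = (K *v v) $ i / w $ i"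

text \<open>Since \<open>K w = 0\<close>, the exchange depends on the differences \<open>v\<^sub>j / w\<^sub>j - v\<^sub>i / w\<^sub>i\<close> only.\<close>

lemma reaction_bound:
  obtains C where "C \<ge> 0" "\<And>v i. (reaction v i)\<^sup>2 \<le> C * dissipation v"
proof -
  obtain C where C: "C \<ge> 0" "\<And>v i j. (v $ i / w $ i - v $ j / w $ j)\<^sup>2 \<le> C * dissipation v"
    using dissipation_coercive by blast
  define a where "a i = (\<Sum>j\<in>UNIV. \<bar>K $ i $ j * w $ j\<bar>) / w $ i" for i
  have a: "a i \<ge> 0" for i unfolding a_def using w_pos[of i] by (intro divide_nonneg_pos sum_nonneg) auto
  define Q where "Q = (\<Sum>i\<in>UNIV. (a i)\<^sup>2)"
  have "(reaction v i)\<^sup>2 \<le> Q * C * dissipation v" for v i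
  proof -
    define D where "D = sqrt (C * dissipation v)"
    have D: "D \<ge> 0" "D\<^sup>2 = C * dissipation v" using C(1) dissipation_nonneg[of v] by (auto simp: D_def)
    have diff: "\<bar>v $ j / w $ j - v $ i / w $ i\<bar> \<le> D" for j
      unfolding D_def using C(2)[of v j i] real_le_rsqrt[of "\<bar>v $ j / w $ j - v $ i / w $ i\<bar>"] by simp
    have "(K *v v) $ i = (\<Sum>j\<in>UNIV. K $ i $ j * w $ j * (v $ j / w $ j - v $ i / w $ i))"
    proof -
      have "(\<Sum>j\<in>UNIV. K $ i $ j * w $ j * (v $ j / w $ j - v $ i / w $ i))
          = (\<Sum>j\<in>UNIV. K $ i $ j * v $ j) - (\<Sum>j\<in>UNIV. K $ i $ j * w $ j) * (v $ i / w $ i)"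
        unfolding sum_distrib_right sum_subtractf[symmetric]
      proof (intro sum.cong refl)
        fix j show "K $ i $ j * w $ j * (v $ j / w $ j - v $ i / w $ i) = K $ i $ j * v $ j - K $ i $ j * w $ j * (v $ i / w $ i)"
          using w_pos[of j] by (simp add: algebra_simps)
      qed
      then show ?thesis using K_w_component[of i] by (simp add: matrix_vector_mult_def)
    qed
    also have "\<bar>\<dots>\<bar> \<le> (\<Sum>j\<in>UNIV. \<bar>K $ i $ j * w $ j\<bar> * D)"
      by (intro order_trans[OF sum_abs] sum_mono) (auto simp: abs_mult intro!: mult_left_mono diff)
    finally have "\<bar>reaction v i\<bar> \<le> a i * D"
      using w_pos[of i] by (simp add: reaction_def a_def abs_divide sum_distrib_right divide_right_mono)
    then have "(reaction v i)\<^sup>2 \<le> (a i)\<^sup>2 * (C * dissipation v)"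
      using power_mono[of "\<bar>reaction v i\<bar>" "a i * D" 2] by (simp add: power_mult_distrib D)
    also have "\<dots> \<le> Q * (C * dissipation v)"
      unfolding Q_def using C(1) dissipation_nonneg[of v]
      by (intro mult_right_mono member_le_sum[where f="\<lambda>i. (a i)\<^sup>2"]) auto
    finally show ?thesis by (simp add: mult.assoc)
  qed
  moreover have "Q * C \<ge> 0" unfolding Q_def using C by (intro mult_nonneg_nonneg sum_nonneg) auto
  ultimately show ?thesis using that by blast
qed

text \<open>The density of the compensating functional, with \<open>p\<close> in the role of \<open>u\<^sub>x\<close>.\<close>

definition cross :: "'n \<Rightarrow> 'n \<Rightarrow> real ^ 'n \<Rightarrow> real ^ 'n \<Rightarrow> real" where
  "cross a b u p = (u $ a / w $ a - u $ b / w $ b) * (p $ a / w $ a)"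

text \<open>The time derivative of \<open>cross\<close> along solutions, up to a derivative in \<open>x\<close>: the second derivative
  \<open>p\<^sub>x\<close> has been removed by an integration by parts.\<close>

definition cross_rate :: "'n \<Rightarrow> 'n \<Rightarrow> real ^ 'n \<Rightarrow> real ^ 'n \<Rightarrow> real" where
  "cross_rate a b u p = (reaction u a - lam $ a * (p $ a / w $ a) - reaction u b + lam $ b * (p $ b / w $ b)) * (p $ a / w $ a)
     - (p $ a / w $ a - p $ b / w $ b) * (reaction u a - lam $ a * (p $ a / w $ a))"

text \<open>With \<open>x = p\<^sub>a / w\<^sub>a\<close>, \<open>d = p\<^sub>a / w\<^sub>a - p\<^sub>b / w\<^sub>b\<close> and \<open>\<delta> = \<lambda>\<^sub>a - \<lambda>\<^sub>b\<close> the rate is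
  \<open>- \<delta> x\<^sup>2\<close> plus products in which one factor is \<open>d\<close> or a reaction term, and these are controlled by the
  dissipation.  Young's inequality gives up half of \<open>\<delta> x\<^sup>2\<close>.\<close>

lemma cross_rate_bound:
  assumes ab: "lam $ a > lam $ b"
  obtains C where "C \<ge> 0" "\<And>u p. cross_rate a b u p \<le> - ((lam $ a - lam $ b) / 2) * (p $ a / w $ a)\<^sup>2 + C * dissipation u + C * dissipation p"
proof -
  obtain C where C: "C \<ge> 0" "\<And>v i j. (v $ i / w $ i - v $ j / w $ j)\<^sup>2 \<le> C * dissipation v" using dissipation_coercive by blast
  obtain C' where C': "C' \<ge> 0" "\<And>v i. (reaction v i)\<^sup>2 \<le> C' * dissipation v" using reaction_bound by blast
  define \<delta> where "\<delta> = lam $ a - lam $ b"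
  have \<delta>: "\<delta> > 0" using ab by (simp add: \<delta>_def)
  have main: "cross_rate a b u p \<le> - (\<delta> / 2) * (p $ a / w $ a)\<^sup>2 + (4 / \<delta> + 1) * C' * dissipation u + (\<delta> + 1) * C * dissipation p" for u p
  proof -
    define x where "x = p $ a / w $ a"
    define d where "d = p $ a / w $ a - p $ b / w $ b"
    define r where "r = reaction u a"
    define s where "s = reaction u b"
    have pb: "p $ b / w $ b = x - d" by (simp add: x_def d_def)
    have cr: "cross_rate a b u p = (r - s) * x - \<delta> * x\<^sup>2 + \<delta> * d * x - d * r"
      unfolding cross_rate_def pb by (simp add: x_def[symmetric] r_def[symmetric] s_def[symmetric] \<delta>_def power2_eq_square algebra_simps)
    have 1: "(r - s) * x \<le> \<delta> / 4 * x\<^sup>2 + (r - s)\<^sup>2 / \<delta>"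
    proof -
      have "0 \<le> (\<delta> / 2 * x - (r - s))\<^sup>2 / \<delta>" using \<delta> by simp
      also have "\<dots> = \<delta> / 4 * x\<^sup>2 + (r - s)\<^sup>2 / \<delta> - (r - s) * x"
        using \<delta> by (simp add: power2_eq_square field_simps)
      finally show ?thesis by simp
    qed
    have 2: "\<delta> * d * x \<le> \<delta> / 4 * x\<^sup>2 + \<delta> * d\<^sup>2"
    proof -
      have "0 \<le> \<delta> * (x / 2 - d)\<^sup>2" using \<delta> by simp
      then show ?thesis by (simp add: power2_eq_square algebra_simps)
    qed
    have 3: "- d * r \<le> d\<^sup>2 + r\<^sup>2"
    proof -
      have "0 \<le> (d + r)\<^sup>2 + d\<^sup>2 + r\<^sup>2" by simp
      then have "0 \<le> 2 * (d\<^sup>2 + r\<^sup>2 + d * r)" by (simp add: power2_eq_square algebra_simps)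
      then show ?thesis by simp
    qed
    have 4: "(r - s)\<^sup>2 / \<delta> \<le> (4 * (C' * dissipation u)) / \<delta>"
      using norm_add_squared_le[of r "- s"] C'(2)[of u a] C'(2)[of u b] \<delta>
      by (intro divide_right_mono) (auto simp: r_def s_def)
    have 5: "d\<^sup>2 \<le> C * dissipation p" "r\<^sup>2 \<le> C' * dissipation u" using C C' by (auto simp: d_def r_def)
    have 6: "\<delta> * d\<^sup>2 \<le> \<delta> * (C * dissipation p)" using 5 \<delta> by (intro mult_left_mono) auto
    have "cross_rate a b u p \<le> - (\<delta> / 2) * x\<^sup>2 + (4 * (C' * dissipation u)) / \<delta> + \<delta> * (C * dissipation p) + C * dissipation p + C' * dissipation u"
      unfolding cr using 1 2 3 4 5 6 by linarith
    also have "\<dots> = - (\<delta> / 2) * x\<^sup>2 + (4 / \<delta> + 1) * C' * dissipation u + (\<delta> + 1) * C * dissipation p"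
      by (simp add: algebra_simps)
    finally show ?thesis by (simp add: x_def)
  qed
  define M where "M = (4 / \<delta> + 1) * C' + (\<delta> + 1) * C"
  have n: "(4 / \<delta> + 1) * C' \<ge> 0" "(\<delta> + 1) * C \<ge> 0" using C C' \<delta> by auto
  show ?thesis
  proof (rule that[of M])
    show "M \<ge> 0" using n by (simp add: M_def)
    fix u p
    have "(4 / \<delta> + 1) * C' * dissipation u \<le> M * dissipation u" "(\<delta> + 1) * C * dissipation p \<le> M * dissipation p"
      using n by (auto simp: M_def intro!: mult_right_mono dissipation_nonneg)
    then show "cross_rate a b u p \<le> - ((lam $ a - lam $ b) / 2) * (p $ a / w $ a)\<^sup>2 + M * dissipation u + M * dissipation p"
      using main[of u p] unfolding \<delta>_def[symmetric] by linarith
  qed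
qed

text \<open>One component and all differences determine the vector.\<close>

lemma energy_le_component:
  obtains C where "C \<ge> 0" "\<And>v. energy v \<le> C * ((v $ a / w $ a)\<^sup>2 + dissipation v)"
proof -
  obtain C where C: "C \<ge> 0" "\<And>v i j. (v $ i / w $ i - v $ j / w $ j)\<^sup>2 \<le> C * dissipation v" using dissipation_coercive by blast
  have "energy v \<le> (2 * W * (1 + C)) * ((v $ a / w $ a)\<^sup>2 + dissipation v)" for v
  proof -
    have "(v $ i)\<^sup>2 / w $ i \<le> w $ i * (2 * (1 + C) * ((v $ a / w $ a)\<^sup>2 + dissipation v))" for i
    proof -
      have "(v $ i / w $ i)\<^sup>2 \<le> 2 * (v $ a / w $ a)\<^sup>2 + 2 * (C * dissipation v)"
        using real_add_squared_le[of "v $ a / w $ a" "v $ i / w $ i - v $ a / w $ a"] C(2)[of v i a] by simp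
      also have "\<dots> \<le> 2 * (1 + C) * ((v $ a / w $ a)\<^sup>2 + dissipation v)"
        using C(1) dissipation_nonneg[of v] mult_nonneg_nonneg[OF C(1), of "(v $ a / w $ a)\<^sup>2"] by (simp add: algebra_simps)
      finally have "w $ i * (v $ i / w $ i)\<^sup>2 \<le> w $ i * (2 * (1 + C) * ((v $ a / w $ a)\<^sup>2 + dissipation v))"
        using w_pos[of i] by (intro mult_left_mono) auto
      then show ?thesis using w_pos[of i] by (simp add: power2_eq_square)
    qed
    then have "energy v \<le> (\<Sum>i\<in>UNIV. w $ i * (2 * (1 + C) * ((v $ a / w $ a)\<^sup>2 + dissipation v)))"
      unfolding energy_def by (intro sum_mono)
    also have "\<dots> = (2 * W * (1 + C)) * ((v $ a / w $ a)\<^sup>2 + dissipation v)"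
      by (simp add: W_def sum_distrib_right[symmetric])
    finally show ?thesis .
  qed
  then show ?thesis using that[of "2 * W * (1 + C)"] W_nonneg C by simp
qed

lemma cross_bound:
  obtains C where "C \<ge> 0" "\<And>u p. \<bar>cross a b u p\<bar> \<le> C * (energy u + energy p)"
proof -
  note S = inverse_w_le_S S_nonneg
  have comp: "(v $ i / w $ i)\<^sup>2 \<le> S * energy v" for v i
  proof -
    have "(v $ i)\<^sup>2 / w $ i \<le> energy v" unfolding energy_def
      using w_pos by (intro member_le_sum[where f="\<lambda>i. (v $ i)\<^sup>2 / w $ i"]) (auto simp: less_imp_le)
    moreover have "(v $ i / w $ i)\<^sup>2 = (1 / w $ i) * ((v $ i)\<^sup>2 / w $ i)" by (simp add: power2_eq_square)
    ultimately show ?thesis using S energy_nonneg[of v] w_pos[of i] by (simp only:) (intro mult_mono, auto simp: less_imp_le)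
  qed
  have "\<bar>cross a b u p\<bar> \<le> (4 * S) * (energy u + energy p)" for u p
  proof -
    have xy: "\<bar>(x - y) * z\<bar> \<le> 2 * x\<^sup>2 + 2 * y\<^sup>2 + z\<^sup>2" for x y z :: real
    proof -
      have "\<bar>(x - y) * z\<bar> \<le> (x - y)\<^sup>2 + z\<^sup>2"
      proof -
        have "2 * (\<bar>x - y\<bar> * \<bar>z\<bar>) \<le> (x - y)\<^sup>2 + z\<^sup>2" using sum_squares_bound[of "\<bar>x - y\<bar>" "\<bar>z\<bar>"] by simp
        moreover have "0 \<le> \<bar>x - y\<bar> * \<bar>z\<bar>" by simp
        ultimately show ?thesis unfolding abs_mult by linarith
      qed
      also have "(x - y)\<^sup>2 \<le> 2 * x\<^sup>2 + 2 * y\<^sup>2" using norm_add_squared_le[of x "- y"] by simp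
      finally show ?thesis by simp
    qed
    have "\<bar>cross a b u p\<bar> \<le> 2 * (S * energy u) + 2 * (S * energy u) + S * energy p"
      unfolding cross_def using xy[of "u $ a / w $ a" "u $ b / w $ b" "p $ a / w $ a"] comp[of u a] comp[of u b] comp[of p a] by linarith
    also have "\<dots> \<le> (4 * S) * (energy u + energy p)"
      using S(2) energy_nonneg[of p] by (simp add: algebra_simps)
    finally show ?thesis .
  qed
  then show ?thesis using that[of "4 * S"] S by simp
qed

end


section \<open>Energy estimates and uniform decay\<close>

lemma nonincreasing_within:
  fixes f :: "real \<Rightarrow> real"
  assumes d: "\<And>t. t \<in> {0..T} \<Longrightarrow> (f has_real_derivative f' t) (at t within {0..T})"
    and n: "\<And>t. t \<in> {0..T} \<Longrightarrow> f' t \<le> 0" and T: "T \<ge> 0"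
  shows "f T \<le> f 0"
proof (rule DERIV_nonpos_imp_decreasing_open[OF T])
  show "\<exists>y. (f has_real_derivative y) (at t) \<and> y \<le> 0" if "0 < t" "t < T" for t
  proof -
    have "at t within {0..T} = at t" using that by (intro at_within_interior) auto
    then show ?thesis using d[of t] n[of t] that by auto
  qed
  show "continuous_on {0..T} f"
    unfolding continuous_on_eq_continuous_within by (intro ballI DERIV_continuous[OF d])
qed

lemma sqnorm_supported:
  fixes k :: "real \<Rightarrow> 'a::euclidean_space"
  assumes k: "continuous_on UNIV k" "supported_in X k"
  shows "sqnorm k = integral {0..X} (\<lambda>x. (norm (k x))\<^sup>2)"
proof -
  have c: "continuous_on {0..X} (\<lambda>x. (norm (k x))\<^sup>2)" by (intro continuous_intros continuous_on_subset[OF k(1)]) auto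
  have "sqnorm k = (LINT x:{0..X}|lebesgue. (norm (k x))\<^sup>2)"
    unfolding L2_half_line_extend(3)[OF continuous_supported_L2[OF k]] set_lebesgue_integral_def
  proof (rule Bochner_Integration.integral_cong)
    fix x show "(norm (indicat_real {0<..} x *\<^sub>R k x))\<^sup>2 = indicat_real {0..X} x *\<^sub>R (norm (k x))\<^sup>2"
      using supported_inD[OF k(2), of x] by (auto simp: indicator_def)
  qed simp
  also have "\<dots> = integral {0..X} (\<lambda>x. (norm (k x))\<^sup>2)"
    by (rule set_lebesgue_integral_eq_integral(2)[OF absolutely_integrable_continuous_real[OF c]])
  finally show ?thesis .
qed

context transport
begin

lemma reaction_bounded_linear: "bounded_linear (\<lambda>v. reaction v i)"
  unfolding reaction_def
  by (intro bounded_linear_divide[THEN bounded_linear_compose] bounded_linear_vec_nth[THEN bounded_linear_compose] matrix_vector_mul_bounded_linear)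

lemma continuous_on_reaction [continuous_intros]: "continuous_on A f \<Longrightarrow> continuous_on A (\<lambda>x. reaction (f x) i)"
  by (rule bounded_linear.continuous_on[OF reaction_bounded_linear])

lemma reaction_has_derivative:
  "(f has_vector_derivative f') F \<Longrightarrow> ((\<lambda>x. reaction (f x) i) has_real_derivative reaction f' i) F"
  using bounded_linear.has_vector_derivative[OF reaction_bounded_linear]
  by (simp add: has_real_derivative_iff_has_vector_derivative)

lemma w_nonzero: "w $ i \<noteq> 0" using w_pos[of i] by simp

lemma continuous_on_energy [continuous_intros]: "continuous_on A f \<Longrightarrow> continuous_on A (\<lambda>x. energy (f x))"
  unfolding energy_def using w_nonzero by (intro continuous_intros) auto

lemma continuous_on_dissipation [continuous_intros]: "continuous_on A f \<Longrightarrow> continuous_on A (\<lambda>x. dissipation (f x))"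
  unfolding dissipation_def using w_nonzero by (intro continuous_intros) auto

lemma continuous_on_cross [continuous_intros]:
  "continuous_on A f \<Longrightarrow> continuous_on A g \<Longrightarrow> continuous_on A (\<lambda>x. cross a b (f x) (g x))"
  unfolding cross_def using w_nonzero by (intro continuous_intros) auto

lemma continuous_on_cross_rate [continuous_intros]:
  "continuous_on A f \<Longrightarrow> continuous_on A g \<Longrightarrow> continuous_on A (\<lambda>x. cross_rate a b (f x) (g x))"
  unfolding cross_rate_def using w_nonzero by (intro continuous_intros) auto

text \<open>Solutions supported in \<open>[0, X]\<close> up to time \<open>T\<close>.  All integrals over the line reduce to this fixed compact
  interval, on which differentiation under the integral sign applies and boundary terms vanish.\<close>

definition classical :: "real \<Rightarrow> real \<Rightarrow> (real \<Rightarrow> real \<Rightarrow> real ^ 'n) \<Rightarrow> (real \<Rightarrow> real \<Rightarrow> real ^ 'n) \<Rightarrow> bool" where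
  "classical X T u p \<longleftrightarrow>
     (\<forall>t\<in>{0..T}. \<forall>x. ((\<lambda>x. u x t) has_vector_derivative p x t) (at x)) \<and>
     (\<forall>t\<in>{0..T}. \<forall>x. ((\<lambda>s. u x s) has_vector_derivative K *v u x t - (\<chi> i. lam $ i * p x t $ i)) (at t within {0..T})) \<and>
     continuous_on (UNIV \<times> {0..T}) (\<lambda>(x, t). u x t) \<and> continuous_on (UNIV \<times> {0..T}) (\<lambda>(x, t). p x t) \<and>
     (\<forall>t\<in>{0..T}. \<forall>x. x \<le> 0 \<or> X \<le> x \<longrightarrow> u x t = 0)"

lemma classical_continuous:
  assumes "classical X T u p"
  shows "continuous_on ({0..T} \<times> A) (\<lambda>(t, x). u x t)" "continuous_on ({0..T} \<times> A) (\<lambda>(t, x). p x t)"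
    and "t \<in> {0..T} \<Longrightarrow> continuous_on A (\<lambda>x. u x t)" "t \<in> {0..T} \<Longrightarrow> continuous_on A (\<lambda>x. p x t)"
proof -
  have c: "continuous_on (UNIV \<times> {0..T}) (\<lambda>z. u (fst z) (snd z))" "continuous_on (UNIV \<times> {0..T}) (\<lambda>z. p (fst z) (snd z))"
    using assms by (auto simp: classical_def split_beta)
  show "continuous_on ({0..T} \<times> A) (\<lambda>(t, x). u x t)" "continuous_on ({0..T} \<times> A) (\<lambda>(t, x). p x t)"
  proof -
    have sw: "continuous_on ({0..T} \<times> A) (\<lambda>z. (snd z, fst z))" by (intro continuous_intros)
    have im: "(\<lambda>z. (snd z, fst z)) ` ({0..T} \<times> A) \<subseteq> UNIV \<times> {0..T}" by auto
    show "continuous_on ({0..T} \<times> A) (\<lambda>(t, x). u x t)" "continuous_on ({0..T} \<times> A) (\<lambda>(t, x). p x t)"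
      unfolding split_beta
      using continuous_on_compose2[OF c(1) sw im] continuous_on_compose2[OF c(2) sw im] by simp_all
  qed
  assume t: "t \<in> {0..T}"
  show "continuous_on A (\<lambda>x. u x t)" "continuous_on A (\<lambda>x. p x t)"
  proof -
    have sw: "continuous_on A (\<lambda>x. (x, t))" by (intro continuous_intros)
    have im: "(\<lambda>x. (x, t)) ` A \<subseteq> UNIV \<times> {0..T}" using t by auto
    show "continuous_on A (\<lambda>x. u x t)" "continuous_on A (\<lambda>x. p x t)"
      using continuous_on_compose2[OF c(1) sw im] continuous_on_compose2[OF c(2) sw im] by simp_all
  qed
qed

lemma classical_component_derivs:
  assumes "classical X T u p" "t \<in> {0..T}"
  shows "((\<lambda>x. u x t $ i) has_real_derivative p x t $ i) (at x within A)"
    "((\<lambda>s. u x s $ i) has_real_derivative (K *v u x t) $ i - lam $ i * p x t $ i) (at t within {0..T})"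
  using assms has_vector_derivative_component[of "\<lambda>x. u x t" "p x t" "at x" i, THEN has_field_derivative_at_within]
    has_vector_derivative_component[of "u x" "K *v u x t - (\<chi> i. lam $ i * p x t $ i)" "at t within {0..T}" i]
  by (auto simp: classical_def)

lemma integral_derivative_zero:
  fixes F F' :: "real \<Rightarrow> real"
  assumes "\<And>x. x \<in> {0..X} \<Longrightarrow> (F has_real_derivative F' x) (at x within {0..X})" "F 0 = 0" "F X = 0" "X \<ge> 0"
  shows "(F' has_integral 0) {0..X}"
  using fundamental_theorem_of_calculus[of 0 X F F'] assms by (simp add: has_real_derivative_iff_has_vector_derivative)

lemma energy_derivative:
  assumes cl: "classical X T u p" and t: "t \<in> {0..T}" and X: "X \<ge> 0"
  shows "((\<lambda>t. integral {0..X} (\<lambda>x. energy (u x t))) has_real_derivative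
     - integral {0..X} (\<lambda>x. dissipation (u x t))) (at t within {0..T})"
proof -
  define fl where "fl u p = (\<Sum>i\<in>UNIV. 2 * lam $ i * u $ i * p $ i / w $ i)" for u p :: "real ^ 'n"
  note c = classical_continuous[OF cl, unfolded split_beta]
  have L: "((\<lambda>t. integral (cbox 0 X) (\<lambda>x. energy (u x t))) has_real_derivative
      integral (cbox 0 X) (\<lambda>x. - dissipation (u x t) - fl (u x t) (p x t))) (at t within {0..T})"
  proof (rule leibniz_rule_field_derivative)
    fix s x assume s: "s \<in> {0..T}"
    have "((\<lambda>s. energy (u x s)) has_real_derivative
       (\<Sum>i\<in>UNIV. 2 * u x s $ i * ((K *v u x s) $ i - lam $ i * p x s $ i) / w $ i)) (at s within {0..T})"
      unfolding energy_def
      using w_nonzero by (auto intro!: derivative_eq_intros classical_component_derivs(2)[OF cl s] sum.cong)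
    also have "(\<Sum>i\<in>UNIV. 2 * u x s $ i * ((K *v u x s) $ i - lam $ i * p x s $ i) / w $ i)
        = (\<Sum>i\<in>UNIV. 2 * u x s $ i * (K *v u x s) $ i / w $ i) - fl (u x s) (p x s)"
      unfolding fl_def sum_subtractf[symmetric]
      by (intro sum.cong refl) (simp add: right_diff_distrib diff_divide_distrib mult_ac)
    finally show "((\<lambda>s. energy (u x s)) has_real_derivative - dissipation (u x s) - fl (u x s) (p x s)) (at s within {0..T})"
      by (simp add: dissipation_identity)
  next
    show "(\<lambda>x. energy (u x s)) integrable_on cbox 0 X" if "s \<in> {0..T}" for s
      unfolding cbox_interval by (intro integrable_continuous_real continuous_intros c(3) that)
    show "continuous_on ({0..T} \<times> cbox 0 X) (\<lambda>(t, x). - dissipation (u x t) - fl (u x t) (p x t))"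
      unfolding split_beta fl_def using w_nonzero by (intro continuous_intros c(1,2)) auto
  qed (use t in auto)
  have fl: "((\<lambda>x. fl (u x t) (p x t)) has_integral 0) {0..X}"
  proof (rule integral_derivative_zero[where F="\<lambda>x. \<Sum>i\<in>UNIV. lam $ i * (u x t $ i)\<^sup>2 / w $ i"])
    show "((\<lambda>x. \<Sum>i\<in>UNIV. lam $ i * (u x t $ i)\<^sup>2 / w $ i) has_real_derivative fl (u x t) (p x t)) (at x within {0..X})" for x
      unfolding fl_def using w_nonzero
      by (auto intro!: derivative_eq_intros classical_component_derivs(1)[OF cl t] sum.cong)
  qed (use cl t X in \<open>auto simp: classical_def\<close>)
  have di: "(\<lambda>x. dissipation (u x t)) integrable_on {0..X}"
    by (intro integrable_continuous_real continuous_intros c(3) t)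
  have "integral {0..X} (\<lambda>x. - dissipation (u x t) - fl (u x t) (p x t)) = - integral {0..X} (\<lambda>x. dissipation (u x t))"
    using has_integral_diff[OF has_integral_neg[OF integrable_integral[OF di]] fl] by (simp add: integral_unique)
  then show ?thesis using L by simp
qed

lemma cross_derivative:
  assumes cl: "classical X T u p" and cl': "classical X T p q" and t: "t \<in> {0..T}" and X: "X \<ge> 0"
  shows "((\<lambda>t. integral {0..X} (\<lambda>x. cross a b (u x t) (p x t))) has_real_derivative
     integral {0..X} (\<lambda>x. cross_rate a b (u x t) (p x t))) (at t within {0..T})"
proof -
  define G where "G u p = (u $ a / w $ a - u $ b / w $ b) * (reaction u a - lam $ a * (p $ a / w $ a))" for u p :: "real ^ 'n"
  define G' where "G' u p q = (p $ a / w $ a - p $ b / w $ b) * (reaction u a - lam $ a * (p $ a / w $ a)) +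
     (u $ a / w $ a - u $ b / w $ b) * (reaction p a - lam $ a * (q $ a / w $ a))" for u p q :: "real ^ 'n"
  note c = classical_continuous[OF cl, unfolded split_beta] and c' = classical_continuous[OF cl', unfolded split_beta]
  have L: "((\<lambda>t. integral (cbox 0 X) (\<lambda>x. cross a b (u x t) (p x t))) has_real_derivative
      integral (cbox 0 X) (\<lambda>x. cross_rate a b (u x t) (p x t) + G' (u x t) (p x t) (q x t))) (at t within {0..T})"
  proof (rule leibniz_rule_field_derivative)
    fix s x assume s: "s \<in> {0..T}"
    show "((\<lambda>s. cross a b (u x s) (p x s)) has_real_derivative
       cross_rate a b (u x s) (p x s) + G' (u x s) (p x s) (q x s)) (at s within {0..T})"
      unfolding cross_def
      by (rule derivative_eq_intros classical_component_derivs(2)[OF cl s] classical_component_derivs(2)[OF cl' s] refl w_nonzero)+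
        (simp add: cross_rate_def G'_def reaction_def w_nonzero field_simps)
  next
    show "(\<lambda>x. cross a b (u x s) (p x s)) integrable_on cbox 0 X" if "s \<in> {0..T}" for s
      unfolding cbox_interval by (intro integrable_continuous_real continuous_intros c(3,4) that)
    show "continuous_on ({0..T} \<times> cbox 0 X) (\<lambda>(t, x). cross_rate a b (u x t) (p x t) + G' (u x t) (p x t) (q x t))"
      unfolding split_beta G'_def using w_nonzero by (intro continuous_intros c(1,2) c'(2)) auto
  qed (use t in auto)
  have G: "((\<lambda>x. G' (u x t) (p x t) (q x t)) has_integral 0) {0..X}"
  proof (rule integral_derivative_zero[where F="\<lambda>x. G (u x t) (p x t)"])
    fix x
    have "((\<lambda>x. u x t) has_vector_derivative p x t) (at x within {0..X})"
      using cl t by (auto simp: classical_def intro: has_vector_derivative_at_within)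
    note r = reaction_has_derivative[OF this, of a]
    show "((\<lambda>x. G (u x t) (p x t)) has_real_derivative G' (u x t) (p x t) (q x t)) (at x within {0..X})"
      unfolding G_def
      by (rule derivative_eq_intros r classical_component_derivs(1)[OF cl t] classical_component_derivs(1)[OF cl' t] refl w_nonzero)+
        (simp add: G'_def w_nonzero field_simps)
  qed (use cl t X in \<open>auto simp: classical_def G_def\<close>)
  have di: "(\<lambda>x. cross_rate a b (u x t) (p x t)) integrable_on {0..X}"
    by (intro integrable_continuous_real continuous_intros c(3,4) t)
  have "integral {0..X} (\<lambda>x. cross_rate a b (u x t) (p x t) + G' (u x t) (p x t) (q x t)) = integral {0..X} (\<lambda>x. cross_rate a b (u x t) (p x t))"
    using has_integral_add[OF integrable_integral[OF di] G] by (simp add: integral_unique)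
  then show ?thesis using L by simp
qed

lemma classical_of_mild:
  assumes z: "C2_supported R z z' z''" and u: "mild z u" and p: "mild z' p" and q: "mild z'' q" and T: "T \<ge> 0"
  shows "classical (max 0 R + speed * T) T u p" "classical (max 0 R + speed * T) T p q"
proof -
  have *: "classical (max 0 R + speed * T) T u p"
    if u: "mild f u" and p: "mild f' p" and d: "\<And>x. (f has_vector_derivative f' x) (at x)"
      and c: "continuous_on UNIV f'" and s: "supported_in R f" "supported_in R f'" for f f' u p
  proof -
    have dx: "((\<lambda>x. u x t) has_vector_derivative p x t) (at x)" if "t \<ge> 0" for x t
      by (rule mild_space_derivative[OF u p d c _ that]) (use s in \<open>auto simp: supported_in_def\<close>)
    have dt: "((\<lambda>s. u x s) has_vector_derivative K *v u x t - (\<chi> i. lam $ i * p x t $ i)) (at t within {0..T})" if "t \<in> {0..T}" for x t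
      by (rule has_vector_derivative_within_subset[OF mild_time_derivative[OF u mild_continuous[OF p] dx]]) (use that in auto)
    have zl: "u x t = 0" if "x \<le> 0" "t \<ge> 0" for x t
      by (rule mild_zero_left[OF u _ that]) (use s in \<open>auto simp: supported_in_def\<close>)
    have zr: "u x t = 0" if "x \<ge> max 0 R + speed * T" "t \<in> {0..T}" for x t
    proof (rule mild_zero_right[OF u])
      show "f y = 0" if "y \<ge> max 0 R" for y using s that by (auto simp: supported_in_def)
      have "speed * t \<le> speed * T" using that speed_nonneg by (intro mult_left_mono) auto
      then show "max 0 R + speed * t \<le> x" using that by linarith
    qed (use that in auto)
    have sub: "(UNIV :: real set) \<times> {0..T} \<subseteq> UNIV \<times> {0..}" by auto
    show ?thesis
      unfolding classical_def
      using dx dt zl zr continuous_on_subset[OF mild_continuous[OF u] sub]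
        continuous_on_subset[OF mild_continuous[OF p] sub] by auto
  qed
  have "continuous_on UNIV z'" "continuous_on UNIV z''" using C2_supported_continuous[OF z] by auto
  then show "classical (max 0 R + speed * T) T u p" "classical (max 0 R + speed * T) T p q"
    using z by (auto simp: C2_supported_def intro!: *[OF u p] *[OF p q])
qed

lemma C2_supported_mild:
  assumes z: "C2_supported R z z' z''"
  obtains u p q where "mild z u" "mild z' p" "mild z'' q"
proof -
  note c = C2_supported_continuous[OF z, of UNIV]
  have s: "supported_in R z" "supported_in R z'" "supported_in R z''" using z by (auto simp: C2_supported_def)
  obtain b b' b'' where "\<And>x. norm (z x) \<le> b" "\<And>x. norm (z' x) \<le> b'" "\<And>x. norm (z'' x) \<le> b''"
    using continuous_supported_bounded[OF c(1) s(1)] continuous_supported_bounded[OF c(2) s(2)] continuous_supported_bounded[OF c(3) s(3)] by metis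
  then show ?thesis using mild_exists[OF c(1)] mild_exists[OF c(2)] mild_exists[OF c(3)] that by metis
qed

lemma norm_squared_vec: "(norm (v :: real ^ 'n))\<^sup>2 = (\<Sum>i\<in>UNIV. (v $ i)\<^sup>2)"
  unfolding power2_norm_eq_inner inner_vec_def by (simp add: power2_eq_square)

lemma energy_le_norm: "energy v \<le> S * (norm v)\<^sup>2"
proof -
  have "(v $ i)\<^sup>2 / w $ i \<le> S * (v $ i)\<^sup>2" for i
  proof -
    from mult_right_mono[OF inverse_w_le_S[of i], of "(v $ i)\<^sup>2"] show ?thesis by simp
  qed
  then show ?thesis unfolding energy_def norm_squared_vec sum_distrib_left by (intro sum_mono)
qed

lemma norm_le_energy: "(norm v)\<^sup>2 \<le> W * energy v"
proof -
  have "(v $ i)\<^sup>2 \<le> W * ((v $ i)\<^sup>2 / w $ i)" for i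
  proof -
    from mult_right_mono[OF w_le_W[of i], of "(v $ i)\<^sup>2 / w $ i"] show ?thesis using w_pos[of i] by simp
  qed
  then show ?thesis unfolding energy_def norm_squared_vec sum_distrib_left by (intro sum_mono)
qed

lemma energy_nonincreasing:
  assumes cl: "classical X T u p" and t: "t \<in> {0..T}" and X: "X \<ge> 0"
  shows "integral {0..X} (\<lambda>x. energy (u x t)) \<le> integral {0..X} (\<lambda>x. energy (u x 0))"
proof (rule nonincreasing_within[where f="\<lambda>t. integral {0..X} (\<lambda>x. energy (u x t))"])
  fix s assume s: "s \<in> {0..t}"
  then have s': "s \<in> {0..T}" using t by auto
  show "((\<lambda>t. integral {0..X} (\<lambda>x. energy (u x t))) has_real_derivative - integral {0..X} (\<lambda>x. dissipation (u x s))) (at s within {0..t})"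
    by (rule has_field_derivative_subset[OF energy_derivative[OF cl s' X]]) (use t in auto)
  show "- integral {0..X} (\<lambda>x. dissipation (u x s)) \<le> 0"
    using integral_nonneg[OF integrable_continuous_real[OF continuous_on_dissipation[OF classical_continuous(3)[OF cl s']]], of 0 X] dissipation_nonneg by auto
qed (use t in auto)

lemma initial_energy_bound:
  assumes c: "continuous_on UNIV z" "supported_in R z"
  shows "integral {0..X} (\<lambda>x. energy (z x)) \<le> S * sqnorm z"
proof -
  have "integral {0..X} (\<lambda>x. energy (z x)) \<le> integral {0..X} (\<lambda>x. S * (norm (z x))\<^sup>2)"
    by (intro integral_le energy_le_norm integrable_continuous_real continuous_intros continuous_on_subset[OF c(1)]) auto
  also have "\<dots> = S * integral {0..X} (\<lambda>x. (norm (z x))\<^sup>2)" by simp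
  also have "\<dots> \<le> S * sqnorm z"
    by (intro mult_left_mono S_nonneg L2_absolutely_integrable(3) continuous_supported_L2[OF c]) auto
  finally show ?thesis .
qed

text \<open>The energy is nonincreasing and equivalent to the Euclidean square; the constant is independent of time.\<close>

lemma sqnorm_mild_bound:
  assumes z: "C2_supported R z z' z''" and u: "mild z u" and t: "t \<ge> 0"
  shows "sqnorm (\<lambda>x. u x t) \<le> W * S * sqnorm z" "L2_on {0<..} (\<lambda>x. u x t)"
proof -
  obtain v p q where m: "mild z v" "mild z' p" "mild z'' q" using C2_supported_mild[OF z] .
  define X where "X = max 0 R + speed * t"
  have cl: "classical X t u p" unfolding X_def by (rule classical_of_mild[OF z u m(2,3) t])
  have X: "X \<ge> 0" unfolding X_def using t speed_nonneg by (intro add_nonneg_nonneg mult_nonneg_nonneg) auto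
  have tT: "t \<in> {0..t}" using t by auto
  have uc: "continuous_on UNIV (\<lambda>x. u x t)" by (rule classical_continuous(3)[OF cl tT])
  have us: "supported_in X (\<lambda>x. u x t)" using cl t by (auto simp: classical_def supported_in_def)
  show "L2_on {0<..} (\<lambda>x. u x t)" by (rule continuous_supported_L2[OF uc us])
  have "sqnorm (\<lambda>x. u x t) = integral {0..X} (\<lambda>x. (norm (u x t))\<^sup>2)" by (rule sqnorm_supported[OF uc us])
  also have "\<dots> \<le> integral {0..X} (\<lambda>x. W * energy (u x t))"
    by (intro integral_le norm_le_energy integrable_continuous_real continuous_intros continuous_on_subset[OF uc]) auto
  also have "\<dots> = W * integral {0..X} (\<lambda>x. energy (u x t))" by simp
  also have "\<dots> \<le> W * integral {0..X} (\<lambda>x. energy (u x 0))"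
    by (intro mult_left_mono W_nonneg energy_nonincreasing[OF cl tT X])
  also have "\<dots> \<le> W * (S * sqnorm z)"
    unfolding mild_initial[OF u] using z C2_supported_continuous[OF z]
    by (intro mult_left_mono W_nonneg initial_energy_bound[where R=R]) (auto simp: C2_supported_def)
  finally show "sqnorm (\<lambda>x. u x t) \<le> W * S * sqnorm z" by (simp add: mult.assoc)
qed


text \<open>Let \<open>E\<close>, \<open>E'\<close> be the energies of \<open>u\<close> and \<open>u\<^sub>x\<close> and \<open>Y\<close> the integral of \<open>cross\<close>.  For small \<open>\<kappa>\<close> and large \<open>A\<close> the functional
  \<open>A * (E + E') + Y + \<kappa> * t * E'\<close> is nonincreasing: the growth \<open>\<kappa> * E'\<close> caused by the explicit factor \<open>t\<close> is absorbed by the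
  dissipation of \<open>A * (E + E') + Y\<close>, and \<open>E'\<close> itself does not increase.  The first two summands are together nonnegative,
  so \<open>E'\<close> is \<open>O(1 / t)\<close>.\<close>

lemma decay_C2:
  assumes z: "C2_supported R z z' z''" and u: "mild z u" and ab: "lam $ a > lam $ b"
  obtains C where "\<And>T x. T > 0 \<Longrightarrow> (norm (u x T))\<^sup>2 \<le> C / sqrt T"
proof -
  obtain v p q where m: "mild z v" "mild z' p" "mild z'' q" using C2_supported_mild[OF z] .
  obtain C1 where C1: "C1 \<ge> 0" "\<And>u p. cross_rate a b u p \<le> - ((lam $ a - lam $ b) / 2) * (p $ a / w $ a)\<^sup>2 + C1 * dissipation u + C1 * dissipation p"
    using cross_rate_bound[OF ab] by blast
  obtain C2 where C2: "C2 \<ge> 0" "\<And>v. energy v \<le> C2 * ((v $ a / w $ a)\<^sup>2 + dissipation v)"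
    using energy_le_component by blast
  obtain C3 where C3: "C3 \<ge> 0" "\<And>u p. \<bar>cross a b u p\<bar> \<le> C3 * (energy u + energy p)"
    using cross_bound by blast
  define \<delta> where "\<delta> = lam $ a - lam $ b"
  (* \<kappa> is small enough for the energy of u_x, bounded by C2 times its common part and its dissipation,
     to be absorbed; A pays for the errors of cross_rate, one unit of dissipation, and positivity. *)
  define \<kappa> where "\<kappa> = min 1 (\<delta> / 2) / (C2 + 1)"
  define A where "A = C1 + C3 + 1"
  have \<delta>: "\<delta> > 0" using ab by (simp add: \<delta>_def)
  have \<kappa>: "\<kappa> > 0" "\<kappa> * C2 \<le> 1" "\<kappa> * C2 \<le> \<delta> / 2"
  proof -
    show "\<kappa> > 0" using \<delta> C2 by (auto simp: \<kappa>_def)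
    have "\<kappa> * C2 \<le> \<kappa> * (C2 + 1)" using \<open>\<kappa> > 0\<close> by simp
    also have "\<dots> = min 1 (\<delta> / 2)" using C2 by (simp add: \<kappa>_def)
    finally show "\<kappa> * C2 \<le> 1" "\<kappa> * C2 \<le> \<delta> / 2" by auto
  qed
  have A: "A \<ge> C3" "A \<ge> 0" using C1 C3 by (auto simp: A_def)
  have pointwise: "- A * dissipation u - A * dissipation p + cross_rate a b u p + \<kappa> * energy p \<le> 0" for u p
  proof -
    let ?x2 = "(p $ a / w $ a)\<^sup>2"
    have "\<kappa> * energy p \<le> \<kappa> * (C2 * (?x2 + dissipation p))" using C2(2) \<kappa>(1) by (intro mult_left_mono) auto
    also have "\<dots> = (\<kappa> * C2) * ?x2 + (\<kappa> * C2) * dissipation p" by (simp add: algebra_simps)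
    also have "\<dots> \<le> \<delta> / 2 * ?x2 + 1 * dissipation p"
      using \<kappa> dissipation_nonneg by (intro add_mono mult_right_mono) auto
    finally have "\<kappa> * energy p \<le> \<delta> / 2 * ?x2 + dissipation p" by simp
    moreover have "A * dissipation u \<ge> C1 * dissipation u" "A * dissipation p \<ge> C1 * dissipation p + dissipation p"
      using C3(1) dissipation_nonneg[of u] dissipation_nonneg[of p] mult_nonneg_nonneg[OF C3(1) dissipation_nonneg[of u]]
        mult_nonneg_nonneg[OF C3(1) dissipation_nonneg[of p]] by (auto simp: A_def algebra_simps)
    ultimately show ?thesis using C1(2)[of u p] unfolding \<delta>_def[symmetric] by linarith
  qed
  define I0 where "I0 = S * sqnorm z + S * sqnorm z'"
  (* The bound of the functional at time 0, divided by \<kappa>: the constant in E' T \<le> B / T. *)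
  define B where "B = (A + C3) * I0 / \<kappa>"
  have I0: "I0 \<ge> 0" unfolding I0_def by (intro add_nonneg_nonneg mult_nonneg_nonneg S_nonneg sqnorm_nonneg)
  have B: "B \<ge> 0" unfolding B_def using A C3 I0 \<kappa> by auto
  have "(norm (u x T))\<^sup>2 \<le> (real CARD('n) * (W * (I0 + B))) / sqrt T" if T: "T > 0" for x T
  proof -
    define X where "X = max 0 R + speed * T"
    have T0: "T \<ge> 0" using T by simp
    have X: "X \<ge> 0" unfolding X_def using T speed_nonneg by (intro add_nonneg_nonneg mult_nonneg_nonneg) auto
    have cl: "classical X T u p" "classical X T p q" unfolding X_def
      by (rule classical_of_mild[OF z u m(2,3) T0])+
    define E where "E t = integral {0..X} (\<lambda>x. energy (u x t))" for t
    define E' where "E' t = integral {0..X} (\<lambda>x. energy (p x t))" for t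
    define D where "D t = integral {0..X} (\<lambda>x. dissipation (u x t))" for t
    define D' where "D' t = integral {0..X} (\<lambda>x. dissipation (p x t))" for t
    define Y where "Y t = integral {0..X} (\<lambda>x. cross a b (u x t) (p x t))" for t
    define Y' where "Y' t = integral {0..X} (\<lambda>x. cross_rate a b (u x t) (p x t))" for t
    define M where "M t = A * (E t + E' t) + Y t + \<kappa> * t * E' t" for t
    note c = classical_continuous(3)[OF cl(1)] classical_continuous(3)[OF cl(2)]
    have Ybound: "\<bar>Y t\<bar> \<le> C3 * (E t + E' t)" if t: "t \<in> {0..T}" for t
    proof -
      have i: "(\<lambda>x. energy (u x t)) integrable_on {0..X}" "(\<lambda>x. energy (p x t)) integrable_on {0..X}"
        "(\<lambda>x. cross a b (u x t) (p x t)) integrable_on {0..X}"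
        by (intro integrable_continuous_real continuous_intros c t)+
      have "norm (Y t) \<le> integral {0..X} (\<lambda>x. C3 * (energy (u x t) + energy (p x t)))"
        unfolding Y_def using i C3(2) by (intro integral_norm_bound_integral integrable_on_mult_right integrable_add) auto
      also have "\<dots> = C3 * (E t + E' t)" using i by (simp add: E_def E'_def integral_add)
      finally show ?thesis by simp
    qed
    have E'0: "E' t \<ge> 0" if "t \<in> {0..T}" for t
      unfolding E'_def by (intro integral_nonneg integrable_continuous_real continuous_intros c that energy_nonneg)
    have E0: "E t \<ge> 0" if "t \<in> {0..T}" for t
      unfolding E_def by (intro integral_nonneg integrable_continuous_real continuous_intros c that energy_nonneg)
    have D'0: "D' t \<ge> 0" if "t \<in> {0..T}" for t
      unfolding D'_def by (intro integral_nonneg integrable_continuous_real continuous_intros c that dissipation_nonneg)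
    have "M T \<le> M 0"
    proof (rule nonincreasing_within)
      fix t assume t: "t \<in> {0..T}"
      have dE: "(E has_real_derivative - D t) (at t within {0..T})" "(E' has_real_derivative - D' t) (at t within {0..T})"
        "(Y has_real_derivative Y' t) (at t within {0..T})"
        unfolding E_def D_def E'_def D'_def Y_def Y'_def
        by (rule energy_derivative[OF cl(1) t X] energy_derivative[OF cl(2) t X] cross_derivative[OF cl t X])+
      show "(M has_real_derivative A * (- D t - D' t) + Y' t + (\<kappa> * E' t - \<kappa> * t * D' t)) (at t within {0..T})"
        unfolding M_def[abs_def] by (auto intro!: derivative_eq_intros dE simp: algebra_simps)
      have i: "(\<lambda>x. dissipation (u x t)) integrable_on {0..X}" "(\<lambda>x. dissipation (p x t)) integrable_on {0..X}"
        "(\<lambda>x. cross_rate a b (u x t) (p x t)) integrable_on {0..X}" "(\<lambda>x. energy (p x t)) integrable_on {0..X}"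
        by (intro integrable_continuous_real continuous_intros c t)+
      have "((\<lambda>x. - A * dissipation (u x t) - A * dissipation (p x t) + cross_rate a b (u x t) (p x t) + \<kappa> * energy (p x t))
        has_integral - A * D t - A * D' t + Y' t + \<kappa> * E' t) {0..X}"
        unfolding D_def D'_def Y'_def E'_def
        by (intro has_integral_add has_integral_diff has_integral_mult_right integrable_integral i)
      then have "- A * D t - A * D' t + Y' t + \<kappa> * E' t \<le> 0"
        by (rule has_integral_le[OF _ has_integral_0]) (rule pointwise)
      moreover have "\<kappa> * t * D' t \<ge> 0" using \<kappa> t D'0[OF t] by auto
      ultimately show "A * (- D t - D' t) + Y' t + (\<kappa> * E' t - \<kappa> * t * D' t) \<le> 0" by (simp add: algebra_simps)
    qed (use T in auto)
    moreover have "A * (E T + E' T) + Y T \<ge> 0"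
    proof -
      have "C3 * (E T + E' T) \<le> A * (E T + E' T)" using A E0[of T] E'0[of T] T by (intro mult_right_mono) auto
      then show ?thesis using Ybound[of T] T by auto
    qed
    moreover have "M 0 \<le> (A + C3) * I0"
    proof -
      have s: "supported_in R z" "supported_in R z'" using z by (auto simp: C2_supported_def)
      have "E 0 + E' 0 \<le> I0"
        unfolding E_def E'_def I0_def mild_initial[OF u] mild_initial[OF m(2)]
        by (intro add_mono initial_energy_bound[OF C2_supported_continuous(1)[OF z] s(1)] initial_energy_bound[OF C2_supported_continuous(2)[OF z] s(2)])
      then have "(A + C3) * (E 0 + E' 0) \<le> (A + C3) * I0" using A C3 by (intro mult_left_mono) auto
      then show ?thesis using Ybound[of 0] T by (simp add: M_def algebra_simps)
    qed
    ultimately have "\<kappa> * T * E' T \<le> (A + C3) * I0" by (simp add: M_def)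
    then have E'T: "E' T \<le> B / T" using \<kappa> T by (simp add: B_def field_simps)
    have ET: "E T \<le> I0"
    proof -
      have "E T \<le> E 0" unfolding E_def by (rule energy_nonincreasing[OF cl(1) _ X]) (use T in auto)
      also have "\<dots> \<le> S * sqnorm z" unfolding E_def mild_initial[OF u]
        using z by (intro initial_energy_bound[OF C2_supported_continuous(1)[OF z]]) (auto simp: C2_supported_def)
      also have "\<dots> \<le> I0" unfolding I0_def using mult_nonneg_nonneg[OF S_nonneg sqnorm_nonneg[of z']] by simp
      finally show ?thesis .
    qed
    (* Bounding 2 * u * p by s * u^2 + p^2 / s with this s balances the bounded energy of u against the
       O(1 / T) energy of p. *)
    define s where "s = 1 / sqrt T"
    have s: "s > 0" using T by (simp add: s_def)
    have Tt: "T \<in> {0..T}" using T by simp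
    have comp: "(u x T $ i)\<^sup>2 \<le> W * (I0 + B) / sqrt T" for i
    proof (cases "x \<in> {0..X}")
      case False
      then have "u x T = 0" using cl(1) T by (auto simp: classical_def)
      then show ?thesis using W_nonneg I0 B T by auto
    next
      case True
      have ci: "continuous_on {0..X} (\<lambda>y. u y T)" "continuous_on {0..X} (\<lambda>y. p y T)" using c Tt by auto
      have "((\<lambda>y. 2 * u y T $ i * p y T $ i) has_integral ((u x T $ i)\<^sup>2 - (u 0 T $ i)\<^sup>2)) {0..x}"
        using True
        by (intro fundamental_theorem_of_calculus)
          (auto intro!: derivative_eq_intros classical_component_derivs(1)[OF cl(1) Tt] simp: has_real_derivative_iff_has_vector_derivative[symmetric])
      moreover have "u 0 T = 0" using cl(1) T by (auto simp: classical_def)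
      ultimately have "(u x T $ i)\<^sup>2 = integral {0..x} (\<lambda>y. 2 * u y T $ i * p y T $ i)" by (simp add: integral_unique)
      also have "\<dots> \<le> integral {0..x} (\<lambda>y. s * (u y T $ i)\<^sup>2 + (p y T $ i)\<^sup>2 / s)"
      proof (rule integral_le)
        have sub: "{0..x} \<subseteq> {0..X}" using True by auto
        show "(\<lambda>y. 2 * u y T $ i * p y T $ i) integrable_on {0..x}" "(\<lambda>y. s * (u y T $ i)\<^sup>2 + (p y T $ i)\<^sup>2 / s) integrable_on {0..x}"
          using s by (intro integrable_continuous_real continuous_intros continuous_on_subset[OF ci(1) sub] continuous_on_subset[OF ci(2) sub]; simp)+
        fix y
        have "0 \<le> (s * u y T $ i - p y T $ i)\<^sup>2 / s" using s by simp
        then show "2 * u y T $ i * p y T $ i \<le> s * (u y T $ i)\<^sup>2 + (p y T $ i)\<^sup>2 / s"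
          using s by (simp add: power2_eq_square field_simps)
      qed
      also have "\<dots> \<le> integral {0..X} (\<lambda>y. s * (u y T $ i)\<^sup>2 + (p y T $ i)\<^sup>2 / s)"
      proof (rule integral_subset_le)
        have sub: "{0..x} \<subseteq> {0..X}" using True by auto
        then show "{0..x} \<subseteq> {0..X}" .
        show "(\<lambda>y. s * (u y T $ i)\<^sup>2 + (p y T $ i)\<^sup>2 / s) integrable_on {0..x}"
          using s by (intro integrable_continuous_real continuous_intros continuous_on_subset[OF ci(1) sub] continuous_on_subset[OF ci(2) sub]; simp)
        show "(\<lambda>y. s * (u y T $ i)\<^sup>2 + (p y T $ i)\<^sup>2 / s) integrable_on {0..X}"
          using s by (intro integrable_continuous_real continuous_intros ci; simp)
      qed (use s in auto)
      also have "\<dots> \<le> integral {0..X} (\<lambda>y. s * (W * energy (u y T)) + (W * energy (p y T)) / s)"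
      proof (rule integral_le)
        show "(\<lambda>y. s * (u y T $ i)\<^sup>2 + (p y T $ i)\<^sup>2 / s) integrable_on {0..X}"
          "(\<lambda>y. s * (W * energy (u y T)) + (W * energy (p y T)) / s) integrable_on {0..X}"
          using s by (intro integrable_continuous_real continuous_intros ci; simp)+
        fix y
        have cn: "(v $ i)\<^sup>2 \<le> W * energy v" for v
          using power_mono[OF component_le_norm_cart[of v i], of 2] norm_le_energy[of v] by simp
        show "s * (u y T $ i)\<^sup>2 + (p y T $ i)\<^sup>2 / s \<le> s * (W * energy (u y T)) + (W * energy (p y T)) / s"
          using s by (intro add_mono mult_left_mono divide_right_mono cn) auto
      qed
      also have "\<dots> = s * (W * E T) + (W * E' T) / s"
      proof -
        have i: "(\<lambda>x. energy (u x T)) integrable_on {0..X}" "(\<lambda>x. energy (p x T)) integrable_on {0..X}"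
          by (intro integrable_continuous_real continuous_intros ci)+
        have "((\<lambda>y. s * (W * energy (u y T)) + (W * energy (p y T)) / s) has_integral s * (W * E T) + (W * E' T) / s) {0..X}"
          unfolding E_def E'_def
          by (intro has_integral_add has_integral_mult_right has_integral_divide integrable_integral i)
        then show ?thesis by (rule integral_unique)
      qed
      also have "\<dots> \<le> s * (W * I0) + (W * (B / T)) / s"
        using s ET E'T W_nonneg by (intro add_mono mult_left_mono divide_right_mono) auto
      also have "\<dots> = W * (I0 + B) / sqrt T"
      proof -
        have "T = sqrt T * sqrt T" using T by simp
        then have "(W * (B / T)) / s = W * B / sqrt T" unfolding s_def using T by (simp add: field_simps)
        then show ?thesis by (simp add: s_def add_divide_distrib distrib_left)
      qed
      finally show ?thesis .
    qed
    have "(norm (u x T))\<^sup>2 \<le> (\<Sum>i\<in>(UNIV::'n set). W * (I0 + B) / sqrt T)"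
      unfolding norm_squared_vec by (intro sum_mono comp)
    then show ?thesis by simp
  qed
  then show ?thesis using that by blast
qed

lemma decay:
  assumes u: "mild f u" and c: "continuous_on UNIV f" and z: "\<And>x. x \<le> 0 \<Longrightarrow> f x = 0"
    and lim: "(f \<longlongrightarrow> 0) at_top" and L: "L2_on {0<..} f" and ab: "lam $ a > lam $ b" and e: "e > 0"
  obtains T where "\<And>t x. t \<ge> T \<Longrightarrow> norm (u x t) \<le> e"
proof -
  define d where "d = e / (2 * (C\<^sub>0 + 1))"
  have d: "d > 0" "C\<^sub>0 * d \<le> e / 2"
    using e C\<^sub>0_nonneg by (auto simp: d_def field_simps intro!: divide_pos_pos add_nonneg_pos)
  obtain z z' z'' R where zz: "C2_supported R z z' z''" "\<And>x. norm (f x - z x) \<le> d"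
    using C0_L2_approx_C2[OF c z lim L d(1)] by metis
  obtain v p q where v: "mild z v" "mild z' p" "mild z'' q" using C2_supported_mild[OF zz(1)] .
  obtain C where C: "\<And>T x. T > 0 \<Longrightarrow> (norm (v x T))\<^sup>2 \<le> C / sqrt T" using decay_C2[OF zz(1) v(1) ab] by blast
  define T where "T = (4 * \<bar>C\<bar> / e\<^sup>2)\<^sup>2 + 1"
  have T: "T > 0" "sqrt T \<ge> 4 * \<bar>C\<bar> / e\<^sup>2"
    by (auto simp: T_def add_nonneg_pos intro!: real_le_rsqrt)
  have "norm (u x t) \<le> e" if t: "t \<ge> T" for t x
  proof -
    have "norm (u x t - v x t) \<le> C\<^sub>0 * d"
      by (rule sup_bound[OF mild_diff[OF u v(1)], of x]) (use zz(2) t T in auto)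
    moreover have "norm (v x t) \<le> e / 2"
    proof (rule power2_le_imp_le)
      have st: "sqrt t \<ge> 4 * \<bar>C\<bar> / e\<^sup>2" "sqrt t > 0" using t T by (auto intro: order_trans[OF T(2)])
      have "(norm (v x t))\<^sup>2 \<le> C / sqrt t" using C[of t x] t T by auto
      also have "\<dots> \<le> \<bar>C\<bar> / sqrt t" using st by (intro divide_right_mono) auto
      also have "\<dots> \<le> (e / 2)\<^sup>2" using st e by (simp add: field_simps power2_eq_square)
      finally show "(norm (v x t))\<^sup>2 \<le> (e / 2)\<^sup>2" .
    qed (use e in auto)
    ultimately show ?thesis using d(2) norm_triangle_ineq[of "u x t - v x t" "v x t"] by simp
  qed
  then show ?thesis using that by blast
qed

end


section \<open>The flow on square-integrable data\<close>

lemma convergent_if_geometric_steps: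
  fixes f :: "nat \<Rightarrow> 'a::banach"
  assumes d: "\<And>k. norm (f (Suc k) - f k) \<le> r * (1/2) ^ k" and r: "r \<ge> 0"
  shows "convergent f" "norm (f m - lim f) \<le> 2 * r * (1/2) ^ m"
proof -
  have step: "norm (f (m + j) - f m) \<le> 2 * r * (1/2) ^ m - 2 * r * (1/2) ^ (m + j)" for m j
  proof (induction j)
    case (Suc j)
    have "norm (f (m + Suc j) - f m) \<le> norm (f (Suc (m + j)) - f (m + j)) + norm (f (m + j) - f m)"
      using norm_triangle_ineq[of "f (Suc (m + j)) - f (m + j)" "f (m + j) - f m"] by simp
    also have "\<dots> \<le> r * (1/2) ^ (m + j) + (2 * r * (1/2) ^ m - 2 * r * (1/2) ^ (m + j))"
      by (intro add_mono d Suc)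
    finally show ?case by (simp add: field_simps)
  qed simp
  have bound: "norm (f n - f m) \<le> 2 * r * (1/2) ^ m" if "n \<ge> m" for m n
  proof -
    have "0 \<le> 2 * r * (1/2) ^ n" using r by simp
    then show ?thesis using step[of m "n - m"] that by simp
  qed
  have lim0: "(\<lambda>m. 2 * r * (1/2::real) ^ m) \<longlonglongrightarrow> 2 * r * 0"
    by (intro tendsto_intros LIMSEQ_power_zero) auto
  have "Cauchy f"
  proof (rule metric_CauchyI)
    fix e :: real assume e: "e > 0"
    then obtain M where M: "\<And>m. m \<ge> M \<Longrightarrow> 2 * r * (1/2::real) ^ m < e / 2"
      using order_tendstoD(2)[OF lim0, of "e/2"] by (auto simp: eventually_sequentially)
    have "dist (f m) (f n) < e" if "m \<ge> M" "n \<ge> M" for m n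
    proof -
      have "dist (f m) (f n) \<le> dist (f m) (f M) + dist (f n) (f M)" by (rule dist_triangle2)
      then show ?thesis using bound[OF that(1)] bound[OF that(2)] M[of M] by (simp add: dist_norm)
    qed
    then show "\<exists>M. \<forall>m\<ge>M. \<forall>n\<ge>M. dist (f m) (f n) < e" by blast
  qed
  then show c: "convergent f" by (simp add: Cauchy_convergent_iff)
  then have "f \<longlonglongrightarrow> lim f" by (simp add: convergent_LIMSEQ_iff)
  then have "(\<lambda>n. norm (f m - f n)) \<longlonglongrightarrow> norm (f m - lim f)" by (intro tendsto_intros)
  then show "norm (f m - lim f) \<le> 2 * r * (1/2) ^ m"
  proof (rule LIMSEQ_le_const2, intro exI[of _ m] allI impI)
    fix n assume "m \<le> n"
    from bound[OF this] show "norm (f m - f n) \<le> 2 * r * (1/2) ^ m" by (simp only: norm_minus_commute)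
  qed
qed

text \<open>Completeness of \<open>L2\<close> for rapidly convergent sequences.  The factor \<open>4 ^ m\<close> in front of the squared steps keeps their
  sum integrable; where that sum is finite the steps decrease geometrically, with an error controlled by
  the same integrable sum.\<close>

lemma L2_complete:
  fixes f :: "nat \<Rightarrow> real \<Rightarrow> 'a::euclidean_space"
  assumes L: "\<And>m. L2_on {0<..} (f m)" and d: "\<And>m. sqnorm (\<lambda>x. f (Suc m) x - f m x) \<le> C * (1/16) ^ m" and C: "C \<ge> 0"
  defines "F \<equiv> (\<lambda>x. lim (\<lambda>m. f m x))"
  shows "L2_on {0<..} F" "sqnorm (\<lambda>x. f m x - F x) \<le> 8 * C * (1/4) ^ m" "AE x in half_line. (\<lambda>m. f m x) \<longlonglongrightarrow> F x"
proof -
  have fm[measurable]: "f m \<in> borel_measurable half_line" for m using L by (simp add: L2_on_def)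
  have Fm[measurable]: "F \<in> borel_measurable half_line" unfolding F_def by (rule borel_measurable_lim_metric) measurable
  define a where "a m x = 4 ^ m * (norm (f (Suc m) x - f m x))\<^sup>2" for m x
  have [measurable]: "a m \<in> borel_measurable half_line" for m unfolding a_def by measurable
  have a0: "a m x \<ge> 0" for m x by (simp add: a_def)
  define Se where "Se x = (\<Sum>m. ennreal (a m x))" for x
  have [measurable]: "Se \<in> borel_measurable half_line" unfolding Se_def by measurable
  have ia: "integrable half_line (a m)" for m
    using L2_on_diff[OF L L] unfolding a_def by (auto simp: L2_on_def)
  have an: "(\<integral>\<^sup>+x. ennreal (a m x) \<partial>half_line) \<le> ennreal (C * (1/4) ^ m)" for m
  proof -
    have "(\<integral>\<^sup>+x. ennreal (a m x) \<partial>half_line) = ennreal (\<integral>x. a m x \<partial>half_line)"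
      by (rule nn_integral_eq_integral[OF ia]) (simp add: a0)
    also have "(\<integral>x. a m x \<partial>half_line) = 4 ^ m * sqnorm (\<lambda>x. f (Suc m) x - f m x)"
      unfolding a_def sqnorm_def by simp
    also have "\<dots> \<le> 4 ^ m * (C * (1/16) ^ m)" by (intro mult_left_mono d) auto
    also have "\<dots> = C * (1/4) ^ m" by (simp add: power_divide power_mult_distrib[symmetric] field_simps)
    finally show ?thesis by (simp add: ennreal_leI)
  qed
  have geo: "(\<lambda>m. C * (1/4::real) ^ m) sums (C * (1 / (1 - 1/4)))"
    by (intro sums_mult geometric_sums) auto
  have Sint: "(\<integral>\<^sup>+x. Se x \<partial>half_line) \<le> ennreal (2 * C)"
  proof -
    have "(\<integral>\<^sup>+x. Se x \<partial>half_line) = (\<Sum>m. \<integral>\<^sup>+x. ennreal (a m x) \<partial>half_line)"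
      unfolding Se_def by (rule nn_integral_suminf) measurable
    also have "\<dots> \<le> (\<Sum>m. ennreal (C * (1/4) ^ m))" by (intro suminf_le an) auto
    also have "\<dots> = ennreal (\<Sum>m. C * (1/4) ^ m)"
      using C sums_summable[OF geo] by (intro suminf_ennreal2) auto
    also have "\<dots> \<le> ennreal (2 * C)" using sums_unique[OF geo] C by (intro ennreal_leI) auto
    finally show ?thesis .
  qed
  have pt: "convergent (\<lambda>m. f m x)" "(norm (f m x - F x))\<^sup>2 \<le> 4 * (1/4) ^ m * enn2real (Se x)" if fin: "Se x < \<infinity>" for x m
  proof -
    define b where "b = enn2real (Se x)"
    have b: "b \<ge> 0" "Se x = ennreal b" using fin by (auto simp: b_def)
    have "norm (f (Suc k) x - f k x) \<le> sqrt b * (1/2) ^ k" for k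
    proof -
      have "ennreal (a k x) \<le> Se x" unfolding Se_def
        using sum_le_suminf[of "\<lambda>m. ennreal (a m x)" "{k}"] by auto
      then have "a k x \<le> b" using b by (simp add: ennreal_le_iff)
      then have "(norm (f (Suc k) x - f k x))\<^sup>2 \<le> b * (1/4) ^ k" by (simp add: a_def field_simps power_divide)
      also have "\<dots> = (sqrt b * (1/2) ^ k)\<^sup>2" using b by (simp add: power_mult_distrib power_divide power_even_eq[symmetric] power_mult[symmetric] mult.commute[of k 2] power_mult)
      finally show ?thesis by (rule power2_le_imp_le) (use b in auto)
    qed
    note g = convergent_if_geometric_steps[OF this real_sqrt_ge_zero[OF b(1)]]
    show "convergent (\<lambda>m. f m x)" by (rule g(1))
    have "norm (f m x - F x) \<le> 2 * sqrt b * (1/2) ^ m" unfolding F_def by (rule g(2))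
    then have "(norm (f m x - F x))\<^sup>2 \<le> (2 * sqrt b * (1/2) ^ m)\<^sup>2" by (intro power_mono) auto
    also have "\<dots> = 4 * (1/4) ^ m * b" using b by (simp add: power_mult_distrib power_divide power_mult[symmetric] mult.commute[of m 2] power_mult)
    finally show "(norm (f m x - F x))\<^sup>2 \<le> 4 * (1/4) ^ m * enn2real (Se x)" by (simp add: b_def)
  qed
  have AEfin: "AE x in half_line. Se x < \<infinity>"
  proof -
    have "(\<integral>\<^sup>+x. Se x \<partial>half_line) \<noteq> \<infinity>" using Sint by (auto simp: top_unique)
    then have "AE x in half_line. Se x \<noteq> \<infinity>" by (intro nn_integral_PInf_AE) measurable
    then show ?thesis by eventually_elim (simp add: less_top)
  qed
  have nn: "(\<integral>\<^sup>+x. ennreal ((norm (f m x - F x))\<^sup>2) \<partial>half_line) \<le> ennreal (8 * C * (1/4) ^ m)" for m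
  proof -
    have "(\<integral>\<^sup>+x. ennreal ((norm (f m x - F x))\<^sup>2) \<partial>half_line) \<le> (\<integral>\<^sup>+x. ennreal (4 * (1/4) ^ m) * Se x \<partial>half_line)"
    proof (rule nn_integral_mono_AE)
      show "AE x in half_line. ennreal ((norm (f m x - F x))\<^sup>2) \<le> ennreal (4 * (1/4) ^ m) * Se x"
        using AEfin
      proof eventually_elim
        case (elim x)
        have "ennreal ((norm (f m x - F x))\<^sup>2) \<le> ennreal (4 * (1/4) ^ m * enn2real (Se x))"
          by (rule ennreal_leI[OF pt(2)[OF elim]])
        also have "\<dots> = ennreal (4 * (1/4) ^ m) * Se x" using elim by (simp add: ennreal_mult)
        finally show ?case .
      qed
    qed
    also have "\<dots> = ennreal (4 * (1/4) ^ m) * (\<integral>\<^sup>+x. Se x \<partial>half_line)" by (rule nn_integral_cmult) measurable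
    also have "\<dots> \<le> ennreal (4 * (1/4) ^ m) * ennreal (2 * C)" by (intro mult_left_mono Sint) auto
    also have "\<dots> = ennreal (8 * C * (1/4) ^ m)" using C by (simp add: ennreal_mult[symmetric] mult_ac)
    finally show ?thesis .
  qed
  have Ld: "L2_on {0<..} (\<lambda>x. f m x - F x)" for m
    unfolding L2_on_def
  proof (intro conjI)
    show "integrable half_line (\<lambda>x. (norm (f m x - F x))\<^sup>2)"
      by (rule integrableI_nonneg) (use nn[of m] in \<open>auto simp: le_less_trans\<close>)
  qed measurable
  show "L2_on {0<..} F" using L2_on_diff[OF L[of 0] Ld[of 0]] by simp
  show "sqnorm (\<lambda>x. f m x - F x) \<le> 8 * C * (1/4) ^ m"
  proof -
    have "ennreal (sqnorm (\<lambda>x. f m x - F x)) = (\<integral>\<^sup>+x. ennreal ((norm (f m x - F x))\<^sup>2) \<partial>half_line)"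
      unfolding sqnorm_def by (rule nn_integral_eq_integral[symmetric]) (use Ld in \<open>auto simp: L2_on_def\<close>)
    then have "ennreal (sqnorm (\<lambda>x. f m x - F x)) \<le> ennreal (8 * C * (1/4) ^ m)" using nn[of m] by simp
    then show ?thesis using C by (subst (asm) ennreal_le_iff) auto
  qed
  show "AE x in half_line. (\<lambda>m. f m x) \<longlonglongrightarrow> F x"
    using AEfin by eventually_elim (auto simp: F_def convergent_LIMSEQ_iff[symmetric] intro: pt(1))
qed

lemma C2_supported_diff:
  assumes "C2_supported R z z' z''" "C2_supported Q y y' y''"
  shows "C2_supported (max R Q) (\<lambda>x. z x - y x) (\<lambda>x. z' x - y' x) (\<lambda>x. z'' x - y'' x)"
  using assms unfolding C2_supported_def supported_in_def
  by (auto intro!: has_vector_derivative_diff continuous_intros)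

context transport
begin

text \<open>On bounded time intervals the solution is jointly continuous with support in a fixed compact set.\<close>

lemma C2_time_continuous:
  assumes z: "C2_supported R z z' z''" and u: "mild z u" and t: "t \<ge> 0"
  shows "((\<lambda>s. sqnorm (\<lambda>x. u x s - u x t)) \<longlongrightarrow> 0) (at t within {0..})"
proof -
  obtain v p q where m: "mild z v" "mild z' p" "mild z'' q" using C2_supported_mild[OF z] .
  define T where "T = t + 1"
  have T: "T \<ge> 0" "t \<in> {0..T}" using t by (auto simp: T_def)
  define X where "X = max 0 R + speed * T"
  have cl: "classical X T u p" unfolding X_def by (rule classical_of_mild[OF z u m(2,3) T(1)])
  have eq: "sqnorm (\<lambda>x. u x s - u x t) = integral (cbox 0 X) (\<lambda>x. (norm (u x s - u x t))\<^sup>2)" if s: "s \<in> {0..T}" for s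
    unfolding cbox_interval
    by (rule sqnorm_supported)
      (use cl s T in \<open>auto simp: supported_in_def classical_def intro!: continuous_intros classical_continuous(3)[OF cl]\<close>)
  have "continuous_on {0..T} (\<lambda>s. integral (cbox 0 X) (\<lambda>x. (norm (u x s - u x t))\<^sup>2))"
  proof (rule integral_continuous_on_param)
    have "continuous_on ({0..T} \<times> cbox 0 X) (\<lambda>y. u (snd y) t)"
      by (rule continuous_on_compose2[OF classical_continuous(3)[OF cl T(2), of UNIV]]) (auto intro!: continuous_intros)
    then show "continuous_on ({0..T} \<times> cbox 0 X) (\<lambda>(s, x). (norm (u x s - u x t))\<^sup>2)"
      unfolding split_beta by (intro continuous_intros classical_continuous(1)[OF cl, unfolded split_beta])
  qed
  from this[unfolded continuous_on_def, rule_format, OF T(2)]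
  have "((\<lambda>s. integral (cbox 0 X) (\<lambda>x. (norm (u x s - u x t))\<^sup>2)) \<longlongrightarrow> 0) (at t within {0..T})"
    by simp
  then have "((\<lambda>s. sqnorm (\<lambda>x. u x s - u x t)) \<longlongrightarrow> 0) (at t within {0..T})"
    by (rule Lim_transform_within[OF _ zero_less_one]) (simp add: eq)
  then show ?thesis using at_within_Icc_Suc[OF t] by (simp add: T_def)
qed

text \<open>The differences of the approximating solutions are bounded by the differences of the data, uniformly in
  time.  So the limit inherits continuity in time.\<close>

lemma L2_flow:
  fixes z :: "nat \<Rightarrow> real \<Rightarrow> real ^ 'n"
  assumes g: "L2_on {0<..} g" and z: "\<And>m. \<exists>R z' z''. C2_supported R (z m) z' z''"
    and gz: "\<And>m. sqnorm (\<lambda>x. g x - z m x) < (1/16) ^ m" and u: "\<And>m. mild (z m) (u m)"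
  obtains Z C where "\<And>t. t \<ge> 0 \<Longrightarrow> L2_on {0<..} (Z t)"
    "\<And>t. t \<ge> 0 \<Longrightarrow> AE x in half_line. (\<lambda>m. u m x t) \<longlonglongrightarrow> Z t x"
    "\<And>t m. t \<ge> 0 \<Longrightarrow> sqnorm (\<lambda>x. u m x t - Z t x) \<le> C * (1/4) ^ m"
    "\<And>t. t \<ge> 0 \<Longrightarrow> ((\<lambda>s. sqnorm (\<lambda>x. Z s x - Z t x)) \<longlongrightarrow> 0) (at t within {0..})"
proof -
  define Z where "Z t x = lim (\<lambda>m. u m x t)" for t x
  define C1 where "C1 = W * S * 4"
  have C1: "C1 \<ge> 0" using W_nonneg S_nonneg by (simp add: C1_def)
  define C where "C = 8 * C1"
  have Lz: "L2_on {0<..} (z m)" for m using z[of m] C2_supported_L2 by blast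
  have Lu: "L2_on {0<..} (\<lambda>x. u m x t)" if "t \<ge> 0" for m t
    using z[of m] sqnorm_mild_bound(2)[OF _ u that] by blast
  have d: "sqnorm (\<lambda>x. u (Suc m) x t - u m x t) \<le> C1 * (1/16) ^ m" if "t \<ge> 0" for m t
  proof -
    have "sqnorm (\<lambda>x. u (Suc m) x t - u m x t) \<le> W * S * sqnorm (\<lambda>x. z (Suc m) x - z m x)"
    proof -
      obtain R1 a1 b1 R2 a2 b2 where "C2_supported R1 (z (Suc m)) a1 b1" "C2_supported R2 (z m) a2 b2"
        using z[of m] z[of "Suc m"] by blast
      then show ?thesis by (intro sqnorm_mild_bound(1)[OF C2_supported_diff mild_diff[OF u u] that])
    qed
    also have "sqnorm (\<lambda>x. z (Suc m) x - z m x) \<le> 2 * (1/16) ^ Suc m + 2 * (1/16) ^ m"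
      using sqnorm_diff_trans[OF Lz[of "Suc m"] g Lz[of m]] gz[of m] gz[of "Suc m"] sqnorm_minus_commute[of g "z (Suc m)"] by linarith
    also have "2 * (1/16) ^ Suc m + 2 * (1/16) ^ m \<le> 4 * (1/16::real) ^ m" by simp
    finally show ?thesis using W_nonneg S_nonneg by (simp add: C1_def mult_left_mono mult.assoc)
  qed
  have Z: "L2_on {0<..} (Z t)" "\<And>m. sqnorm (\<lambda>x. u m x t - Z t x) \<le> C * (1/4) ^ m" "AE x in half_line. (\<lambda>m. u m x t) \<longlonglongrightarrow> Z t x"
    if "t \<ge> 0" for t
    using L2_complete[OF Lu[OF that] d[OF that] C1] unfolding Z_def C_def by auto
  have cont: "((\<lambda>s. sqnorm (\<lambda>x. Z s x - Z t x)) \<longlongrightarrow> 0) (at t within {0..})" if t: "t \<ge> 0" for t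
  proof (rule tendstoI)
    fix e :: real assume e: "e > 0"
    have "(\<lambda>m. 6 * (C * (1/4::real) ^ m)) \<longlonglongrightarrow> 6 * (C * 0)"
      by (intro tendsto_intros LIMSEQ_power_zero) auto
    then have "\<forall>\<^sub>F m in sequentially. 6 * (C * (1/4::real) ^ m) < e / 2"
      by (rule order_tendstoD(2)) (use e in simp)
    then obtain m where m: "6 * (C * (1/4::real) ^ m) < e / 2" by (auto simp: eventually_sequentially)
    have "\<forall>\<^sub>F s in at t within {0..}. sqnorm (\<lambda>x. u m x s - u m x t) < e / 8"
    proof -
      obtain R a b where "C2_supported R (z m) a b" using z[of m] by blast
      from order_tendstoD(2)[OF C2_time_continuous[OF this u t], of "e/8"] show ?thesis using e by simp
    qed
    moreover have "\<forall>\<^sub>F s in at t within {0..}. s \<in> {0..}" by (simp add: eventually_at_filter)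
    ultimately show "\<forall>\<^sub>F s in at t within {0..}. dist (sqnorm (\<lambda>x. Z s x - Z t x)) 0 < e"
    proof eventually_elim
      case (elim s)
      then have s: "s \<ge> 0" by simp
      have "sqnorm (\<lambda>x. Z s x - Z t x) \<le> 2 * sqnorm (\<lambda>x. Z s x - u m x s) + 2 * sqnorm (\<lambda>x. u m x s - Z t x)"
        by (rule sqnorm_diff_trans[OF Z(1)[OF s] Lu[OF s] Z(1)[OF t]])
      moreover have "sqnorm (\<lambda>x. u m x s - Z t x) \<le> 2 * sqnorm (\<lambda>x. u m x s - u m x t) + 2 * sqnorm (\<lambda>x. u m x t - Z t x)"
        by (rule sqnorm_diff_trans[OF Lu[OF s] Lu[OF t] Z(1)[OF t]])
      moreover have "sqnorm (\<lambda>x. Z s x - u m x s) \<le> C * (1/4) ^ m"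
        using Z(2)[OF s, of m] by (simp add: sqnorm_minus_commute)
      ultimately have "sqnorm (\<lambda>x. Z s x - Z t x) < e" using Z(2)[OF t, of m] m elim(1) by linarith
      then show ?case using sqnorm_nonneg[of "\<lambda>x. Z s x - Z t x"] by (simp add: dist_real_def)
    qed
  qed
  show ?thesis by (rule that[OF Z(1) Z(3) Z(2) cont])
qed

text \<open>Approximation that is simultaneously uniform and in \<open>L2\<close> identifies the \<open>L2\<close> limit with the pointwise
  solution.\<close>

lemma mild_L2_continuous:
  assumes u: "mild f u" and c: "continuous_on UNIV f" and z: "\<And>x. x \<le> 0 \<Longrightarrow> f x = 0"
    and lim: "(f \<longlongrightarrow> 0) at_top" and L: "L2_on {0<..} f" and t: "t \<ge> 0"
  shows "L2_on {0<..} (\<lambda>x. u x t)" "((\<lambda>s. sqnorm (\<lambda>x. u x s - u x t)) \<longlongrightarrow> 0) (at t within {0..})"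
proof -
  have "\<forall>m. \<exists>y. (\<exists>R y' y''. C2_supported R y y' y'') \<and> sqnorm (\<lambda>x. f x - y x) < (1/16) ^ m \<and> (\<forall>x. norm (f x - y x) \<le> (1/16) ^ m)"
  proof
    fix m :: nat
    have e: "(1/16::real) ^ m > 0" by simp
    obtain y y' y'' R where "C2_supported R y y' y''" "sqnorm (\<lambda>x. f x - y x) < (1/16) ^ m" "\<And>x. norm (f x - y x) \<le> (1/16) ^ m"
      by (rule C0_L2_approx_C2[OF c _ lim L e]) (erule z, rule that, assumption+)
    then show "\<exists>y. (\<exists>R y' y''. C2_supported R y y' y'') \<and> sqnorm (\<lambda>x. f x - y x) < (1/16) ^ m \<and> (\<forall>x. norm (f x - y x) \<le> (1/16) ^ m)" by blast
  qed
  from choice[OF this] obtain y where y: "\<And>m. \<exists>R y' y''. C2_supported R (y m) y' y''"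
    and fy: "\<And>m. sqnorm (\<lambda>x. f x - y m x) < (1/16) ^ m" "\<And>m x. norm (f x - y m x) \<le> (1/16) ^ m"
    by blast
  have "\<forall>m. \<exists>v. mild (y m) v"
  proof
    fix m
    obtain R y' y'' where "C2_supported R (y m) y' y''" using y[of m] by blast
    then obtain v1 v2 v3 where "mild (y m) v1" "mild y' v2" "mild y'' v3" by (rule C2_supported_mild)
    then show "\<exists>v. mild (y m) v" by blast
  qed
  from choice[OF this] obtain v where v: "\<And>m. mild (y m) (v m)" by blast
  obtain Z C where Z: "\<And>t. t \<ge> 0 \<Longrightarrow> L2_on {0<..} (Z t)"
    "\<And>t. t \<ge> 0 \<Longrightarrow> AE x in half_line. (\<lambda>m. v m x t) \<longlonglongrightarrow> Z t x"
    "\<And>t m. t \<ge> 0 \<Longrightarrow> sqnorm (\<lambda>x. v m x t - Z t x) \<le> C * (1/4) ^ m"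
    "\<And>t. t \<ge> 0 \<Longrightarrow> ((\<lambda>s. sqnorm (\<lambda>x. Z s x - Z t x)) \<longlongrightarrow> 0) (at t within {0..})"
    by (rule L2_flow[OF L y fy(1) v]) (rule that, assumption+)
  have conv: "(\<lambda>m. v m x s) \<longlonglongrightarrow> u x s" if s: "s \<ge> 0" for x s
  proof (rule LIM_zero_cancel, rule Lim_null_comparison)
    show "\<forall>\<^sub>F m in sequentially. norm (v m x s - u x s) \<le> C\<^sub>0 * (1/16) ^ m"
    proof (intro always_eventually allI)
      fix m show "norm (v m x s - u x s) \<le> C\<^sub>0 * (1/16) ^ m"
        by (rule sup_bound[OF mild_diff[OF v u], where L=x]) (use fy(2) s in \<open>auto simp: norm_minus_commute\<close>)
    qed
    have "(\<lambda>m. C\<^sub>0 * (1/16::real) ^ m) \<longlonglongrightarrow> C\<^sub>0 * 0" by (intro tendsto_intros LIMSEQ_power_zero) auto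
    then show "(\<lambda>m. C\<^sub>0 * (1/16::real) ^ m) \<longlonglongrightarrow> 0" by simp
  qed
  have ae: "AE x in half_line. Z s x = u x s" if s: "s \<ge> 0" for s
    using Z(2)[OF s] by eventually_elim (rule LIMSEQ_unique[OF _ conv[OF s]])
  have Lu: "L2_on {0<..} (\<lambda>x. u x s)" if "s \<ge> 0" for s
    by (rule L2_on_cong_AE[OF Z(1)[OF that] ae[OF that]]) simp
  show "L2_on {0<..} (\<lambda>x. u x t)" by (rule Lu[OF t])
  have eq: "sqnorm (\<lambda>x. Z s x - Z t x) = sqnorm (\<lambda>x. u x s - u x t)" if s: "s \<ge> 0" for s
  proof (rule sqnorm_cong_AE)
    show "AE x in half_line. Z s x - Z t x = u x s - u x t"
      using ae[OF s] ae[OF t] by eventually_elim simp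
  qed (use L2_on_diff[OF Z(1)[OF s] Z(1)[OF t]] L2_on_diff[OF Lu[OF s] Lu[OF t]] in \<open>auto simp: L2_on_def\<close>)
  show "((\<lambda>s. sqnorm (\<lambda>x. u x s - u x t)) \<longlongrightarrow> 0) (at t within {0..})"
    by (rule Lim_transform_within[OF Z(4)[OF t] zero_less_one]) (simp add: eq)
qed

end

lemma primitive_has_derivative:
  fixes z :: "real \<Rightarrow> 'a::euclidean_space"
  assumes c: "continuous_on UNIV z" and s: "\<And>x. x \<le> 0 \<Longrightarrow> z x = 0"
  shows "((\<lambda>x. integral {0..x} z) has_vector_derivative z x) (at x)"
proof (cases "x < 0")
  case True
  have "((\<lambda>x. 0) has_vector_derivative z x) (at x)" using s[of x] True by (auto intro!: derivative_eq_intros)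
  then show ?thesis
    by (rule has_vector_derivative_transform_within_open[where S="{..<0}"]) (use True in auto)
next
  case False
  have i: "z integrable_on {a..b}" for a b by (intro integrable_continuous_real continuous_on_subset[OF c]) auto
  have "((\<lambda>y. integral {-1..y} z) has_vector_derivative z x) (at x within {-1..x+1})"
    by (rule integral_has_vector_derivative[OF continuous_on_subset[OF c]]) (use False in auto)
  moreover have "at x within {-1..x+1} = at x" using False by (intro at_within_interior) auto
  ultimately have "((\<lambda>y. integral {-1..y} z) has_vector_derivative z x) (at x)" by simp
  then show ?thesis
  proof (rule has_vector_derivative_transform_within_open[where S="{-1<..}"])
    fix y :: real assume y: "y \<in> {-1<..}"
    have z0: "integral {-1..b} z = 0" if "b \<le> 0" for b
    proof -
      have "integral {-1..b} z = integral {-1..b} (\<lambda>_. 0)" by (rule integral_cong) (use s that in auto)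
      then show ?thesis by simp
    qed
    show "integral {-1..y} z = integral {0..y} z"
    proof (cases "y < 0")
      case True then show ?thesis using z0[of y] by simp
    next
      case False
      then show ?thesis using Henstock_Kurzweil_Integration.integral_combine[of "-1" 0 y z] i z0[of 0] by simp
    qed
  qed (use False in auto)
qed

context transport
begin

text \<open>For smooth data the derivative of the solution with primitive data is the solution with the data
  themselves.  In the limit the left-hand sides converge locally uniformly by the maximum principle and the integrands
  converge in \<open>L2\<close>.\<close>

lemma mild_primitive:
  assumes g: "L2_on {0<..} g" and p: "mild p0 p" and p0: "\<And>x. p0 x = integral {0..x} g"
  obtains Z where "\<And>t. t \<ge> 0 \<Longrightarrow> L2_on {0<..} (Z t)"
    "\<And>t. t \<ge> 0 \<Longrightarrow> ((\<lambda>s. sqnorm (\<lambda>x. Z s x - Z t x)) \<longlongrightarrow> 0) (at t within {0..})"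
    "\<And>x t. t \<ge> 0 \<Longrightarrow> x \<ge> 0 \<Longrightarrow> p x t = integral {0..x} (Z t)"
proof -
  have "\<forall>m. \<exists>y. (\<exists>R y' y''. C2_supported R y y' y'') \<and> sqnorm (\<lambda>x. g x - y x) < (1/16) ^ m"
  proof
    fix m :: nat
    have "(1/16::real) ^ m > 0" by simp
    then obtain y y' y'' R where "C2_supported R y y' y''" "sqnorm (\<lambda>x. g x - y x) < (1/16) ^ m"
      using L2_approx_C2[OF g] by metis
    then show "\<exists>y. (\<exists>R y' y''. C2_supported R y y' y'') \<and> sqnorm (\<lambda>x. g x - y x) < (1/16) ^ m" by blast
  qed
  from choice[OF this] obtain y where y: "\<And>m. \<exists>R y' y''. C2_supported R (y m) y' y''"
    and gy: "\<And>m. sqnorm (\<lambda>x. g x - y m x) < (1/16) ^ m"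
    by blast
  have "\<forall>m. \<exists>v. mild (y m) v"
  proof
    fix m
    obtain R y' y'' where "C2_supported R (y m) y' y''" using y[of m] by blast
    then obtain v1 v2 v3 where "mild (y m) v1" "mild y' v2" "mild y'' v3" by (rule C2_supported_mild)
    then show "\<exists>v. mild (y m) v" by blast
  qed
  from choice[OF this] obtain v where v: "\<And>m. mild (y m) (v m)" by blast
  obtain Z C where Z: "\<And>t. t \<ge> 0 \<Longrightarrow> L2_on {0<..} (Z t)"
    "\<And>t. t \<ge> 0 \<Longrightarrow> AE x in half_line. (\<lambda>m. v m x t) \<longlonglongrightarrow> Z t x"
    "\<And>t m. t \<ge> 0 \<Longrightarrow> sqnorm (\<lambda>x. v m x t - Z t x) \<le> C * (1/4) ^ m"
    "\<And>t. t \<ge> 0 \<Longrightarrow> ((\<lambda>s. sqnorm (\<lambda>x. Z s x - Z t x)) \<longlongrightarrow> 0) (at t within {0..})"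
    by (rule L2_flow[OF g y gy v]) (rule that, assumption+)
  have yc: "continuous_on UNIV (y m)" for m using y[of m] C2_supported_continuous(1) by blast
  have "\<forall>m. \<exists>R. supported_in R (y m)"
  proof
    fix m
    obtain R y' y'' where "C2_supported R (y m) y' y''" using y[of m] by blast
    then show "\<exists>R. supported_in R (y m)" unfolding C2_supported_def by blast
  qed
  from choice[OF this] obtain R where ys: "\<And>m. supported_in (R m) (y m)" by blast
  have Ly: "L2_on {0<..} (y m)" for m by (rule continuous_supported_L2[OF yc ys])
  define q where "q m x = integral {0..x} (y m)" for m x
  have qd: "(q m has_vector_derivative y m x) (at x)" for m x
    unfolding q_def[abs_def] by (rule primitive_has_derivative[OF yc]) (use ys in \<open>auto simp: supported_in_def\<close>)
  have qc: "continuous_on A (q m)" for m A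
    using qd by (meson continuous_at_imp_continuous_on has_vector_derivative_continuous)
  have qb: "\<exists>b. \<forall>x. norm (q m x) \<le> b" for m
  proof -
    define X where "X = max 0 (R m)"
    have "compact (q m ` {0..X})" by (intro compact_continuous_image qc compact_Icc)
    then obtain b where b: "\<And>x. x \<in> {0..X} \<Longrightarrow> norm (q m x) \<le> b" by (metis bounded_iff compact_imp_bounded imageI)
    have "norm (q m x) \<le> b" for x
    proof -
      consider "x < 0" | "x \<in> {0..X}" | "x > X" by force
      then show ?thesis
      proof cases
        case 1 then have "q m x = q m 0" by (simp add: q_def)
        then show ?thesis using b[of 0] by (simp add: X_def)
      next
        case 3
        have "q m x = integral {0..X} (y m) + integral {X..x} (y m)"
          unfolding q_def using 3
          by (intro Henstock_Kurzweil_Integration.integral_combine[symmetric] integrable_continuous_real continuous_on_subset[OF yc]) (auto simp: X_def)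
        also have "integral {X..x} (y m) = integral {X..x} (\<lambda>_. 0)"
          by (rule integral_cong) (use ys[of m] in \<open>auto simp: supported_in_def X_def\<close>)
        finally show ?thesis using b[of X] by (simp add: q_def X_def)
      qed (use b in auto)
    qed
    then show ?thesis by blast
  qed
  have "\<forall>m. \<exists>Q. mild (q m) Q"
  proof
    fix m
    obtain b where "\<And>x. norm (q m x) \<le> b" using qb[of m] by blast
    then obtain Q where "mild (q m) Q" by (rule mild_exists[OF qc])
    then show "\<exists>Q. mild (q m) Q" by blast
  qed
  from choice[OF this] obtain Q where Q: "\<And>m. mild (q m) (Q m)" by blast
  have QI: "Q m x t = integral {0..x} (\<lambda>s. v m s t)" if t: "t \<ge> 0" and x: "x \<ge> 0" for m x t
  proof -
    have "((\<lambda>s. v m s t) has_integral (Q m x t - Q m 0 t)) {0..x}"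
    proof (rule fundamental_theorem_of_calculus[OF x])
      fix s
      show "((\<lambda>s. Q m s t) has_vector_derivative v m s t) (at s within {0..x})"
        by (rule has_vector_derivative_at_within[OF mild_space_derivative[OF Q v qd yc _ t]]) (use ys in \<open>auto simp: supported_in_def\<close>)
    qed
    moreover have "Q m 0 t = 0"
    proof (rule mild_zero_left[OF Q _ order_refl t])
      show "q m s = 0" if "s \<le> 0" for s using that by (cases "s = 0") (auto simp: q_def)
    qed
    ultimately show ?thesis by (simp add: integral_unique)
  qed
  have main: "p x t = integral {0..x} (Z t)" if t: "t \<ge> 0" and x: "x \<ge> 0" for x t
  proof -
    have Lv: "L2_on {0<..} (\<lambda>s. v m s t)" for m 
      using y[of m] sqnorm_mild_bound(2)[OF _ v t] by blast
    have "(\<lambda>m. Q m x t) \<longlonglongrightarrow> p x t"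
    proof (rule LIM_zero_cancel, rule Lim_null_comparison)
      show "\<forall>\<^sub>F m in sequentially. norm (Q m x t - p x t) \<le> C\<^sub>0 * sqrt (x * (1/16) ^ m)"
      proof (intro always_eventually allI)
        fix m
        have "norm (q m s - p0 s) \<le> sqrt (x * (1/16) ^ m)" if s: "s \<le> x" for s
        proof (cases "s \<le> 0")
          case True then show ?thesis using x by (cases "s = 0") (auto simp: q_def p0)
        next
          case False
          have "q m s - p0 s = integral {0..s} (\<lambda>x. y m x - g x)"
            unfolding q_def p0 by (intro integral_diff[symmetric] L2_integrable_on Ly g order_refl)
          moreover have "(norm (integral {0..s} (\<lambda>x. y m x - g x)))\<^sup>2 \<le> (s - 0) * sqnorm (\<lambda>x. y m x - g x)"
            using False by (intro L2_norm_integral_squared_le(1) L2_on_diff Ly g) auto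
          moreover have "(s - 0) * sqnorm (\<lambda>x. y m x - g x) \<le> x * (1/16) ^ m"
            using s x gy[of m] by (intro mult_mono) (auto simp: sqnorm_minus_commute sqnorm_nonneg)
          ultimately show ?thesis by (intro real_le_rsqrt) simp
        qed
        then show "norm (Q m x t - p x t) \<le> C\<^sub>0 * sqrt (x * (1/16) ^ m)"
          by (intro sup_bound[OF mild_diff[OF Q p], where L=x]) (use t in auto)
      qed
      have "(\<lambda>m. C\<^sub>0 * sqrt (x * (1/16::real) ^ m)) \<longlonglongrightarrow> C\<^sub>0 * sqrt (x * 0)" by (intro tendsto_intros LIMSEQ_power_zero) auto
      then show "(\<lambda>m. C\<^sub>0 * sqrt (x * (1/16::real) ^ m)) \<longlonglongrightarrow> 0" by simp
    qed
    moreover have "(\<lambda>m. Q m x t) \<longlonglongrightarrow> integral {0..x} (Z t)"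
    proof (rule LIM_zero_cancel, rule Lim_null_comparison)
      show "\<forall>\<^sub>F m in sequentially. norm (Q m x t - integral {0..x} (Z t)) \<le> sqrt (x * (C * (1/4) ^ m))"
      proof (intro always_eventually allI real_le_rsqrt)
        fix m
        have "Q m x t - integral {0..x} (Z t) = integral {0..x} (\<lambda>s. v m s t - Z t s)"
          unfolding QI[OF t x] by (intro integral_diff[symmetric] L2_integrable_on Lv Z(1) t order_refl)
        moreover have "(norm (integral {0..x} (\<lambda>s. v m s t - Z t s)))\<^sup>2 \<le> (x - 0) * sqnorm (\<lambda>s. v m s t - Z t s)"
          using x by (intro L2_norm_integral_squared_le(1) L2_on_diff Lv Z(1) t) auto
        moreover have "(x - 0) * sqnorm (\<lambda>s. v m s t - Z t s) \<le> x * (C * (1/4) ^ m)"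
          using x Z(3)[OF t, of m] by (simp add: mult_left_mono)
        ultimately show "(norm (Q m x t - integral {0..x} (Z t)))\<^sup>2 \<le> x * (C * (1/4) ^ m)" by simp
      qed
      have "(\<lambda>m. sqrt (x * (C * (1/4::real) ^ m))) \<longlonglongrightarrow> sqrt (x * (C * 0))" by (intro tendsto_intros LIMSEQ_power_zero) auto
      then show "(\<lambda>m. sqrt (x * (C * (1/4::real) ^ m))) \<longlonglongrightarrow> 0" by simp
    qed
    ultimately show ?thesis by (rule LIMSEQ_unique)
  qed
  show ?thesis by (rule that[OF Z(1) Z(4) main])
qed

end


section \<open>The initial-boundary-value problem\<close>

text \<open>The columns of \<open>K\<close> sum to zero, so \<open>K\<close> has a kernel vector \<open>v\<close>.  Taking absolute values entrywise gives
  \<open>K \<bar>v\<bar> \<ge> 0\<close>, whose entries again sum to zero; hence \<open>\<bar>v\<bar>\<close> is in the kernel.  A zero entry would spread along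
  every path of positive entries.\<close>

lemma perron_vector:
  fixes K :: "real ^ 'n ^ 'n"
  assumes offdiag: "\<And>i j. i \<noteq> j \<Longrightarrow> K $ i $ j \<ge> 0"
    and colsum: "\<And>j. (\<Sum>i\<in>UNIV. K $ i $ j) = 0"
    and irred: "\<And>i\<^sub>0 i\<^sub>1. i\<^sub>0 \<noteq> i\<^sub>1 \<Longrightarrow>
      \<exists>js. js \<noteq> [] \<and> hd js = i\<^sub>0 \<and> last js = i\<^sub>1 \<and>
           (\<forall>m. Suc m < length js \<longrightarrow> K $ (js ! m) $ (js ! Suc m) > 0)"
  obtains w where "\<And>i. w $ i > 0" "K *v w = 0"
proof -
  have "\<exists>v. K *v v = 0 \<and> v \<noteq> 0"
  proof (rule ccontr)
    assume "\<not> (\<exists>v. K *v v = 0 \<and> v \<noteq> 0)"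
    then obtain B where "B ** K = mat 1"
      using matrix_left_invertible_ker[of K] by blast
    then have KB: "K ** B = mat 1" using matrix_left_right_inverse by blast
    fix j :: 'n
    have "(\<Sum>i\<in>UNIV. (K ** B) $ i $ j) = (\<Sum>k\<in>UNIV. (\<Sum>i\<in>UNIV. K $ i $ k) * B $ k $ j)"
      unfolding matrix_matrix_mult_def sum_distrib_right by simp (rule sum.swap)
    also have "\<dots> = 0" by (simp add: colsum)
    finally show False unfolding KB by (simp add: mat_def)
  qed
  then obtain v where v: "K *v v = 0" "v \<noteq> 0" by blast
  define a where "a = (\<chi> i. \<bar>v $ i\<bar>)"
  have row_nonneg: "(\<Sum>j\<in>UNIV. K $ i $ j * a $ j) \<ge> 0" for i
  proof -
    have split: "(\<Sum>j\<in>UNIV. K $ i $ j * y j) = K $ i $ i * y i + (\<Sum>j\<in>UNIV - {i}. K $ i $ j * y j)" for y :: "'n \<Rightarrow> real"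
      by (rule sum.remove) auto
    have "(\<Sum>j\<in>UNIV. K $ i $ j * v $ j) = 0" using v(1) by (simp add: vec_eq_iff matrix_vector_mult_def)
    then have "\<bar>K $ i $ i * v $ i\<bar> = \<bar>\<Sum>j\<in>UNIV - {i}. K $ i $ j * v $ j\<bar>" unfolding split by simp
    also have "\<dots> \<le> (\<Sum>j\<in>UNIV - {i}. \<bar>K $ i $ j * v $ j\<bar>)" by (rule sum_abs)
    also have "\<dots> = (\<Sum>j\<in>UNIV - {i}. K $ i $ j * a $ j)"
      by (intro sum.cong refl) (auto simp: a_def abs_mult offdiag)
    finally have "\<bar>K $ i $ i * v $ i\<bar> \<le> (\<Sum>j\<in>UNIV - {i}. K $ i $ j * a $ j)" .
    moreover have "- \<bar>K $ i $ i * v $ i\<bar> \<le> K $ i $ i * a $ i"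
    proof -
      have "\<bar>K $ i $ i * a $ i\<bar> = \<bar>K $ i $ i * v $ i\<bar>" by (simp add: a_def abs_mult)
      then show ?thesis by linarith
    qed
    ultimately show ?thesis unfolding split by simp
  qed
  have "(\<Sum>i\<in>UNIV. \<Sum>j\<in>UNIV. K $ i $ j * a $ j) = 0"
    by (subst sum.swap) (simp add: sum_distrib_right[symmetric] colsum)
  then have row: "(\<Sum>j\<in>UNIV. K $ i $ j * a $ j) = 0" for i
    using sum_nonneg_eq_0_iff[of UNIV "\<lambda>i. \<Sum>j\<in>UNIV. K $ i $ j * a $ j"] row_nonneg by auto
  have step: "a $ y = 0" if x: "a $ x = 0" and k: "K $ x $ y > 0" for x y
  proof -
    have "K $ x $ j * a $ j \<ge> 0" for j using x offdiag[of x j] by (cases "j = x") (auto simp: a_def)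
    then have "K $ x $ y * a $ y = 0"
      using sum_nonneg_eq_0_iff[of UNIV "\<lambda>j. K $ x $ j * a $ j"] row[of x] by auto
    then show ?thesis using k by simp
  qed
  have "a $ i > 0" for i
  proof (rule ccontr)
    assume "\<not> a $ i > 0"
    then have i: "a $ i = 0" by (auto simp: a_def)
    have "a $ j = 0" for j
    proof (cases "i = j")
      case False
      then obtain js where js: "js \<noteq> []" "hd js = i" "last js = j"
        "\<And>m. Suc m < length js \<Longrightarrow> K $ (js ! m) $ (js ! Suc m) > 0" using irred by blast
      have "m < length js \<Longrightarrow> a $ (js ! m) = 0" for m
      proof (induction m)
        case 0 then show ?case using js i by (simp add: hd_conv_nth)
      next
        case (Suc m) then show ?case using step js(4)[of m] by auto
      qed
      from this[of "length js - 1"] show ?thesis using js(1,3) by (simp add: last_conv_nth)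
    qed (use i in auto)
    then show False using v(2) by (auto simp: a_def vec_eq_iff)
  qed
  moreover have "K *v a = 0" using row by (simp add: vec_eq_iff matrix_vector_mult_def)
  ultimately show ?thesis using that by blast
qed

text \<open>The composition with \<open>max 0\<close> is the extension by zero, as \<open>f\<close> vanishes at 0.\<close>

lemma zero_extension_has_derivative:
  fixes f f' :: "real \<Rightarrow> 'a::real_normed_vector"
  assumes d: "\<And>x. x \<ge> 0 \<Longrightarrow> (f has_vector_derivative f' x) (at x within {0..})" and z: "f 0 = 0" "f' 0 = 0"
  shows "((\<lambda>x. f (max 0 x)) has_vector_derivative f' (max 0 x)) (at x)"
proof -
  consider "x > 0" | "x < 0" | "x = 0" by linarith
  then show ?thesis
  proof cases
    case 1
    then have "at x within {0..} = at x" by (intro at_within_interior) auto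
    then have "(f has_vector_derivative f' x) (at x)" using d[of x] 1 by simp
    then have "((\<lambda>x. f (max 0 x)) has_vector_derivative f' x) (at x)"
      by (rule has_vector_derivative_transform_within_open[where S="{0<..}"]) (use 1 in auto)
    then show ?thesis using 1 by simp
  next
    case 2
    have "((\<lambda>x. 0) has_vector_derivative 0) (at x)" by simp
    then have "((\<lambda>x. f (max 0 x)) has_vector_derivative 0) (at x)"
      by (rule has_vector_derivative_transform_within_open[where S="{..<0}"]) (use 2 z in auto)
    then show ?thesis using 2 z by simp
  next
    case 3
    have "((\<lambda>x. f (max 0 x)) has_vector_derivative 0) (at 0)"
      unfolding has_vector_derivative_def has_derivative_within_alt
    proof (intro conjI allI impI)
      show "bounded_linear (\<lambda>h::real. h *\<^sub>R (0 :: 'a))" by simp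
      fix e :: real assume e: "e > 0"
      have "\<forall>e>0. \<exists>\<delta>>0. \<forall>y\<in>{0..}. norm (y - 0) < \<delta> \<longrightarrow> norm (f y - f 0 - (y - 0) *\<^sub>R f' 0) \<le> e * norm (y - 0)"
        using d[of 0, unfolded has_vector_derivative_def has_derivative_within_alt] by blast
      from this[rule_format, OF e] obtain \<delta> where
        \<delta>: "\<delta> > 0" "\<And>y. y \<in> {0..} \<Longrightarrow> norm (y - 0) < \<delta> \<Longrightarrow> norm (f y - f 0 - (y - 0) *\<^sub>R f' 0) \<le> e * norm (y - 0)"
        by blast
      have "norm (f (max 0 y)) \<le> e * norm y" if "norm y < \<delta>" for y
      proof (cases "y \<ge> 0")
        case True then show ?thesis using \<delta>(2)[of y] that z by (simp add: max_def)
      next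
        case False then show ?thesis using z e by (simp add: max_def mult_nonneg_nonpos)
      qed
      then show "\<exists>\<delta>>0. \<forall>y\<in>UNIV. norm (y - 0) < \<delta> \<longrightarrow>
          norm (f (max 0 y) - f (max 0 0) - (y - 0) *\<^sub>R 0) \<le> e * norm (y - 0)"
        using \<delta>(1) z by auto
    qed
    then show ?thesis using 3 z by simp
  qed
qed

lemma uniformly_continuous_in_time_imp_jointly_continuous:
  fixes A :: "real \<Rightarrow> real \<Rightarrow> 'a::real_normed_vector"
  assumes A: "\<And>t. t \<ge> 0 \<Longrightarrow> continuous_on {0..} (A t)"
    and N: "\<And>t. t \<ge> 0 \<Longrightarrow> ((\<lambda>s. N s t) \<longlongrightarrow> (0::real)) (at t within {0..})"
    and b: "\<And>s t x. s \<ge> 0 \<Longrightarrow> t \<ge> 0 \<Longrightarrow> x \<ge> 0 \<Longrightarrow> norm (A s x - A t x) \<le> k * N s t"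
  shows "continuous_on ({0..} \<times> {0..}) (\<lambda>(x, t). A t x)"
  unfolding continuous_on_iff
proof (intro ballI allI impI)
  fix z and e :: real assume z: "z \<in> {0::real..} \<times> {0::real..}" and e: "e > 0"
  obtain x t where xt: "z = (x, t)" "x \<ge> 0" "t \<ge> 0" using z by auto
  have "((\<lambda>s. k * N s t) \<longlongrightarrow> k * 0) (at t within {0..})" by (intro tendsto_intros N xt)
  then have "\<forall>\<^sub>F s in at t within {0..}. k * N s t < e / 2" using e by (intro order_tendstoD(2)) auto
  then obtain d1 where d1: "d1 > 0" "\<And>s. s \<ge> 0 \<Longrightarrow> s \<noteq> t \<Longrightarrow> dist s t < d1 \<Longrightarrow> k * N s t < e / 2"
    unfolding eventually_at by auto
  obtain d2 where d2: "d2 > 0" "\<And>y. y \<ge> 0 \<Longrightarrow> dist y x < d2 \<Longrightarrow> dist (A t y) (A t x) < e / 2"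
    using A[OF xt(3)] xt(2) e unfolding continuous_on_iff by (metis atLeast_iff half_gt_zero)
  show "\<exists>d>0. \<forall>z'\<in>{0..} \<times> {0..}. dist z' z < d \<longrightarrow> dist (case z' of (x, t) \<Rightarrow> A t x) (case z of (x, t) \<Rightarrow> A t x) < e"
  proof (intro exI[of _ "min d1 d2"] conjI ballI impI)
    fix z' assume z': "z' \<in> {0::real..} \<times> {0::real..}" "dist z' z < min d1 d2"
    obtain y s where ys: "z' = (y, s)" "y \<ge> 0" "s \<ge> 0" using z' by auto
    have "dist y x \<le> dist z' z" "dist s t \<le> dist z' z"
      unfolding xt ys using dist_fst_le[of "(y, s)" "(x, t)"] dist_snd_le[of "(y, s)" "(x, t)"] by auto
    then have yx: "dist y x < d2" "dist s t < d1" using z' by auto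
    have "dist (A s y) (A t y) < e / 2"
    proof (cases "s = t")
      case True then show ?thesis using e by simp
    next
      case False
      then show ?thesis using b[OF ys(3) xt(3) ys(2)] d1(2)[OF ys(3) False yx(2)] by (simp add: dist_norm)
    qed
    moreover have "dist (A t y) (A t x) < e / 2" by (rule d2(2)[OF ys(2) yx(1)])
    ultimately have "dist (A s y) (A t x) < e" using dist_triangle[of "A s y" "A t x" "A t y"] by linarith
    then show "dist (case z' of (x, t) \<Rightarrow> A t x) (case z of (x, t) \<Rightarrow> A t x) < e" by (simp add: xt ys)
  qed (use d1 d2 in auto)
qed

text \<open>The embedding of H2 into \<open>C1\<close>, for differences, since continuity in time is expressed by their norms.\<close>

lemma H2_diff_pointwise:
  fixes f h :: "real \<Rightarrow> 'a::euclidean_space"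
  assumes f: "H2_on {0<..} f" "\<And>x. x \<ge> 0 \<Longrightarrow> (f has_vector_derivative f' x) (at x within {0..})"
    and h: "H2_on {0<..} h" "\<And>x. x \<ge> 0 \<Longrightarrow> (h has_vector_derivative h' x) (at x within {0..})"
    and x: "x \<ge> 0"
  shows "norm (f x - h x) \<le> sqrt 2 * H2_norm {0<..} (\<lambda>x. f x - h x)"
    "norm (f' x - h' x) \<le> sqrt 2 * H2_norm {0<..} (\<lambda>x. f x - h x)"
proof -
  obtain g where F: "L2_on {0<..} f" "L2_on {0<..} f'" "L2_on {0<..} g"
    "\<And>x. x \<ge> 0 \<Longrightarrow> f x = f 0 + integral {0..x} f'" "\<And>x. x \<ge> 0 \<Longrightarrow> f' x = f' 0 + integral {0..x} g"
    by (rule H2_on_regular[OF f]) (assumption, rule that, assumption+)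
  obtain k where H: "L2_on {0<..} h" "L2_on {0<..} h'" "L2_on {0<..} k"
    "\<And>x. x \<ge> 0 \<Longrightarrow> h x = h 0 + integral {0..x} h'" "\<And>x. x \<ge> 0 \<Longrightarrow> h' x = h' 0 + integral {0..x} k"
    by (rule H2_on_regular[OF h]) (assumption, rule that, assumption+)
  let ?N = "H2_norm {0<..} (\<lambda>x. f x - h x)"
  have L: "L2_on {0<..} (\<lambda>x. f x - h x)" "L2_on {0<..} (\<lambda>x. f' x - h' x)" "L2_on {0<..} (\<lambda>x. g x - k x)"
    by (intro L2_on_diff F H)+
  have 1: "f x - h x = (f 0 - h 0) + integral {0..x} (\<lambda>x. f' x - h' x)" if "x \<ge> 0" for x
    using F(4)[OF that] H(4)[OF that] integral_diff[OF L2_integrable_on[OF F(2)] L2_integrable_on[OF H(2)], of 0 x] by simp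
  have 2: "f' x - h' x = (f' 0 - h' 0) + integral {0..x} (\<lambda>x. g x - k x)" if "x \<ge> 0" for x
    using F(5)[OF that] H(5)[OF that] integral_diff[OF L2_integrable_on[OF F(3)] L2_integrable_on[OF H(3)], of 0 x] by simp
  have N: "?N\<^sup>2 = sqnorm (\<lambda>x. f x - h x) + sqnorm (\<lambda>x. f' x - h' x) + sqnorm (\<lambda>x. g x - k x)"
    by (rule H2_on_primitive(2)[OF L 1 2]) auto
  have sq: "(norm (f x - h x))\<^sup>2 \<le> (sqrt 2 * ?N)\<^sup>2" "(norm (f' x - h' x))\<^sup>2 \<le> (sqrt 2 * ?N)\<^sup>2"
    unfolding power_mult_distrib real_sqrt_pow2[OF zero_le_numeral] using L2_primitive_bound[OF L(1,2) 1 x] L2_primitive_bound[OF L(2,3) 2 x] N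
      sqnorm_nonneg[of "\<lambda>x. f x - h x"] sqnorm_nonneg[of "\<lambda>x. g x - k x"] by linarith+
  have "0 \<le> sqrt 2 * ?N" by (simp add: H2_norm_nonneg)
  then show "norm (f x - h x) \<le> sqrt 2 * ?N" "norm (f' x - h' x) \<le> sqrt 2 * ?N"
    by (rule power2_le_imp_le[OF sq(1)], rule power2_le_imp_le[OF sq(2)])
qed

context transport
begin

lemma H2_solution:
  assumes d: "\<And>x. x \<ge> 0 \<Longrightarrow> (f has_vector_derivative f' x) (at x within {0..})"
    and H: "H2_on {0<..} f" and z: "f 0 = 0" "f' 0 = 0" and ab: "lam $ a > lam $ b"
  obtains u p where "mild (\<lambda>x. f (max 0 x)) u"
    "\<And>x t. t \<ge> 0 \<Longrightarrow> ((\<lambda>x. u x t) has_vector_derivative p x t) (at x)"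
    "\<And>x t. t \<ge> 0 \<Longrightarrow> ((\<lambda>s. u x s) has_vector_derivative K *v u x t - (\<chi> i. lam $ i * p x t $ i)) (at t within {0..})"
    "\<And>t. t \<ge> 0 \<Longrightarrow> u 0 t = 0"
    "continuous_into_H2 {0<..} (\<lambda>t x. u x t)"
    "\<And>e. e > 0 \<Longrightarrow> \<exists>T. \<forall>t\<ge>T. \<forall>x. norm (u x t) \<le> e"
proof -
  obtain g where R: "L2_on {0<..} f" "L2_on {0<..} f'" "L2_on {0<..} g"
    "\<And>x. x \<ge> 0 \<Longrightarrow> f x = f 0 + integral {0..x} f'" "\<And>x. x \<ge> 0 \<Longrightarrow> f' x = f' 0 + integral {0..x} g"
    by (rule H2_on_regular[OF H d]) (assumption, rule that, assumption+)
  define F where "F x = f (max 0 x)" for x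
  define F' where "F' x = f' (max 0 x)" for x
  have Fd: "(F has_vector_derivative F' x) (at x)" for x
    unfolding F_def[abs_def] F'_def by (rule zero_extension_has_derivative[OF d z])
  have Fc: "continuous_on A F" for A
    using Fd by (meson continuous_at_imp_continuous_on has_vector_derivative_continuous)
  have f'c: "continuous_on {0..b} f'" for b
    by (rule continuous_on_eq[of _ "\<lambda>x. f' 0 + integral {0..x} g"]) (auto intro!: continuous_intros L2_primitive_continuous R simp: R(5)[symmetric])
  have F'c: "continuous_on UNIV F'"
  proof (rule continuous_at_imp_continuous_on, rule ballI)
    fix x :: real
    have "continuous_on {x - 1<..<x + 1} F'" unfolding F'_def
      by (rule continuous_on_compose2[OF f'c[of "max 0 (x + 1)"]]) (auto intro!: continuous_intros)
    then show "isCont F' x" by (simp add: continuous_on_eq_continuous_at)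
  qed
  have F0: "F x = 0" "F' x = 0" if "x \<le> 0" for x using that z by (auto simp: F_def F'_def)
  have AEpos: "AE x in half_line. 0 < x" by (rule AE_I2) auto
  have LF: "L2_on {0<..} F" by (rule L2_on_cong_AE[OF R(1)]) (use AEpos in \<open>auto simp: F_def elim!: eventually_mono\<close>)
  have LF': "L2_on {0<..} F'" by (rule L2_on_cong_AE[OF R(2)]) (use AEpos in \<open>auto simp: F'_def elim!: eventually_mono\<close>)
  have tl: "(F \<longlongrightarrow> 0) at_top" "(F' \<longlongrightarrow> 0) at_top"
  proof -
    have ev: "\<forall>\<^sub>F x::real in at_top. x \<ge> 0" by (rule eventually_ge_at_top)
    have "(f \<longlongrightarrow> 0) at_top" by (rule L2_primitive_tendsto_0[OF R(1,2,4)])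
    then show "(F \<longlongrightarrow> 0) at_top" by (rule Lim_transform_eventually) (auto simp: F_def intro!: eventually_mono[OF ev])
    have "(f' \<longlongrightarrow> 0) at_top" by (rule L2_primitive_tendsto_0[OF R(2,3,5)])
    then show "(F' \<longlongrightarrow> 0) at_top" by (rule Lim_transform_eventually) (auto simp: F'_def intro!: eventually_mono[OF ev])
  qed
  have Fb: "norm (F x) \<le> sqrt (2 * sqnorm f + 2 * sqnorm f')" for x
    unfolding F_def by (rule real_le_rsqrt, rule L2_primitive_bound[OF R(1,2,4)]) auto
  have F'b: "norm (F' x) \<le> sqrt (2 * sqnorm f' + 2 * sqnorm g)" for x
    unfolding F'_def by (rule real_le_rsqrt, rule L2_primitive_bound[OF R(2,3,5)]) auto
  obtain u where u: "mild F u" using mild_exists[OF Fc Fb] .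
  obtain p where p: "mild F' p" using mild_exists[OF F'c F'b] .
  have F'I: "F' x = integral {0..x} g" for x
    using R(5)[of x] z F0(2)[of x] by (cases "x \<le> 0") (auto simp: F'_def max_def elim!: less_eq_real_def[THEN iffD1, THEN disjE])
  obtain Z where Z: "\<And>t. t \<ge> 0 \<Longrightarrow> L2_on {0<..} (Z t)"
    "\<And>t. t \<ge> 0 \<Longrightarrow> ((\<lambda>s. sqnorm (\<lambda>x. Z s x - Z t x)) \<longlongrightarrow> 0) (at t within {0..})"
    "\<And>x t. t \<ge> 0 \<Longrightarrow> x \<ge> 0 \<Longrightarrow> p x t = integral {0..x} (Z t)"
    by (rule mild_primitive[OF R(3) p F'I]) (rule that, assumption+)
  have ux: "((\<lambda>x. u x t) has_vector_derivative p x t) (at x)" if "t \<ge> 0" for x t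
    by (rule mild_space_derivative[OF u p Fd F'c F0(2) that])
  have ut: "((\<lambda>s. u x s) has_vector_derivative K *v u x t - (\<chi> i. lam $ i * p x t $ i)) (at t within {0..})" if "t \<ge> 0" for x t
    by (rule mild_time_derivative[OF u mild_continuous[OF p] ux that])
  have u0: "u 0 t = 0" if "t \<ge> 0" for t by (rule mild_zero_left[OF u F0(1) order_refl that])
  have Lu: "L2_on {0<..} (\<lambda>x. u x t)" "((\<lambda>s. sqnorm (\<lambda>x. u x s - u x t)) \<longlongrightarrow> 0) (at t within {0..})" if "t \<ge> 0" for t
    by (rule mild_L2_continuous[OF u Fc F0(1) tl(1) LF that]; assumption)+
  have Lp: "L2_on {0<..} (\<lambda>x. p x t)" "((\<lambda>s. sqnorm (\<lambda>x. p x s - p x t)) \<longlongrightarrow> 0) (at t within {0..})" if "t \<ge> 0" for t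
    by (rule mild_L2_continuous[OF p F'c F0(2) tl(2) LF' that]; assumption)+
  have uI: "u x t = integral {0..x} (\<lambda>y. p y t)" if "t \<ge> 0" "x \<ge> 0" for x t
  proof -
    have "((\<lambda>y. p y t) has_integral (u x t - u 0 t)) {0..x}"
      by (rule fundamental_theorem_of_calculus[OF that(2)]) (rule has_vector_derivative_at_within[OF ux[OF that(1)]])
    then show ?thesis using u0[OF that(1)] by (simp add: integral_unique)
  qed
  have H2: "continuous_into_H2 {0<..} (\<lambda>t x. u x t)"
    unfolding continuous_into_H2_def
  proof (intro conjI allI impI)
    fix t :: real assume t: "t \<ge> 0"
    show "H2_on {0<..} (\<lambda>x. u x t)"
      by (rule H2_on_primitive(1)[OF Lu(1)[OF t] Lp(1)[OF t] Z(1)[OF t], of 0 0]) (use uI Z(3) t in auto)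
    have eq: "H2_norm {0<..} (\<lambda>x. u x s - u x t) = sqrt (sqnorm (\<lambda>x. u x s - u x t) + sqnorm (\<lambda>x. p x s - p x t) + sqnorm (\<lambda>x. Z s x - Z t x))"
      if s: "s \<ge> 0" for s
    proof -
      have "(H2_norm {0<..} (\<lambda>x. u x s - u x t))\<^sup>2 = sqnorm (\<lambda>x. u x s - u x t) + sqnorm (\<lambda>x. p x s - p x t) + sqnorm (\<lambda>x. Z s x - Z t x)"
      proof (rule H2_on_primitive(2)[where c=0 and d=0])
        fix x :: real assume x: "x > 0"
        then have x: "x \<ge> 0" by simp
        show "u x s - u x t = 0 + integral {0..x} (\<lambda>x. p x s - p x t)"
          unfolding uI[OF s x] uI[OF t x]
          using integral_diff[OF L2_integrable_on[OF Lp(1)[OF s]] L2_integrable_on[OF Lp(1)[OF t]], of 0 x] by simp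
        show "p x s - p x t = 0 + integral {0..x} (\<lambda>x. Z s x - Z t x)"
          unfolding Z(3)[OF s x] Z(3)[OF t x]
          using integral_diff[OF L2_integrable_on[OF Z(1)[OF s]] L2_integrable_on[OF Z(1)[OF t]], of 0 x] by simp
      qed (intro L2_on_diff Lu(1) Lp(1) Z(1) s t)+
      then show ?thesis by (rule real_sqrt_unique[symmetric, OF _ H2_norm_nonneg])
    qed
    have "((\<lambda>s. sqrt (sqnorm (\<lambda>x. u x s - u x t) + sqnorm (\<lambda>x. p x s - p x t) + sqnorm (\<lambda>x. Z s x - Z t x))) \<longlongrightarrow> sqrt (0 + 0 + 0)) (at t within {0..})"
      by (intro tendsto_intros Lu(2) Lp(2) Z(2) t)
    then have "((\<lambda>s. sqrt (sqnorm (\<lambda>x. u x s - u x t) + sqnorm (\<lambda>x. p x s - p x t) + sqnorm (\<lambda>x. Z s x - Z t x))) \<longlongrightarrow> 0) (at t within {0..})"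
      by simp
    then show "((\<lambda>s. H2_norm {0<..} (\<lambda>x. u x s - u x t)) \<longlongrightarrow> 0) (at t within {0..})"
      by (rule Lim_transform_within[OF _ zero_less_one]) (simp add: eq)
  qed
  have dec: "\<exists>T. \<forall>t\<ge>T. \<forall>x. norm (u x t) \<le> e" if e: "e > 0" for e
  proof -
    obtain T where "\<And>t x. t \<ge> T \<Longrightarrow> norm (u x t) \<le> e"
      by (rule decay[OF u Fc F0(1) tl(1) LF ab e]) (assumption, rule that, assumption)
    then show ?thesis by blast
  qed
  show ?thesis by (rule that[OF u[unfolded F_def[abs_def]] ux ut u0 H2 dec])
qed

text \<open>A solution is only assumed to have partial derivatives at each point.  Continuity in time with values in H2 makes
  the solution and its derivative in \<open>x\<close> jointly continuous.  The equation on the boundary forces the derivative in \<open>x\<close> to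
  vanish there because the solution does, and the extension by zero is again a solution.\<close>

lemma H2_solution_is_mild:
  assumes vx: "\<And>x t. x \<ge> 0 \<Longrightarrow> t \<ge> 0 \<Longrightarrow> ((\<lambda>y. v y t) has_vector_derivative q x t) (at x within {0..})"
    and vt: "\<And>x t. x \<ge> 0 \<Longrightarrow> t \<ge> 0 \<Longrightarrow> ((\<lambda>s. v x s) has_vector_derivative K *v v x t - (\<chi> i. lam $ i * q x t $ i)) (at t within {0..})"
    and v0: "\<And>t. t \<ge> 0 \<Longrightarrow> v 0 t = 0"
    and H: "continuous_into_H2 {0<..} (\<lambda>t x. v x t)"
  shows "mild (\<lambda>x. v (max 0 x) 0) (\<lambda>x t. v (max 0 x) t)"
proof (rule classical_imp_mild[where p="\<lambda>x t. q (max 0 x) t"])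
  have H2: "H2_on {0<..} (\<lambda>x. v x t)" if "t \<ge> 0" for t using H that by (simp add: continuous_into_H2_def)
  have lim: "((\<lambda>s. H2_norm {0<..} (\<lambda>x. v x s - v x t)) \<longlongrightarrow> 0) (at t within {0..})" if "t \<ge> 0" for t
    using H that by (simp add: continuous_into_H2_def)
  have vc: "continuous_on {0..} (\<lambda>x. v x t)" if "t \<ge> 0" for t
    using vx[OF _ that] by (auto simp: continuous_on_eq_continuous_within intro: has_vector_derivative_continuous)
  have qc: "continuous_on {0..} (\<lambda>x. q x t)" if t: "t \<ge> 0" for t
  proof -
    obtain g where R: "L2_on {0<..} g" "\<And>x. x \<ge> 0 \<Longrightarrow> q x t = q 0 t + integral {0..x} g"
      by (rule H2_on_regular[OF H2[OF t] vx[OF _ t]]) (assumption, rule that, assumption+)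
    have c: "continuous_on {0..b} (\<lambda>x. q x t)" for b
      by (rule continuous_on_eq[of _ "\<lambda>x. q 0 t + integral {0..x} g"]) (auto intro!: continuous_intros L2_primitive_continuous R simp: R(2)[symmetric])
    show ?thesis by (rule continuous_on_atLeast_0[OF c])
  qed
  have jv: "continuous_on ({0..} \<times> {0..}) (\<lambda>(x, t). v x t)"
    by (rule uniformly_continuous_in_time_imp_jointly_continuous[where A="\<lambda>t x. v x t", OF vc lim])
      (auto intro: H2_diff_pointwise(1)[OF H2 vx H2 vx])
  have jq: "continuous_on ({0..} \<times> {0..}) (\<lambda>(x, t). q x t)"
    by (rule uniformly_continuous_in_time_imp_jointly_continuous[where A="\<lambda>t x. q x t", OF qc lim])
      (auto intro: H2_diff_pointwise(2)[OF H2 vx H2 vx])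
  have q0: "q 0 t = 0" if t: "t \<ge> 0" for t
  proof -
    have "((\<lambda>s. v 0 s) has_vector_derivative 0) (at t within {0..})"
      by (rule has_vector_derivative_transform[of _ _ _ "\<lambda>_. 0"]) (use t v0 in auto)
    moreover have "at t within {0..} \<noteq> bot"
    proof -
      have "t islimpt {t..t + 1}" by (simp add: islimpt_Icc)
      then have "t islimpt {0..}" by (rule islimpt_subset) (use t in auto)
      then show ?thesis by (simp add: trivial_limit_within)
    qed
    ultimately have "K *v v 0 t - (\<chi> i. lam $ i * q 0 t $ i) = 0"
      using vector_derivative_unique_within[OF _ vt[of 0 t]] t by auto
    then have "lam $ i * q 0 t $ i = 0" for i using v0[OF t] by (simp add: vec_eq_iff)
    then show ?thesis using lam_pos by (auto simp: vec_eq_iff less_imp_neq[THEN not_sym])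
  qed
  have sw: "continuous_on (UNIV \<times> {0..}) (\<lambda>z::real \<times> real. (max 0 (fst z), snd z))" by (intro continuous_intros)
  have im: "(\<lambda>z::real \<times> real. (max 0 (fst z), snd z)) ` (UNIV \<times> {0..}) \<subseteq> {0..} \<times> {0..}" by auto
  show "continuous_on (UNIV \<times> {0..}) (\<lambda>(x, t). v (max 0 x) t)" "continuous_on (UNIV \<times> {0..}) (\<lambda>(x, t). q (max 0 x) t)"
    using continuous_on_compose2[OF jv sw im] continuous_on_compose2[OF jq sw im] by (simp_all add: split_beta)
  show "((\<lambda>x. v (max 0 x) t) has_vector_derivative q (max 0 x) t) (at x)" if "t \<ge> 0" for x t
    by (rule zero_extension_has_derivative[where f="\<lambda>x. v x t" and f'="\<lambda>x. q x t", OF vx[OF _ that]]) (use v0 q0 that in auto)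
  show "((\<lambda>s. v (max 0 x) s) has_vector_derivative K *v v (max 0 x) t - (\<chi> i. lam $ i * q (max 0 x) t $ i)) (at t within {0..})" if "t \<ge> 0" for x t
    by (rule vt) (use that in auto)
  show "v (max 0 x) t = 0" if "t \<ge> 0" "x \<le> 0" for x t using v0 that by simp
qed

end

lemma diag_matrix_mult: "diag_matrix l *v x = (\<chi> i. l $ i * x $ i)"
  by (simp add: diag_matrix_def matrix_vector_mult_def vec_eq_iff if_distrib[of "\<lambda>x. x * _"] cong: if_cong)

lemma diag_matrix_invertible:
  assumes "\<And>i. l $ i \<noteq> 0" shows "invertible (diag_matrix l)"
proof -
  have "diag_matrix l ** diag_matrix (\<chi> i. 1 / l $ i) = mat 1" "diag_matrix (\<chi> i. 1 / l $ i) ** diag_matrix l = mat 1"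
    using assms by (auto simp: diag_matrix_def matrix_matrix_mult_def mat_def vec_eq_iff if_distrib[of "\<lambda>x. x * _"] if_distrib[of "\<lambda>x. _ * x"] cong: if_cong)
  then show ?thesis unfolding invertible_def by blast
qed

theorem theorem3p2:
  fixes K :: "real ^ 'r ^ 'r"
    and lam :: "real ^ 'r"
    and U\<^sub>0 U\<^sub>0\<^sub>x B :: "real \<Rightarrow> real ^ 'r"
  defines "\<Lambda> \<equiv> diag_matrix lam"
  assumes offdiag: "\<And>i j. i \<noteq> j \<Longrightarrow> K $ i $ j \<ge> 0"
    and colsum: "\<And>j. (\<Sum>i\<in>UNIV. K $ i $ j) = 0"
    and irred: "\<And>i\<^sub>0 i\<^sub>1. i\<^sub>0 \<noteq> i\<^sub>1 \<Longrightarrow>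
      \<exists>js. js \<noteq> [] \<and> hd js = i\<^sub>0 \<and> last js = i\<^sub>1 \<and>
           (\<forall>m. Suc m < length js \<longrightarrow> K $ (js ! m) $ (js ! Suc m) > 0)"
    and distinct_speeds: "\<exists>i j. lam $ i \<noteq> lam $ j"
    and pos_speeds: "\<And>i. lam $ i > 0"
    and U0_deriv: "\<And>x. x \<ge> 0 \<Longrightarrow> (U\<^sub>0 has_vector_derivative U\<^sub>0\<^sub>x x) (at x within {0..})"
    and U0_C1: "continuous_on {0..} U\<^sub>0\<^sub>x"
    and B_eq: "\<And>x. x \<ge> 0 \<Longrightarrow> B x = steady_state \<Lambda> K (U\<^sub>0 0) x"
    and U0_H2: "H2_on {0<..} (\<lambda>x. U\<^sub>0 x - B x)"
    and compat: "\<Lambda> *v U\<^sub>0\<^sub>x 0 = K *v U\<^sub>0 0"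
  shows "\<exists>U. ibvp_solution \<Lambda> K U\<^sub>0 U \<and>
             continuous_into_H2 {0<..} (\<lambda>t x. U x t - B x) \<and>
             (\<forall>V. ibvp_solution \<Lambda> K U\<^sub>0 V \<and>
                  continuous_into_H2 {0<..} (\<lambda>t x. V x t - B x) \<longrightarrow>
                  (\<forall>x\<ge>0. \<forall>t\<ge>0. V x t = U x t)) \<and>
             ((\<lambda>t. SUP x\<in>{0<..}. ereal (norm (U x t - B x))) \<longlongrightarrow> 0) at_top"
proof -
  obtain w where w: "\<And>i. w $ i > 0" "K *v w = 0"
    by (rule perron_vector[OF offdiag colsum irred]) (assumption | rule that)+
  interpret transport K lam w
    by unfold_locales (fact offdiag colsum irred w pos_speeds)+
  obtain a b where ab: "lam $ a > lam $ b" using distinct_speeds by (metis linorder_neqE)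
  have inv: "invertible \<Lambda>" unfolding \<Lambda>_def
    by (rule diag_matrix_invertible) (use pos_speeds in \<open>auto simp: less_imp_neq[THEN not_sym]\<close>)
  have \<Lambda>: "\<Lambda> *v x = (\<chi> i. lam $ i * x $ i)" for x unfolding \<Lambda>_def by (rule diag_matrix_mult)
  have \<Lambda>_inj: "x = y" if "\<Lambda> *v x = \<Lambda> *v y" for x y
  proof -
    have "lam $ i * x $ i = lam $ i * y $ i" for i using that unfolding \<Lambda> vec_eq_iff by simp
    then show ?thesis using pos_speeds by (auto simp: vec_eq_iff less_imp_neq[THEN not_sym])
  qed
  obtain B' where B': "\<And>x. (steady_state \<Lambda> K (U\<^sub>0 0) has_vector_derivative B' x) (at x)"
    "\<And>x. \<Lambda> *v B' x = K *v steady_state \<Lambda> K (U\<^sub>0 0) x" "steady_state \<Lambda> K (U\<^sub>0 0) 0 = U\<^sub>0 0"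
    by (rule steady_state_solves[OF inv]) (rule that, assumption+)
  have Bd: "(B has_vector_derivative B' x) (at x within {0..})" if "x \<ge> 0" for x
    by (rule has_vector_derivative_transform[OF _ _ has_vector_derivative_at_within[OF B'(1)]]) (use that B_eq in auto)
  have BK: "\<Lambda> *v B' x = K *v B x" if "x \<ge> 0" for x using B'(2) B_eq[OF that] by simp
  have B0: "B 0 = U\<^sub>0 0" using B_eq[of 0] B'(3) by simp
  define f where "f x = U\<^sub>0 x - B x" for x
  define f' where "f' x = U\<^sub>0\<^sub>x x - B' x" for x
  have fd: "(f has_vector_derivative f' x) (at x within {0..})" if "x \<ge> 0" for x
    unfolding f_def[abs_def] f'_def by (intro has_vector_derivative_diff U0_deriv Bd that)
  have f0: "f 0 = 0" by (simp add: f_def B0)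
  have f'0: "f' 0 = 0" using \<Lambda>_inj[of "U\<^sub>0\<^sub>x 0" "B' 0"] compat BK[of 0] B0 by (simp add: f'_def)
  have fH: "H2_on {0<..} f" unfolding f_def[abs_def] by (rule U0_H2)
  obtain u p where u: "mild (\<lambda>x. f (max 0 x)) u"
    and ux: "\<And>x t. t \<ge> 0 \<Longrightarrow> ((\<lambda>x. u x t) has_vector_derivative p x t) (at x)"
    and ut: "\<And>x t. t \<ge> 0 \<Longrightarrow> ((\<lambda>s. u x s) has_vector_derivative K *v u x t - (\<chi> i. lam $ i * p x t $ i)) (at t within {0..})"
    and u0: "\<And>t. t \<ge> 0 \<Longrightarrow> u 0 t = 0"
    and uH: "continuous_into_H2 {0<..} (\<lambda>t x. u x t)"
    and dec: "\<And>e. e > 0 \<Longrightarrow> \<exists>T. \<forall>t\<ge>T. \<forall>x. norm (u x t) \<le> e"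
    by (rule H2_solution[OF fd fH f0 f'0 ab]) (assumption, rule that, assumption+)
  define U where "U x t = u x t + B x" for x t
  have UB: "U x t - B x = u x t" for x t by (simp add: U_def)
  have sol: "ibvp_solution \<Lambda> K U\<^sub>0 U"
    unfolding ibvp_solution_def
  proof (intro conjI allI impI)
    fix x t :: real assume x: "x \<ge> 0" and t: "t \<ge> 0"
    show "\<exists>Ut Ux. ((\<lambda>s. U x s) has_vector_derivative Ut) (at t within {0..}) \<and>
        ((\<lambda>y. U y t) has_vector_derivative Ux) (at x within {0..}) \<and> Ut + \<Lambda> *v Ux = K *v U x t"
    proof (intro exI conjI)
      show "((\<lambda>s. U x s) has_vector_derivative K *v u x t - (\<chi> i. lam $ i * p x t $ i)) (at t within {0..})"
        unfolding U_def using has_vector_derivative_add[OF ut[OF t, of x] has_vector_derivative_const[of "B x"]] by simp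
      show "((\<lambda>y. U y t) has_vector_derivative p x t + B' x) (at x within {0..})"
        unfolding U_def by (intro has_vector_derivative_add has_vector_derivative_at_within[OF ux[OF t]] Bd x)
      show "K *v u x t - (\<chi> i. lam $ i * p x t $ i) + \<Lambda> *v (p x t + B' x) = K *v U x t"
        unfolding U_def matrix_vector_right_distrib BK[OF x] \<Lambda>[symmetric] by simp
    qed
  next
    fix x :: real assume "x \<ge> 0"
    then show "U x 0 = U\<^sub>0 x" using mild_initial[OF u, of x] by (simp add: U_def f_def)
  next
    fix t :: real assume "t \<ge> 0"
    then show "U 0 t = U\<^sub>0 0" using u0 by (simp add: U_def B0)
  qed
  have uniq: "V x t = U x t" if V: "ibvp_solution \<Lambda> K U\<^sub>0 V" and VH: "continuous_into_H2 {0<..} (\<lambda>t x. V x t - B x)"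
    and x: "x \<ge> 0" and t: "t \<ge> 0" for V x t
  proof -
    define v where "v x t = V x t - B x" for x t
    have "\<forall>x t. \<exists>Vt Vx. x \<ge> 0 \<longrightarrow> t \<ge> 0 \<longrightarrow> ((\<lambda>s. V x s) has_vector_derivative Vt) (at t within {0..}) \<and>
        ((\<lambda>y. V y t) has_vector_derivative Vx) (at x within {0..}) \<and> Vt + \<Lambda> *v Vx = K *v V x t"
      using V unfolding ibvp_solution_def by blast
    then obtain Vt Vx where VV: "\<And>x t. x \<ge> 0 \<Longrightarrow> t \<ge> 0 \<Longrightarrow> ((\<lambda>s. V x s) has_vector_derivative Vt x t) (at t within {0..})"
        "\<And>x t. x \<ge> 0 \<Longrightarrow> t \<ge> 0 \<Longrightarrow> ((\<lambda>y. V y t) has_vector_derivative Vx x t) (at x within {0..})"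
        "\<And>x t. x \<ge> 0 \<Longrightarrow> t \<ge> 0 \<Longrightarrow> Vt x t + \<Lambda> *v Vx x t = K *v V x t"
      by metis
    have "mild (\<lambda>x. v (max 0 x) 0) (\<lambda>x t. v (max 0 x) t)"
    proof (rule H2_solution_is_mild[where q="\<lambda>x t. Vx x t - B' x"])
      fix x t :: real assume x: "x \<ge> 0" and t: "t \<ge> 0"
      show "((\<lambda>y. v y t) has_vector_derivative Vx x t - B' x) (at x within {0..})"
        unfolding v_def by (intro has_vector_derivative_diff VV(2) Bd x t)
      have "K *v v x t - (\<chi> i. lam $ i * (Vx x t - B' x) $ i) = Vt x t"
      proof -
        have "\<Lambda> *v (Vx x t - B' x) = (K *v V x t - Vt x t) - K *v B x"
          unfolding matrix_vector_mult_diff_distrib BK[OF x] VV(3)[OF x t, symmetric] by simp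
        then show ?thesis unfolding \<Lambda>[symmetric] v_def matrix_vector_mult_diff_distrib by simp
      qed
      then show "((\<lambda>s. v x s) has_vector_derivative K *v v x t - (\<chi> i. lam $ i * (Vx x t - B' x) $ i)) (at t within {0..})"
        unfolding v_def using has_vector_derivative_diff[OF VV(1)[OF x t] has_vector_derivative_const[of "B x"]] by simp
    next
      fix t :: real assume "t \<ge> 0"
      then show "v 0 t = 0" using V by (simp add: ibvp_solution_def v_def B0)
    qed (use VH in \<open>simp add: v_def\<close>)
    moreover have "(\<lambda>x. v (max 0 x) 0) = (\<lambda>x. f (max 0 x))"
      using V by (auto simp: ibvp_solution_def v_def f_def)
    ultimately have "v (max 0 x) t = u x t" using mild_unique[OF _ u t] by metis
    then show ?thesis using x by (simp add: v_def U_def diff_eq_eq)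
  qed
  have "((\<lambda>t. SUP x\<in>{0<..}. ereal (norm (U x t - B x))) \<longlongrightarrow> 0) at_top"
    unfolding UB
  proof (rule order_tendstoI)
    fix l :: ereal assume l: "l < 0"
    have "l < (SUP x\<in>{0<..}. ereal (norm (u x t)))" for t
    proof -
      have "0 \<le> ereal (norm (u 1 t))" by simp
      also have "\<dots> \<le> (SUP x\<in>{0<..}. ereal (norm (u x t)))" by (rule SUP_upper) auto
      finally show ?thesis using l by (rule less_le_trans[rotated])
    qed
    then show "\<forall>\<^sub>F t in at_top. l < (SUP x\<in>{0<..}. ereal (norm (u x t)))" by simp
  next
    fix l :: ereal assume l: "0 < l"
    obtain e where e: "0 < e" "ereal e < l" using ereal_dense2[OF l] by auto
    obtain T where T: "\<And>t x. t \<ge> T \<Longrightarrow> norm (u x t) \<le> e" using dec[OF e(1)] by blast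
    have "(SUP x\<in>{0<..}. ereal (norm (u x t))) < l" if "t \<ge> T" for t
    proof -
      have "(SUP x\<in>{0<..}. ereal (norm (u x t))) \<le> ereal e" by (rule SUP_least) (use T that in auto)
      then show ?thesis using e(2) by (rule le_less_trans)
    qed
    then show "\<forall>\<^sub>F t in at_top. (SUP x\<in>{0<..}. ereal (norm (u x t))) < l"
      unfolding eventually_at_top_linorder by blast
  qed
  moreover have "continuous_into_H2 {0<..} (\<lambda>t x. U x t - B x)" unfolding UB by (rule uH)
  moreover have "\<forall>V. ibvp_solution \<Lambda> K U\<^sub>0 V \<and> continuous_into_H2 {0<..} (\<lambda>t x. V x t - B x) \<longrightarrow>
      (\<forall>x\<ge>0. \<forall>t\<ge>0. V x t = U x t)"
    by (intro allI impI, elim conjE) (rule uniq)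
  ultimately show ?thesis using sol by blast
qed


end
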